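(* Every locally connected minimal torsion-free abelian group is trivial.
   Context: All topological groups are assumed Hausdorff. A Hausdorff topological group $G$ is minimal if every continuous group isomorphism $f:G\to H$ onto a Hausdorff topological group $H$ is a topological isomorphism (equivalently, $G$ admits no strictly coarser Hausdorff group topology). Local connectedness refers to the topology of the minimal topological group. *)

theory Defs
  imports "HOL-Analysis.Analysis" "HOL-Algebra.Elementary_Groups"
begin

definition hausdorff_topological_group :: "('a, 'm) monoid_scheme \<Rightarrow> 'a topology \<Rightarrow> bool" where
  "hausdorff_topological_group G T \<longleftrightarrow>
     group G \<and> topspace T = carrier G \<and> Hausdorff_space T \<and>
     continuous_map (prod_topology T T) T (\<lambda>(x, y). x \<otimes>\<^bsub>G\<^esub> y) \<and>
     continuous_map T T (\<lambda>x. inv\<^bsub>G\<^esub> x)"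

(* H ranges over groups whose carrier lies in the same type as that of G, since a definition
   cannot quantify over types. This loses nothing: minimal_topological_group_iso below gives
   the condition for H over an arbitrary type, and minimal_topological_group_iff_coarser gives
   the equivalent formulation by coarser group topologies. *)
definition minimal_topological_group :: "('a, 'm) monoid_scheme \<Rightarrow> 'a topology \<Rightarrow> bool" where
  "minimal_topological_group G T \<longleftrightarrow>
     hausdorff_topological_group G T \<and>
     (\<forall>(H :: 'a monoid) S f.
        hausdorff_topological_group H S \<and> f \<in> iso G H \<and> continuous_map T S f
        \<longrightarrow> homeomorphic_map T S f)"

definition torsion_free_group :: "('a, 'm) monoid_scheme \<Rightarrow> bool" where
  "torsion_free_group G \<longleftrightarrow>
     (\<forall>x \<in> carrier G. \<forall>n::nat. n > 0 \<and> x [^]\<^bsub>G\<^esub> n = \<one>\<^bsub>G\<^esub> \<longrightarrow> x = \<one>\<^bsub>G\<^esub>)"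

lemma hausdorff_topological_group_pullback:
  fixes G :: "('a, 'm) monoid_scheme" and H :: "('b, 'n) monoid_scheme"
  assumes G: "group G" and H: "hausdorff_topological_group H S" and f: "f \<in> iso G H"
  shows "hausdorff_topological_group G (pullback_topology (carrier G) f S)"
    and "homeomorphic_map (pullback_topology (carrier G) f S) S f"
proof -
  let ?P = "pullback_topology (carrier G) f S"
  have gH: "group H" and tS: "topspace S = carrier H" and hS: "Hausdorff_space S"
    and mS: "continuous_map (prod_topology S S) S (\<lambda>(x, y). x \<otimes>\<^bsub>H\<^esub> y)"
    and iS: "continuous_map S S (\<lambda>x. inv\<^bsub>H\<^esub> x)"
    using H by (auto simp: hausdorff_topological_group_def)
  have hom: "f \<in> hom G H" and bij: "bij_betw f (carrier G) (carrier H)"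
    using f by (auto simp: iso_def)
  interpret f: group_hom G H f
    using G gH hom by (simp add: group_hom.intro group_hom_axioms_def)
  have im: "f ` carrier G = carrier H" and inj: "inj_on f (carrier G)"
    using bij by (auto simp: bij_betw_def)
  have tP: "topspace ?P = carrier G"
    using im tS by (auto simp: topspace_pullback_topology)
  have cf: "continuous_map ?P S f"
    using continuous_map_pullback[OF continuous_map_id[of S], of "carrier G" f] by (simp add: id_def comp_def)
  have into: "continuous_map X ?P g"
    if "continuous_map X S (f \<circ> g)" "topspace X \<subseteq> g -` carrier G" for X :: "'z topology" and g
    using continuous_map_pullback'[OF that] .
  show "hausdorff_topological_group G ?P"
    unfolding hausdorff_topological_group_def
  proof (intro conjI)
    show "Hausdorff_space ?P"
      using Hausdorff_space_injective_preimage[OF hS cf] inj tP by simp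
    have pm: "continuous_map (prod_topology ?P ?P) (prod_topology S S) (\<lambda>(x, y). (f x, f y))"
      using cf by (simp add: continuous_map_prod_top)
    have "continuous_map (prod_topology ?P ?P) S
            ((\<lambda>(x, y). x \<otimes>\<^bsub>H\<^esub> y) \<circ> (\<lambda>(x, y). (f x, f y)))"
      using continuous_map_compose[OF pm mS] .
    then have "continuous_map (prod_topology ?P ?P) S (f \<circ> (\<lambda>(x, y). x \<otimes>\<^bsub>G\<^esub> y))"
      by (rule continuous_map_eq) (auto simp: tP)
    then show "continuous_map (prod_topology ?P ?P) ?P (\<lambda>(x, y). x \<otimes>\<^bsub>G\<^esub> y)"
      by (rule into) (auto simp: tP)
    have "continuous_map ?P S ((\<lambda>x. inv\<^bsub>H\<^esub> x) \<circ> f)"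
      using continuous_map_compose[OF cf iS] .
    then have "continuous_map ?P S (f \<circ> (\<lambda>x. inv\<^bsub>G\<^esub> x))"
      by (rule continuous_map_eq) (auto simp: tP)
    then show "continuous_map ?P ?P (\<lambda>x. inv\<^bsub>G\<^esub> x)"
      by (rule into) (auto simp: tP)
  qed (use G tP in auto)
  let ?g = "inv_into (carrier G) f"
  have gS: "\<And>y. y \<in> carrier H \<Longrightarrow> ?g y \<in> carrier G \<and> f (?g y) = y"
    using im by (metis f_inv_into_f inv_into_into)
  have "continuous_map S S (f \<circ> ?g)"
    by (rule continuous_map_eq[OF continuous_map_id]) (use gS tS in auto)
  then have "continuous_map S ?P ?g"
    by (rule into) (use gS tS in auto)
  then have "homeomorphic_maps ?P S f ?g"
    using cf gS inj tP tS by (auto simp: homeomorphic_maps_def)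
  then show "homeomorphic_map ?P S f"
    using homeomorphic_maps_map by blast
qed

lemma coarser_imp_iso:
  assumes T: "hausdorff_topological_group G T"
    and min: "\<And>S. hausdorff_topological_group G S \<Longrightarrow> (\<And>U. openin S U \<Longrightarrow> openin T U) \<Longrightarrow> S = T"
    and H: "hausdorff_topological_group H S" and f: "f \<in> iso G H" and c: "continuous_map T S f"
  shows "homeomorphic_map T S f"
proof -
  let ?P = "pullback_topology (carrier G) f S"
  have G: "group G" and tT: "topspace T = carrier G"
    using T by (auto simp: hausdorff_topological_group_def)
  have "openin T U" if U: "openin ?P U" for U
  proof -
    obtain V where V: "openin S V" "U = f -` V \<inter> carrier G"
      using U by (auto simp: openin_pullback_topology)
    have "openin T {x \<in> topspace T. f x \<in> V}"
      using openin_continuous_map_preimage[OF c V(1)] .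
    moreover have "{x \<in> topspace T. f x \<in> V} = U"
      using V(2) tT by auto
    ultimately show ?thesis by simp
  qed
  then have "?P = T"
    using min hausdorff_topological_group_pullback(1)[OF G H f] by blast
  then show ?thesis
    using hausdorff_topological_group_pullback(2)[OF G H f] by simp
qed

lemma minimal_imp_coarser:
  fixes G :: "('a, 'm) monoid_scheme"
  assumes min: "minimal_topological_group G T" and S: "hausdorff_topological_group G S"
    and le: "\<And>U. openin S U \<Longrightarrow> openin T U"
  shows "S = T"
proof -
  define H :: "'a monoid" where "H = \<lparr>carrier = carrier G, mult = mult G, one = one G\<rparr>"
  have tT: "topspace T = carrier G" and tS: "topspace S = carrier G" and G: "group G"
    using min S by (auto simp: minimal_topological_group_def hausdorff_topological_group_def)
  interpret group G by (rule G)
  have gH: "group H"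
    by (rule groupI) (auto simp: H_def m_assoc intro: l_inv_ex)
  have "id \<in> iso H G"
    by (auto simp: iso_def hom_def H_def)
  then have "hausdorff_topological_group H (pullback_topology (carrier H) id S)"
    using hausdorff_topological_group_pullback(1)[OF gH S] by blast
  moreover have "pullback_topology (carrier H) id S = S"
    unfolding topology_eq openin_pullback_topology
    using openin_subset[of S] tS by (auto simp: H_def Int_absorb2)
  ultimately have "hausdorff_topological_group H S" by simp
  moreover have "id \<in> iso G H"
    by (auto simp: iso_def hom_def H_def)
  moreover have "continuous_map T S id"
    unfolding continuous_map
  proof (intro conjI allI impI)
    fix U assume U: "openin S U"
    then have "{x \<in> topspace T. id x \<in> U} = U"
      using openin_subset[OF U] tS tT by auto
    then show "openin T {x \<in> topspace T. id x \<in> U}" using le U by simp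
  qed (use tS tT in auto)
  ultimately have "homeomorphic_map T S id"
    using min unfolding minimal_topological_group_def by blast
  then show ?thesis by simp
qed

lemma minimal_topological_group_iso:
  fixes H :: "('b, 'n) monoid_scheme"
  assumes "minimal_topological_group G T" "hausdorff_topological_group H S"
    and "f \<in> iso G H" "continuous_map T S f"
  shows "homeomorphic_map T S f"
proof (rule coarser_imp_iso[OF _ _ assms(2-4)])
  show "hausdorff_topological_group G T"
    using assms(1) unfolding minimal_topological_group_def by blast
  show "S' = T" if "hausdorff_topological_group G S'" "\<And>U. openin S' U \<Longrightarrow> openin T U" for S'
    using minimal_imp_coarser[OF assms(1)] that .
qed

lemma minimal_topological_group_iff_coarser:
  "minimal_topological_group G T \<longleftrightarrow>
     hausdorff_topological_group G T \<and>
     (\<forall>S. hausdorff_topological_group G S \<and> (\<forall>U. openin S U \<longrightarrow> openin T U) \<longrightarrow> S = T)"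
  (is "?L \<longleftrightarrow> ?R")
proof
  assume ?L
  then show ?R
    using minimal_imp_coarser[of G T] unfolding minimal_topological_group_def by blast
next
  assume R: ?R
  then have "homeomorphic_map T S f"
    if "hausdorff_topological_group H S" "f \<in> iso G H" "continuous_map T S f"
    for H :: "'a monoid" and S f
    using coarser_imp_iso[OF _ _ that] by blast
  with R show ?L
    unfolding minimal_topological_group_def by blast
qed

end

theory Submission
  imports Defs "HOL-Algebra.Free_Abelian_Groups" "HOL-Computational_Algebra.Primes"
begin

text \<open>Let \<open>a\<close> be a sequence in a minimal Abelian group. The sets \<open>U + {\<Sum>r. a (i r) - a (j r) | i r, j r \<in> S r}\<close>, with \<open>U\<close> a
  neighbourhood of \<open>0\<close> and \<open>S r\<close> large index sets, generate a coarser group topology; if it is Hausdorff, minimality forces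
  the differences of \<open>a\<close> to become small. Sufficiently independent sequences contradict this. Hence for each
  neighbourhood \<open>U\<close> some set \<open>{y. k y \<in> U}\<close> with \<open>k > 0\<close> has finitely many translates covering the group, and only
  primes \<open>p\<close> for which \<open>p G\<close> has infinite index modulo some neighbourhood are needed in \<open>k\<close>. In the torsion-free
  case a second sequence, independent modulo all such primes, shows that there are none: \<open>G\<close> is precompact.

  On a precompact group, convolution operators are compact, and power iteration yields a convolution
  idempotent \<open>P\<close>. The norm \<open>\<rho>\<close> with \<open>\<rho>(x)\<^sup>2 = 2 (P(0) - P(x))\<close> satisfies \<open>\<rho>(2x)\<^sup>2 \<ge> \<rho>(x)\<^sup>2 (4 - \<rho>(x)\<^sup>2)\<close>, so it nearly doubles
  under doubling of a small element. Minimality makes multiplication by \<open>2\<close> an embedding, and in the subgroup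
  generated by a small connected neighbourhood \<open>\<rho>\<close> is forced to vanish: every element is nearly divisible
  by each \<open>2\<^sup>s\<close>, with quotients built from a bounded number of elements of norm at most \<open>(2 / 3)\<^sup>s\<close>. So the group is
  discrete, hence finite, hence trivial.\<close>

section \<open>Invariant means on Abelian groups\<close>

definition zmul :: "int \<Rightarrow> 'a::ab_group_add \<Rightarrow> 'a" where
  "zmul k x = (((+) x) ^^ nat k) 0 - (((+) x) ^^ nat (- k)) 0"

lemma zmul_0 [simp]: "zmul 0 x = 0"
  by (simp add: zmul_def)

lemma zmul_plus1: "zmul (k + 1) x = zmul k x + x"
proof (cases "k \<ge> 0")
  case True
  then have "nat (k + 1) = Suc (nat k)" by simp
  then show ?thesis using True by (simp add: zmul_def add.commute)
next
  case False
  then have "nat (- k) = Suc (nat (- (k + 1)))" "nat k = 0" "nat (k + 1) = 0" by simp_all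
  then show ?thesis by (simp add: zmul_def)
qed

lemma zmul_add_left: "zmul (k + l) x = zmul k x + zmul l x"
proof (induction l rule: int_induct[where k = 0])
  case (step1 i)
  then show ?case
    using zmul_plus1[of "k + i" x] zmul_plus1[of i x] by (simp add: add.assoc)
next
  case (step2 i)
  then show ?case
    using zmul_plus1[of "k + i - 1" x] zmul_plus1[of "i - 1" x] by (simp add: algebra_simps)
qed simp

lemma zmul_one: "zmul 1 x = x"
  using zmul_plus1[of 0 x] by simp

lemma zmul_minus_left: "zmul (- k) x = - zmul k x"
  using zmul_add_left[of "- k" k x] by (simp add: eq_neg_iff_add_eq_0)

lemma zmul_add_right: "zmul k (x + y) = zmul k x + zmul k y"
proof (induction k rule: int_induct[where k = 0])
  case (step1 i)
  then show ?case by (simp only: zmul_plus1) (simp add: algebra_simps)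
next
  case (step2 i)
  then show ?case
    using zmul_plus1[of "i - 1" x] zmul_plus1[of "i - 1" y] zmul_plus1[of "i - 1" "x + y"]
    by (simp add: algebra_simps)
qed simp

lemma zmul_zmul: "zmul k (zmul l x) = zmul (k * l) x"
proof (induction k rule: int_induct[where k = 0])
  case (step1 i)
  then show ?case by (simp add: zmul_plus1 zmul_add_left distrib_right zmul_one)
next
  case (step2 i)
  then show ?case
    using zmul_plus1[of "i - 1" "zmul l x"] zmul_add_left[of "(i - 1) * l" l x]
    by (simp add: algebra_simps)
qed simp

interpretation zmul: module zmul
  by unfold_locales (simp_all add: zmul_add_left zmul_add_right zmul_zmul zmul_one)

lemma zmul_two: "zmul 2 x = x + x"
  using zmul_add_left[of 1 1 x] by (simp add: zmul_one)

definition bdd :: "('x \<Rightarrow> real) \<Rightarrow> bool" where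
  "bdd f \<longleftrightarrow> (\<exists>B. \<forall>x. \<bar>f x\<bar> \<le> B)"

lemma bddI: "(\<And>x. \<bar>f x\<bar> \<le> B) \<Longrightarrow> bdd f"
  unfolding bdd_def by blast

lemma bddE: assumes "bdd f" obtains B where "B > 0" "\<And>x. \<bar>f x\<bar> \<le> B"
proof -
  obtain B where B: "\<And>x. \<bar>f x\<bar> \<le> B" using assms bdd_def by blast
  have "\<bar>f x\<bar> \<le> \<bar>B\<bar> + 1" for x using B[of x] by linarith
  then show ?thesis using that[of "\<bar>B\<bar> + 1"] by simp
qed

lemma bdd_const [simp, intro]: "bdd (\<lambda>_. c)"
  by (rule bddI[of _ "\<bar>c\<bar>"]) simp

lemma bdd_add [intro]: assumes "bdd f" "bdd g" shows "bdd (\<lambda>x. f x + g x)"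
proof -
  obtain A B where "\<And>x. \<bar>f x\<bar> \<le> A" "\<And>x. \<bar>g x\<bar> \<le> B"
    using assms bdd_def by metis
  then have "\<bar>f x + g x\<bar> \<le> A + B" for x
    by (meson abs_triangle_ineq add_mono order_trans)
  then show ?thesis by (rule bddI)
qed

lemma bdd_mult [intro]: assumes "bdd f" "bdd g" shows "bdd (\<lambda>x. f x * g x)"
proof -
  obtain A B where *: "A > 0" "\<And>x. \<bar>f x\<bar> \<le> A" "\<And>x. \<bar>g x\<bar> \<le> B"
    using assms bddE by metis
  have "\<bar>f x * g x\<bar> \<le> A * B" for x
    using *(1) *(2)[of x] *(3)[of x] by (simp add: abs_mult mult_mono)
  then show ?thesis by (rule bddI)
qed

lemma bdd_cmult [intro]: "bdd f \<Longrightarrow> bdd (\<lambda>x. c * f x)"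
  using bdd_mult[OF bdd_const] .

lemma bdd_minus [intro]: "bdd f \<Longrightarrow> bdd (\<lambda>x. - f x)"
  unfolding bdd_def by simp

lemma bdd_diff [intro]: "bdd f \<Longrightarrow> bdd g \<Longrightarrow> bdd (\<lambda>x. f x - g x)"
  using bdd_add[of f "\<lambda>x. - g x"] by (auto simp: bdd_minus)

lemma bdd_comp: "bdd f \<Longrightarrow> bdd (\<lambda>x. f (h x))"
  unfolding bdd_def by blast

lemma bdd_sum [intro]: "(\<And>i. i \<in> I \<Longrightarrow> bdd (f i)) \<Longrightarrow> bdd (\<lambda>x. \<Sum>i\<in>I. f i x)"
  by (induction I rule: infinite_finite_induct) auto

lemma bdd_divide [intro]: "bdd f \<Longrightarrow> bdd (\<lambda>x. f x / c)"
  using bdd_mult[of f "\<lambda>_. inverse c"] by (simp add: divide_inverse)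

lemma bdd_power2 [intro]: "bdd f \<Longrightarrow> bdd (\<lambda>x. (f x)\<^sup>2)"
  using bdd_mult[of f f] by (simp add: power2_eq_square)

lemma bdd_indicator [intro, simp]: "bdd (indicat_real S)"
  by (rule bddI[of _ 1]) (simp add: indicator_def)

definition mean :: "(('x \<Rightarrow> real) \<Rightarrow> real) \<Rightarrow> bool" where
  "mean m \<longleftrightarrow>
     (\<forall>f g. bdd f \<longrightarrow> bdd g \<longrightarrow> m (\<lambda>x. f x + g x) = m f + m g) \<and>
     (\<forall>f c. bdd f \<longrightarrow> m (\<lambda>x. c * f x) = c * m f) \<and>
     (\<forall>f. bdd f \<longrightarrow> (\<forall>x. 0 \<le> f x) \<longrightarrow> 0 \<le> m f) \<and>
     m (\<lambda>_. 1) = 1"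

lemma mean_add: "mean m \<Longrightarrow> bdd f \<Longrightarrow> bdd g \<Longrightarrow> m (\<lambda>x. f x + g x) = m f + m g"
  and mean_cmult: "mean m \<Longrightarrow> bdd f \<Longrightarrow> m (\<lambda>x. c * f x) = c * m f"
  and mean_nonneg: "mean m \<Longrightarrow> bdd f \<Longrightarrow> (\<And>x. 0 \<le> f x) \<Longrightarrow> 0 \<le> m f"
  and mean_one: "mean m \<Longrightarrow> m (\<lambda>_. 1) = 1"
  unfolding mean_def by blast+

lemma mean_const: "mean m \<Longrightarrow> m (\<lambda>_. c) = c"
  using mean_cmult[of m "\<lambda>_. 1" c] by (simp add: mean_one)

lemma mean_multc: "mean m \<Longrightarrow> bdd f \<Longrightarrow> m (\<lambda>x. f x * c) = m f * c"
  using mean_cmult[of m f c] by (simp add: mult.commute)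

lemma mean_divide: "mean m \<Longrightarrow> bdd f \<Longrightarrow> m (\<lambda>x. f x / c) = m f / c"
  using mean_multc[of m f "inverse c"] by (simp add: divide_inverse)

lemma mean_minus: "mean m \<Longrightarrow> bdd f \<Longrightarrow> m (\<lambda>x. - f x) = - m f"
  using mean_cmult[of m f "-1"] by simp

lemma mean_diff: "mean m \<Longrightarrow> bdd f \<Longrightarrow> bdd g \<Longrightarrow> m (\<lambda>x. f x - g x) = m f - m g"
  using mean_add[of m f "\<lambda>x. - g x"] mean_minus[of m g] by (simp add: bdd_minus)

lemma mean_mono:
  assumes "mean m" "bdd f" "bdd g" "\<And>x. f x \<le> g x" shows "m f \<le> m g"
  using mean_nonneg[OF assms(1) bdd_diff[OF assms(3,2)]] mean_diff[OF assms(1,3,2)] assms(4) by simp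

lemma mean_sum:
  "mean m \<Longrightarrow> (\<And>i. i \<in> I \<Longrightarrow> bdd (f i)) \<Longrightarrow> m (\<lambda>x. \<Sum>i\<in>I. f i x) = (\<Sum>i\<in>I. m (f i))"
proof (induction I rule: infinite_finite_induct)
  case (insert i I)
  then show ?case using mean_add[of m "f i" "\<lambda>x. \<Sum>i\<in>I. f i x"] by (auto simp: bdd_sum)
qed (simp_all add: mean_const)

lemma mean_abs_le:
  assumes "mean m" "bdd f" "\<And>x. \<bar>f x\<bar> \<le> B" shows "\<bar>m f\<bar> \<le> B"
proof -
  have "m f \<le> B" "- B \<le> m f"
    using mean_mono[OF assms(1,2), of "\<lambda>_. B"] mean_mono[OF assms(1) _ assms(2), of "\<lambda>_. - B"] assms(3)
    by (auto simp: mean_const[OF assms(1)] abs_le_iff) (metis abs_le_D2 minus_le_iff)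
  then show ?thesis by (simp add: abs_le_iff)
qed

lemma mean_dist_le:
  assumes "mean m" "bdd f" "bdd g" "\<And>x. \<bar>f x - g x\<bar> \<le> B" shows "\<bar>m f - m g\<bar> \<le> B"
  using mean_abs_le[OF assms(1) bdd_diff[OF assms(2,3)] assms(4)] mean_diff[OF assms(1-3)] by simp

lemma mean_CS:
  assumes m: "mean m" and f: "bdd f" and g: "bdd g"
  shows "(m (\<lambda>x. f x * g x))\<^sup>2 \<le> m (\<lambda>x. (f x)\<^sup>2) * m (\<lambda>x. (g x)\<^sup>2)"
proof -
  let ?a = "m (\<lambda>x. (f x)\<^sup>2)" and ?b = "m (\<lambda>x. f x * g x)" and ?c = "m (\<lambda>x. (g x)\<^sup>2)"
  have *: "0 \<le> s\<^sup>2 * ?a + 2 * s * t * ?b + t\<^sup>2 * ?c" for s t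
  proof -
    have "0 \<le> m (\<lambda>x. (s * f x + t * g x)\<^sup>2)"
      using f g by (intro mean_nonneg[OF m] bdd_power2 bdd_add bdd_cmult) auto
    also have "(\<lambda>x. (s * f x + t * g x)\<^sup>2) = (\<lambda>x. s\<^sup>2 * (f x)\<^sup>2 + (2 * s * t) * (f x * g x) + t\<^sup>2 * (g x)\<^sup>2)"
      by (auto simp: power2_eq_square algebra_simps)
    also have "m \<dots> = s\<^sup>2 * ?a + 2 * s * t * ?b + t\<^sup>2 * ?c"
    proof -
      have "bdd (\<lambda>x. (f x)\<^sup>2)" "bdd (\<lambda>x. f x * g x)" "bdd (\<lambda>x. (g x)\<^sup>2)"
        using f g by (auto intro: bdd_power2 bdd_mult)
      then show ?thesis
        by (simp only: mean_add[OF m] mean_cmult[OF m] bdd_add bdd_cmult)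
    qed
    finally show ?thesis .
  qed
  have a: "0 \<le> ?a" and c: "0 \<le> ?c" using f g by (auto intro!: mean_nonneg[OF m])
  show ?thesis
  proof (cases "?c = 0")
    case True
    have "?b = 0"
    proof (rule ccontr)
      assume "?b \<noteq> 0"
      have "0 \<le> ?a + 2 * (- (?a + 1) / (2 * ?b)) * ?b"
        using *[of 1 "- (?a + 1) / (2 * ?b)"] True by simp
      then show False using \<open>?b \<noteq> 0\<close> by (simp add: field_simps)
    qed
    then show ?thesis using True by simp
  next
    case False
    then have c: "0 < ?c" using c by simp
    have "0 \<le> ?c\<^sup>2 * ?a - 2 * ?c * ?b * ?b + ?b\<^sup>2 * ?c"
      using *[of ?c "- ?b"] by simp
    also have "\<dots> = ?c * (?a * ?c - ?b\<^sup>2)"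
      by (simp add: power2_eq_square algebra_simps)
    finally have "0 \<le> ?a * ?c - ?b\<^sup>2"
      using c by (simp add: zero_le_mult_iff)
    then show ?thesis by simp
  qed
qed

definition invariant_mean :: "(('a::ab_group_add \<Rightarrow> real) \<Rightarrow> real) \<Rightarrow> bool" where
  "invariant_mean m \<longleftrightarrow> mean m \<and> (\<forall>f a. bdd f \<longrightarrow> m (\<lambda>x. f (x + a)) = m f) \<and>
     (\<forall>f. bdd f \<longrightarrow> m (\<lambda>x. f (- x)) = m f)"

lemma closed_means:
  "closed {m :: ('x \<Rightarrow> real) \<Rightarrow> real. mean m}"
proof -
  have *: "closed {m :: ('x \<Rightarrow> real) \<Rightarrow> real. m (\<lambda>x. f x + g x) = m f + m g}"
     "closed {m :: ('x \<Rightarrow> real) \<Rightarrow> real. m (\<lambda>x. c * f x) = c * m f}"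
     "closed {m :: ('x \<Rightarrow> real) \<Rightarrow> real. 0 \<le> m f}"
     "closed {m :: ('x \<Rightarrow> real) \<Rightarrow> real. m (\<lambda>_. 1) = 1}" for f g c
    by (intro closed_Collect_eq closed_Collect_le continuous_intros continuous_on_product_coordinates)+
  have "{m :: ('x \<Rightarrow> real) \<Rightarrow> real. mean m} =
     (\<Inter>f\<in>Collect bdd. \<Inter>g\<in>Collect bdd. {m. m (\<lambda>x. f x + g x) = m f + m g}) \<inter>
     (\<Inter>f\<in>Collect bdd. \<Inter>c. {m. m (\<lambda>x. c * f x) = c * m f}) \<inter>
     (\<Inter>f\<in>{f. bdd f \<and> (\<forall>x. 0 \<le> f x)}. {m. 0 \<le> m f}) \<inter> {m. m (\<lambda>_. 1) = 1}"
    by (auto simp: mean_def)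
  also have "closed \<dots>"
    by (intro closed_Int closed_INT ballI *)
  finally show ?thesis .
qed

lemma ex_translation_invariant_mean:
  "\<exists>m :: ('a::ab_group_add \<Rightarrow> real) \<Rightarrow> real. mean m \<and> (\<forall>f a. bdd f \<longrightarrow> m (\<lambda>x. f (x + a)) = m f)"
proof -
  define M where "M = {m :: ('a \<Rightarrow> real) \<Rightarrow> real. mean m \<and> (\<forall>f. \<not> bdd f \<longrightarrow> m f = 0)}"
  define N :: "('a \<Rightarrow> real) \<Rightarrow> real" where "N f = (if bdd f then SUP x. \<bar>f x\<bar> else 0)" for f
  have N: "\<bar>f x\<bar> \<le> N f" if "bdd f" for f x
    using that unfolding N_def bdd_def by (auto intro!: cSUP_upper bdd_aboveI2)
  have N0: "0 \<le> N f" for f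
    using N[of f 0] by (cases "bdd f") (auto simp: N_def)
  have "compact (PiE UNIV (\<lambda>f. {- N f..N f}))"
    using compactin_PiE[of "\<lambda>_. euclidean" UNIV "\<lambda>f. {- N f..N f}"]
    by (simp add: euclidean_product_topology)
  moreover have "closed M"
  proof -
    have "closed {m :: ('a \<Rightarrow> real) \<Rightarrow> real. m f = 0}" for f
      by (intro closed_Collect_eq continuous_intros continuous_on_product_coordinates)
    then have "closed ({m :: ('a \<Rightarrow> real) \<Rightarrow> real. mean m} \<inter> (\<Inter>f\<in>{f. \<not> bdd f}. {m. m f = 0}))"
      by (intro closed_Int closed_INT ballI closed_means)
    then show ?thesis unfolding M_def by (rule back_subst[of closed]) auto
  qed
  moreover have "M \<subseteq> PiE UNIV (\<lambda>f. {- N f..N f})"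
  proof
    fix m assume m: "m \<in> M"
    have "\<bar>m f\<bar> \<le> N f" for f
      using m mean_abs_le[of m f "N f"] N[of f] N0[of f] by (cases "bdd f") (auto simp: M_def)
    then show "m \<in> PiE UNIV (\<lambda>f. {- N f..N f})" by (auto simp: abs_le_iff minus_le_iff)
  qed
  ultimately have cM: "compact M"
    by (metis compact_Int_closed inf.absorb_iff2)
  define Z where "Z = (\<lambda>(a :: 'a, n :: nat). {m :: ('a \<Rightarrow> real) \<Rightarrow> real. 
      \<forall>f. bdd f \<longrightarrow> \<bar>m (\<lambda>x. f (x + a)) - m f\<bar> \<le> 2 * N f / Suc n})"
  have clZ: "closed (Z i)" for i
  proof -
    obtain a n where i: "i = (a, n)" by fastforce
    have "closed {m :: ('a \<Rightarrow> real) \<Rightarrow> real. \<bar>m (\<lambda>x. f (x + a)) - m f\<bar> \<le> 2 * N f / Suc n}" for f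
      by (intro closed_Collect_le continuous_intros continuous_on_product_coordinates)
    then have "closed (\<Inter>f\<in>Collect bdd. {m :: ('a \<Rightarrow> real) \<Rightarrow> real. \<bar>m (\<lambda>x. f (x + a)) - m f\<bar> \<le> 2 * N f / Suc n})"
      by blast
    then show ?thesis unfolding Z_def i by (rule back_subst[of closed]) auto
  qed
  have fip: "M \<inter> (\<Inter>i\<in>I. Z i) \<noteq> {}" if "finite I" for I
    using that
  proof (induction I rule: finite_induct)
    case empty
    have "(\<lambda>f. if bdd f then f 0 else 0) \<in> M"
      by (auto simp: M_def mean_def)
    then show ?case by auto
  next
    case (insert i I)
    then obtain m where m: "m \<in> M" "\<And>j. j \<in> I \<Longrightarrow> m \<in> Z j" by auto
    then have mm: "mean m" by (simp add: M_def)
    obtain a n where i: "i = (a, n)" by fastforce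
    define L where "L f = (\<lambda>x. (\<Sum>j<Suc n. f (x + zmul (int j) a)) / Suc n)" for f :: "'a \<Rightarrow> real"
    define m' where "m' f = (if bdd f then m (L f) else 0)" for f
    have Lb: "bdd (L f)" if "bdd f" for f
      unfolding L_def by (rule bdd_divide, rule bdd_sum, rule bdd_comp, rule that)
    have LN: "\<bar>L f x\<bar> \<le> N f" if "bdd f" for f x
    proof -
      have "\<bar>\<Sum>j<Suc n. f (x + zmul (int j) a)\<bar> \<le> (\<Sum>j<Suc n. N f)"
        by (rule order_trans[OF sum_abs sum_mono]) (use N that in blast)
      then show ?thesis by (simp add: L_def field_simps)
    qed
    have "mean m'"
      unfolding mean_def
    proof (intro conjI allI impI)
      fix f g :: "'a \<Rightarrow> real" assume fg: "bdd f" "bdd g"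
      have "L (\<lambda>x. f x + g x) = (\<lambda>x. L f x + L g x)"
        by (auto simp: L_def sum.distrib add_divide_distrib)
      then show "m' (\<lambda>x. f x + g x) = m' f + m' g"
        using fg mean_add[OF mm Lb Lb] by (simp add: m'_def bdd_add)
    next
      fix f :: "'a \<Rightarrow> real" and c assume f: "bdd f"
      have "L (\<lambda>x. c * f x) = (\<lambda>x. c * L f x)"
        by (auto simp: L_def sum_distrib_left[symmetric])
      then show "m' (\<lambda>x. c * f x) = c * m' f"
        using f mean_cmult[OF mm Lb] bdd_cmult[of f c] by (simp add: m'_def)
    next
      fix f :: "'a \<Rightarrow> real" assume f: "bdd f" "\<forall>x. 0 \<le> f x"
      then have "0 \<le> L f x" for x
        unfolding L_def by (intro divide_nonneg_nonneg sum_nonneg) auto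
      then show "0 \<le> m' f" using f mean_nonneg[OF mm Lb] by (simp add: m'_def)
    next
      have "L (\<lambda>_. 1) = (\<lambda>_. 1)" by (auto simp: L_def)
      then show "m' (\<lambda>_. 1) = 1" by (simp add: m'_def mean_one[OF mm])
    qed
    then have "m' \<in> M" by (simp add: M_def m'_def)
    moreover have "m' \<in> Z j" if "j \<in> I" for j
    proof -
      obtain b k where j: "j = (b, k)" by fastforce
      have "\<bar>m' (\<lambda>x. f (x + b)) - m' f\<bar> \<le> 2 * N f / Suc k" if f: "bdd f" for f
      proof -
        have "m \<in> Z j" using m that \<open>j \<in> I\<close> by blast
        then have "\<bar>m (\<lambda>x. L f (x + b)) - m (L f)\<bar> \<le> 2 * N (L f) / Suc k"
          using Lb[OF f] by (simp add: Z_def j)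
        also have "\<dots> \<le> 2 * N f / Suc k"
          using LN[OF f] Lb[OF f] by (intro divide_right_mono mult_left_mono) (auto simp: N_def intro!: cSUP_least)
        also have "(\<lambda>x. L f (x + b)) = L (\<lambda>x. f (x + b))"
          by (auto simp: L_def algebra_simps)
        finally show ?thesis using f bdd_comp[OF f, of "\<lambda>x. x + b"]
          by (simp only: m'_def if_True)
      qed
      then show ?thesis by (simp add: Z_def j)
    qed
    moreover have "m' \<in> Z i"
    proof -
      have "\<bar>m' (\<lambda>x. f (x + a)) - m' f\<bar> \<le> 2 * N f / Suc n" if f: "bdd f" for f
      proof -
        have "L (\<lambda>x. f (x + a)) x - L f x = (f (x + zmul (int (Suc n)) a) - f x) / Suc n" for x
        proof -
          have "(\<Sum>j<Suc n. f (x + zmul (int j) a + a)) = (\<Sum>j<Suc n. f (x + zmul (int (Suc j)) a))"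
            by (intro sum.cong) (simp_all add: zmul_plus1 algebra_simps zmul_one)
          then have "(\<Sum>j<Suc n. f (x + zmul (int j) a + a)) - (\<Sum>j<Suc n. f (x + zmul (int j) a))
             = f (x + zmul (int (Suc n)) a) - f x"
            using sum_lessThan_telescope[of "\<lambda>j. f (x + zmul (int j) a)" "Suc n"] by (simp only: sum_subtractf) simp
          then show ?thesis by (simp only: L_def diff_divide_distrib[symmetric])
        qed
        moreover have "\<bar>(f (x + zmul (int (Suc n)) a) - f x) / Suc n\<bar> \<le> 2 * N f / Suc n" for x
        proof -
          have "\<bar>f (x + zmul (int (Suc n)) a) - f x\<bar> \<le> 2 * N f"
            using N[OF f, of x] N[OF f, of "x + zmul (int (Suc n)) a"] by linarith
          then show ?thesis by (simp only: abs_divide abs_of_nat) (rule divide_right_mono; simp)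
        qed
        ultimately have "\<bar>m (L (\<lambda>x. f (x + a))) - m (L f)\<bar> \<le> 2 * N f / Suc n"
          using f by (intro mean_dist_le[OF mm Lb Lb]) (simp_all only: bdd_comp[of f "\<lambda>x. x + a"])
        then show ?thesis using f bdd_comp[OF f, of "\<lambda>x. x + a"]
          by (simp only: m'_def if_True)
      qed
      then show ?thesis by (simp add: Z_def i)
    qed
    ultimately show ?case by auto
  qed
  have "M \<inter> (\<Inter>i\<in>UNIV. Z i) \<noteq> {}"
    by (rule compact_imp_fip_image[OF cM clZ fip])
  then obtain m where m: "m \<in> M" "\<And>i. m \<in> Z i" by auto
  have "m (\<lambda>x. f (x + a)) = m f" if f: "bdd f" for f a
  proof (rule ccontr)
    assume "m (\<lambda>x. f (x + a)) \<noteq> m f"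
    then have d: "0 < \<bar>m (\<lambda>x. f (x + a)) - m f\<bar>" by simp
    then obtain n where n: "2 * N f < real n * \<bar>m (\<lambda>x. f (x + a)) - m f\<bar>"
      using reals_Archimedean3[OF d] by blast
    have "\<bar>m (\<lambda>x. f (x + a)) - m f\<bar> \<le> 2 * N f / Suc n"
      using m(2)[of "(a, n)"] f by (simp add: Z_def)
    then have "Suc n * \<bar>m (\<lambda>x. f (x + a)) - m f\<bar> \<le> 2 * N f" by (simp add: field_simps)
    with n d show False by (simp add: algebra_simps)
  qed
  then show ?thesis using m(1) by (auto simp: M_def)
qed

lemma ex_invariant_mean: "\<exists>m :: ('a::ab_group_add \<Rightarrow> real) \<Rightarrow> real. invariant_mean m"
proof -
  obtain m :: "('a \<Rightarrow> real) \<Rightarrow> real" where m: "mean m" "\<And>f a. bdd f \<Longrightarrow> m (\<lambda>x. f (x + a)) = m f"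
    using ex_translation_invariant_mean by blast
  define m' where "m' f = (m f + m (\<lambda>x. f (- x))) / 2" for f
  have "mean m'"
    unfolding mean_def m'_def
  proof (intro conjI allI impI)
    fix f g :: "'a \<Rightarrow> real" assume "bdd f" "bdd g"
    then show "(m (\<lambda>x. f x + g x) + m (\<lambda>x. f (- x) + g (- x))) / 2
        = (m f + m (\<lambda>x. f (- x))) / 2 + (m g + m (\<lambda>x. g (- x))) / 2"
      by (simp add: mean_add[OF m(1)] bdd_comp[of _ uminus] add_divide_distrib)
  next
    fix f :: "'a \<Rightarrow> real" and c assume "bdd f"
    then show "(m (\<lambda>x. c * f x) + m (\<lambda>x. c * f (- x))) / 2 = c * ((m f + m (\<lambda>x. f (- x))) / 2)"
      by (simp add: mean_cmult[OF m(1)] bdd_comp[of _ uminus] distrib_left)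
  next
    fix f :: "'a \<Rightarrow> real" assume f: "bdd f" "\<forall>x. 0 \<le> f x"
    then have "0 \<le> m f" "0 \<le> m (\<lambda>x. f (- x))"
      by (auto intro!: mean_nonneg[OF m(1)] bdd_comp[of _ uminus])
    then show "0 \<le> (m f + m (\<lambda>x. f (- x))) / 2" by simp
  qed (simp add: mean_one[OF m(1)])
  moreover have "m' (\<lambda>x. f (x + a)) = m' f" if f: "bdd f" for f a
    using m(2)[OF f, of a] m(2)[OF bdd_comp[OF f, of uminus], of "- a"] by (simp add: m'_def algebra_simps)
  moreover have "m' (\<lambda>x. f (- x)) = m' f" for f
    by (simp add: m'_def)
  ultimately show ?thesis unfolding invariant_mean_def by blast
qed

section \<open>Minimal group topologies and sequences\<close>

lemma invariant_meanD:
  assumes "invariant_mean m"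
  shows "mean m" "bdd f \<Longrightarrow> m (\<lambda>x. f (x + a)) = m f" "bdd f \<Longrightarrow> m (\<lambda>x. f (- x)) = m f"
  using assms unfolding invariant_mean_def by blast+

definition big :: "'a::ab_group_add set \<Rightarrow> bool" where
  "big A \<longleftrightarrow> (\<exists>F. finite F \<and> (\<forall>x. \<exists>f\<in>F. x - f \<in> A))"

lemma mean_indicator_eq_0:
  assumes m: "invariant_mean m" and D: "\<not> big D" and A: "\<And>x y. x \<in> A \<Longrightarrow> y \<in> A \<Longrightarrow> x - y \<in> D"
  shows "m (indicat_real A) = 0"
proof -
  note mm = invariant_meanD(1)[OF m]
  obtain s :: "nat \<Rightarrow> 'a" where s: "\<And>n j. j < n \<Longrightarrow> s n - s j \<notin> D"
  proof -
    have "\<exists>s :: nat \<Rightarrow> 'a. \<forall>n. \<forall>j<n. s n - s j \<notin> D"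
    proof (rule dependent_wellorder_choice)
      fix n and f :: "nat \<Rightarrow> 'a"
      have "\<exists>x. \<forall>y\<in>f ` {..<n}. x - y \<notin> D"
        using D unfolding big_def by blast
      then show "\<exists>x. \<forall>j<n. x - f j \<notin> D" by auto
    qed auto
    then show ?thesis using that by blast
  qed
  have le: "real n * m (indicat_real A) \<le> 1" for n
  proof -
    have "m (\<lambda>x. \<Sum>i<n. indicat_real A (x + s i)) = (\<Sum>i<n. m (indicat_real A))"
      by (subst mean_sum[OF mm]) (simp_all add: bdd_comp[OF bdd_indicator] invariant_meanD(2)[OF m])
    moreover have "m (\<lambda>x. \<Sum>i<n. indicat_real A (x + s i)) \<le> m (\<lambda>_. 1)"
    proof (intro mean_mono[OF mm] bdd_sum bdd_comp[OF bdd_indicator] bdd_const)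
      fix x
      have eq: "i = j" if "x + s i \<in> A" "x + s j \<in> A" for i j
        using A[OF that] A[OF that(2,1)] s[of i j] s[of j i] by (metis add_diff_cancel_left linorder_neqE_nat)
      have "finite {i. i < n \<and> x + s i \<in> A}" by simp
      then have "card {i. i < n \<and> x + s i \<in> A} \<le> Suc 0"
        using eq by (subst card_le_Suc0_iff_eq) auto
      moreover have "(\<Sum>i<n. indicat_real A (x + s i)) = real (card {i. i < n \<and> x + s i \<in> A})"
        by (simp add: indicator_def sum.If_cases Int_def)
      ultimately show "(\<Sum>i<n. indicat_real A (x + s i)) \<le> 1" by simp
    qed
    ultimately show ?thesis by (simp add: mean_one[OF mm])
  qed
  have "0 \<le> m (indicat_real A)" by (rule mean_nonneg[OF mm]) auto
  moreover have "\<not> 0 < m (indicat_real A)"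
    using le reals_Archimedean3 by (metis linorder_not_less)
  ultimately show ?thesis by simp
qed

lemma ex_notin_small_sets:
  fixes D :: "'i \<Rightarrow> 'a::ab_group_add set"
  assumes "finite I" and "\<And>i. i \<in> I \<Longrightarrow> \<not> big (D i)"
    and "\<And>i x y. i \<in> I \<Longrightarrow> x \<in> A i \<Longrightarrow> y \<in> A i \<Longrightarrow> x - y \<in> D i"
  shows "\<exists>x. \<forall>i\<in>I. x \<notin> A i"
proof -
  obtain m :: "('a \<Rightarrow> real) \<Rightarrow> real" where m: "invariant_mean m" using ex_invariant_mean by blast
  note mm = invariant_meanD(1)[OF m]
  show ?thesis
  proof (rule ccontr)
    assume "\<not> ?thesis"
    then have *: "\<exists>i\<in>I. x \<in> A i" for x by blast
    have "m (\<lambda>_. 1) \<le> m (\<lambda>x. \<Sum>i\<in>I. indicat_real (A i) x)"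
    proof (intro mean_mono[OF mm] bdd_const bdd_sum bdd_indicator)
      fix x
      obtain i where i: "i \<in> I" "x \<in> A i" using * by blast
      have "indicat_real (A i) x \<le> (\<Sum>i\<in>I. indicat_real (A i) x)"
        using i(1) assms(1) by (intro member_le_sum) auto
      then show "1 \<le> (\<Sum>i\<in>I. indicat_real (A i) x)" using i by simp
    qed
    also have "\<dots> = (\<Sum>i\<in>I. m (indicat_real (A i)))"
      by (rule mean_sum[OF mm]) auto
    also have "\<dots> = 0"
      using assms mean_indicator_eq_0[OF m] by (intro sum.neutral ballI) blast
    finally show False by (simp add: mean_one[OF mm])
  qed
qed

definition group_nbhds :: "'a::ab_group_add set set \<Rightarrow> bool" where
  "group_nbhds N \<longleftrightarrow> N \<noteq> {} \<and> (\<forall>U\<in>N. 0 \<in> U) \<and> (\<forall>U\<in>N. \<forall>x\<in>U. - x \<in> U) \<and>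
     (\<forall>U\<in>N. \<forall>V\<in>N. \<exists>W\<in>N. W \<subseteq> U \<inter> V) \<and> (\<forall>U\<in>N. \<exists>V\<in>N. \<forall>x\<in>V. \<forall>y\<in>V. x + y \<in> U)"

definition minimal_nbhds :: "'a::ab_group_add set set \<Rightarrow> bool" where
  "minimal_nbhds N \<longleftrightarrow> group_nbhds N \<and>
     (\<forall>M. group_nbhds M \<and> (\<forall>V\<in>M. \<exists>U\<in>N. U \<subseteq> V) \<and> \<Inter>M \<subseteq> \<Inter>N \<longrightarrow> (\<forall>U\<in>N. \<exists>V\<in>M. V \<subseteq> U))"

lemma minimal_nbhdsD:
  assumes "minimal_nbhds N"
  shows "group_nbhds N"
    and "group_nbhds M \<Longrightarrow> (\<And>V. V \<in> M \<Longrightarrow> \<exists>U\<in>N. U \<subseteq> V) \<Longrightarrow> \<Inter>M \<subseteq> \<Inter>N \<Longrightarrow> U \<in> N \<Longrightarrow> \<exists>V\<in>M. V \<subseteq> U"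
proof -
  show "group_nbhds N" using assms by (simp add: minimal_nbhds_def)
  have "group_nbhds M \<and> (\<forall>V\<in>M. \<exists>U\<in>N. U \<subseteq> V) \<and> \<Inter>M \<subseteq> \<Inter>N \<longrightarrow> (\<forall>U\<in>N. \<exists>V\<in>M. V \<subseteq> U)"
    using assms unfolding minimal_nbhds_def by (elim conjE) (erule allE)
  then show "group_nbhds M \<Longrightarrow> (\<And>V. V \<in> M \<Longrightarrow> \<exists>U\<in>N. U \<subseteq> V) \<Longrightarrow> \<Inter>M \<subseteq> \<Inter>N \<Longrightarrow> U \<in> N \<Longrightarrow> \<exists>V\<in>M. V \<subseteq> U"
    by simp
qed

lemma nbhds_zero: "group_nbhds N \<Longrightarrow> U \<in> N \<Longrightarrow> 0 \<in> U"
  and nbhds_uminus: "group_nbhds N \<Longrightarrow> U \<in> N \<Longrightarrow> x \<in> U \<Longrightarrow> - x \<in> U"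
  unfolding group_nbhds_def by blast+

lemma nbhds_Int:
  assumes "group_nbhds N" "U \<in> N" "V \<in> N" obtains W where "W \<in> N" "W \<subseteq> U" "W \<subseteq> V"
  using assms unfolding group_nbhds_def by (metis le_inf_iff)

lemma nbhds_add:
  assumes N: "group_nbhds N" "U \<in> N"
  obtains V where "V \<in> N" "V \<subseteq> U" "\<And>x y. x \<in> V \<Longrightarrow> y \<in> V \<Longrightarrow> x + y \<in> U"
    "\<And>x y. x \<in> V \<Longrightarrow> y \<in> V \<Longrightarrow> x - y \<in> U"
proof -
  have "\<exists>V\<in>N. \<forall>x\<in>V. \<forall>y\<in>V. x + y \<in> U"
    using N by (simp add: group_nbhds_def)
  then obtain V where V: "V \<in> N" "\<forall>x\<in>V. \<forall>y\<in>V. x + y \<in> U" by (elim bexE)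
  show ?thesis
  proof (rule that[OF V(1)])
    show "V \<subseteq> U"
    proof
      fix x assume "x \<in> V"
      then show "x \<in> U" using V(2)[rule_format, OF _ nbhds_zero[OF N(1) V(1)]] by simp
    qed
    show "x + y \<in> U" "x - y \<in> U" if "x \<in> V" "y \<in> V" for x y
      using V(2)[rule_format, OF that] V(2)[rule_format, OF that(1) nbhds_uminus[OF N(1) V(1) that(2)]]
      by simp_all
  qed
qed

lemma nbhds_add4:
  assumes N: "group_nbhds N" "U \<in> N"
  obtains V where "V \<in> N" "V \<subseteq> U"
    "\<And>x y z w. x \<in> V \<Longrightarrow> y \<in> V \<Longrightarrow> z \<in> V \<Longrightarrow> w \<in> V \<Longrightarrow> x + y + (z + w) \<in> U"
proof -
  obtain W where W: "W \<in> N" "W \<subseteq> U" "\<And>x y. x \<in> W \<Longrightarrow> y \<in> W \<Longrightarrow> x + y \<in> U"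
    using nbhds_add[OF N] by metis
  obtain V where V: "V \<in> N" "V \<subseteq> W" "\<And>x y. x \<in> V \<Longrightarrow> y \<in> V \<Longrightarrow> x + y \<in> W"
    using nbhds_add[OF N(1) W(1)] by metis
  show ?thesis
    by (rule that[OF V(1) subset_trans[OF V(2) W(2)]]) (intro W(3) V(3))
qed

lemma nbhds_zmul:
  assumes N: "group_nbhds N" "U \<in> N"
  obtains V where "V \<in> N" "\<And>x. x \<in> V \<Longrightarrow> zmul k x \<in> U"
proof -
  have "\<forall>U\<in>N. \<exists>V\<in>N. \<forall>x\<in>V. zmul k x \<in> U"
  proof (induction k rule: int_induct[where k = 0])
    case base
    then show ?case using nbhds_zero[OF N(1)] by auto
  next
    case (step1 i)
    show ?case
    proof
      fix U assume "U \<in> N"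
      then obtain V where V: "V \<in> N" "\<And>x y. x \<in> V \<Longrightarrow> y \<in> V \<Longrightarrow> x + y \<in> U"
        using nbhds_add[OF N(1)] by metis
      obtain W where W: "W \<in> N" "\<forall>x\<in>W. zmul i x \<in> V" using step1 V(1) by blast
      obtain Z where "Z \<in> N" "Z \<subseteq> V" "Z \<subseteq> W" using nbhds_Int[OF N(1) V(1) W(1)] .
      then have "zmul (i + 1) x \<in> U" if "x \<in> Z" for x
        using V(2)[of "zmul i x" x] W(2) that by (auto simp: zmul_plus1)
      then show "\<exists>V\<in>N. \<forall>x\<in>V. zmul (i + 1) x \<in> U" using \<open>Z \<in> N\<close> by blast
    qed
  next
    case (step2 i)
    show ?case
    proof
      fix U assume "U \<in> N"
      then obtain V where V: "V \<in> N" "\<And>x y. x \<in> V \<Longrightarrow> y \<in> V \<Longrightarrow> x - y \<in> U"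
        using nbhds_add[OF N(1)] by metis
      obtain W where W: "W \<in> N" "\<forall>x\<in>W. zmul i x \<in> V" using step2 V(1) by blast
      obtain Z where "Z \<in> N" "Z \<subseteq> V" "Z \<subseteq> W" using nbhds_Int[OF N(1) V(1) W(1)] .
      then have "zmul (i - 1) x \<in> U" if "x \<in> Z" for x
        using V(2)[of "zmul i x" x] W(2) that by (auto simp: zmul.scale_left_diff_distrib zmul_one)
      then show "\<exists>V\<in>N. \<forall>x\<in>V. zmul (i - 1) x \<in> U" using \<open>Z \<in> N\<close> by blast
    qed
  qed
  then show ?thesis using that N(2) by blast
qed

lemma minimal_nbhds_zmul:
  assumes min: "minimal_nbhds N" and tf: "\<And>x. zmul n x \<in> \<Inter>N \<Longrightarrow> x \<in> \<Inter>N" and U: "U \<in> N"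
  obtains V where "V \<in> N" "\<And>x. zmul n x \<in> V \<Longrightarrow> x \<in> U"
proof -
  have N: "group_nbhds N" by (rule minimal_nbhdsD(1)[OF min])
  let ?M = "(\<lambda>U. {x. zmul n x \<in> U}) ` N"
  have gM: "group_nbhds ?M"
    unfolding group_nbhds_def
  proof (intro conjI ballI)
    show "?M \<noteq> {}" using U by blast
    show "0 \<in> A" if "A \<in> ?M" for A using that nbhds_zero[OF N] by auto
    show "- x \<in> A" if "A \<in> ?M" "x \<in> A" for A x using that nbhds_uminus[OF N] by auto
    show "\<exists>W\<in>?M. W \<subseteq> A \<inter> B" if "A \<in> ?M" "B \<in> ?M" for A B
    proof -
      from that obtain U V where UV: "U \<in> N" "V \<in> N" "A = {x. zmul n x \<in> U}" "B = {x. zmul n x \<in> V}"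
        by (elim imageE)
      then obtain W where "W \<in> N" "W \<subseteq> U" "W \<subseteq> V" using nbhds_Int[OF N] by metis
      then show ?thesis using UV by (intro bexI[of _ "{x. zmul n x \<in> W}"]) auto
    qed
    show "\<exists>B\<in>?M. \<forall>x\<in>B. \<forall>y\<in>B. x + y \<in> A" if "A \<in> ?M" for A
    proof -
      from that obtain U where U: "U \<in> N" "A = {x. zmul n x \<in> U}" by (elim imageE)
      obtain V where "V \<in> N" "\<And>x y. x \<in> V \<Longrightarrow> y \<in> V \<Longrightarrow> x + y \<in> U" using nbhds_add[OF N U(1)] by metis
      then show ?thesis using U by (intro bexI[of _ "{x. zmul n x \<in> V}"]) (auto simp: zmul_add_right)
    qed
  qed
  have coarser: "\<exists>U\<in>N. U \<subseteq> V" if "V \<in> ?M" for V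
  proof -
    from that obtain U where U: "U \<in> N" "V = {x. zmul n x \<in> U}" by (elim imageE)
    obtain W where "W \<in> N" "\<And>x. x \<in> W \<Longrightarrow> zmul n x \<in> U" using nbhds_zmul[OF N U(1), where k = n] by metis
    then show ?thesis using U(2) by blast
  qed
  have ker: "\<Inter>?M \<subseteq> \<Inter>N"
  proof
    fix x assume "x \<in> \<Inter>?M"
    then have "zmul n x \<in> \<Inter>N" by simp
    then show "x \<in> \<Inter>N" by (rule tf)
  qed
  have "\<exists>V\<in>?M. V \<subseteq> U" by (rule minimal_nbhdsD(2)[OF min gM coarser ker U])
  then obtain V where "V \<in> N" "{x. zmul n x \<in> V} \<subseteq> U" by (elim bexE imageE) simp
  then show ?thesis using that[of V] by blast
qed

definition pair_sums :: "(nat \<Rightarrow> 'a::ab_group_add) \<Rightarrow> (nat \<Rightarrow> nat set) \<Rightarrow> 'a set" where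
  "pair_sums a S = {\<Sum>r\<in>I. a (i r) - a (j r) | I i j. finite I \<and> (\<forall>r\<in>I. i r \<in> S r \<and> j r \<in> S r)}"

lemma pair_sumsI:
  "finite I \<Longrightarrow> (\<And>r. r \<in> I \<Longrightarrow> i r \<in> S r \<and> j r \<in> S r) \<Longrightarrow> x = (\<Sum>r\<in>I. a (i r) - a (j r)) \<Longrightarrow> x \<in> pair_sums a S"
  unfolding pair_sums_def by (rule CollectI, intro exI conjI ballI) auto

lemma pair_sums_zero: "0 \<in> pair_sums a S"
  by (rule pair_sumsI[of "{}"]) auto

lemma pair_sums_uminus: "x \<in> pair_sums a S \<Longrightarrow> - x \<in> pair_sums a S"
proof -
  assume "x \<in> pair_sums a S"
  then obtain I i j where "finite I" "\<And>r. r \<in> I \<Longrightarrow> i r \<in> S r \<and> j r \<in> S r" "x = (\<Sum>r\<in>I. a (i r) - a (j r))"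
    unfolding pair_sums_def by blast
  then show ?thesis by (intro pair_sumsI[of I j S i]) (auto simp: sum_negf[symmetric])
qed

lemma pair_sums_mono:
  assumes "\<And>r. S r \<subseteq> S' r" shows "pair_sums a S \<subseteq> pair_sums a S'"
proof
  fix x assume "x \<in> pair_sums a S"
  then obtain I i j where I: "finite I" "\<And>r. r \<in> I \<Longrightarrow> i r \<in> S r \<and> j r \<in> S r" "x = (\<Sum>r\<in>I. a (i r) - a (j r))"
    unfolding pair_sums_def by blast
  show "x \<in> pair_sums a S'"
    by (rule pair_sumsI[OF I(1) _ I(3)]) (use I(2) assms in blast)
qed

lemma pair_sums_add:
  assumes "x \<in> pair_sums a S" "y \<in> pair_sums a S" and S: "\<And>r. S r \<subseteq> S' (2 * r) \<inter> S' (2 * r + 1)"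
  shows "x + y \<in> pair_sums a S'"
proof -
  obtain I i j where I: "finite I" "\<And>r. r \<in> I \<Longrightarrow> i r \<in> S r \<and> j r \<in> S r" "x = (\<Sum>r\<in>I. a (i r) - a (j r))"
    using assms(1) unfolding pair_sums_def by blast
  obtain I' i' j' where I': "finite I'" "\<And>r. r \<in> I' \<Longrightarrow> i' r \<in> S r \<and> j' r \<in> S r" "y = (\<Sum>r\<in>I'. a (i' r) - a (j' r))"
    using assms(2) unfolding pair_sums_def by blast
  define p where "p n = (if even n then i (n div 2) else i' (n div 2))" for n
  define q where "q n = (if even n then j (n div 2) else j' (n div 2))" for n
  let ?E = "(\<lambda>r. 2 * r) ` I" and ?O = "(\<lambda>r. 2 * r + 1) ` I'"
  show ?thesis
  proof (rule pair_sumsI[of "?E \<union> ?O" p _ q])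
    show "finite (?E \<union> ?O)" using I I' by simp
    show "p r \<in> S' r \<and> q r \<in> S' r" if "r \<in> ?E \<union> ?O" for r
      using that I(2) I'(2) S unfolding p_def q_def by fastforce
    have "(\<Sum>r\<in>?E. a (p r) - a (q r)) = x" "(\<Sum>r\<in>?O. a (p r) - a (q r)) = y"
      unfolding I(3) I'(3) by (subst sum.reindex; auto simp: inj_on_def p_def q_def)+
    moreover have "?E \<inter> ?O = {}" by auto presburger
    ultimately show "x + y = (\<Sum>r\<in>?E \<union> ?O. a (p r) - a (q r))"
      using I I' by (simp add: sum.union_disjoint)
  qed
qed

text \<open>The sets \<open>U + pair_sums a S\<close> generate a coarser group topology, Hausdorff by the last hypothesis, so each
  neighbourhood \<open>W\<close> contains one of them, and in particular the differences \<open>a i - a j\<close> with \<open>i, j \<in> S 0\<close>.\<close>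
lemma minimal_nbhds_sequence:
  assumes min: "minimal_nbhds N" and W: "W \<in> N"
    and ker: "\<And>g. g \<notin> \<Inter>N \<Longrightarrow> \<exists>U\<in>N. \<exists>S. (\<forall>r. eventually (\<lambda>i. i \<in> S r) F) \<and>
        (\<forall>u\<in>U. u + g \<notin> pair_sums a S)"
  shows "\<exists>T. eventually (\<lambda>i. i \<in> T) F \<and> (\<forall>i\<in>T. \<forall>j\<in>T. a i - a j \<in> W)"
proof -
  have N: "group_nbhds N" by (rule minimal_nbhdsD(1)[OF min])
  define Q where "Q = {S :: nat \<Rightarrow> nat set. \<forall>r. eventually (\<lambda>i. i \<in> S r) F}"
  define E where "E U S = {u + c | u c. u \<in> U \<and> c \<in> pair_sums a S}" for U S
  define M where "M = {E U S | U S. U \<in> N \<and> S \<in> Q}"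
  have Q0: "(\<lambda>_. UNIV) \<in> Q" by (simp add: Q_def)
  have gM: "group_nbhds M"
    unfolding group_nbhds_def
  proof (intro conjI ballI)
    show "M \<noteq> {}" using W Q0 unfolding M_def by blast
    show "0 \<in> A" if A: "A \<in> M" for A
    proof -
      obtain U S where US: "U \<in> N" "A = E U S" using A unfolding M_def by blast
      show ?thesis using nbhds_zero[OF N US(1)] pair_sums_zero[of a S] add_0_left[of "0::'a", symmetric]
        unfolding US(2) E_def by blast
    qed
    show "- x \<in> A" if A: "A \<in> M" and x: "x \<in> A" for A x
    proof -
      obtain U S where US: "U \<in> N" "A = E U S" using A unfolding M_def by blast
      then obtain u c where "u \<in> U" "c \<in> pair_sums a S" "x = u + c" using x unfolding E_def by blast
      then have "- x = - u + - c" "- u \<in> U" "- c \<in> pair_sums a S"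
        using nbhds_uminus[OF N US(1)] pair_sums_uminus by auto
      then show ?thesis unfolding US(2) E_def by blast
    qed
    show "\<exists>C\<in>M. C \<subseteq> A \<inter> B" if A: "A \<in> M" and B: "B \<in> M" for A B
    proof -
      obtain U S where US: "U \<in> N" "S \<in> Q" "A = E U S" using A unfolding M_def by blast
      obtain U' S' where US': "U' \<in> N" "S' \<in> Q" "B = E U' S'" using B unfolding M_def by blast
      obtain V where V: "V \<in> N" "V \<subseteq> U" "V \<subseteq> U'" using nbhds_Int[OF N US(1) US'(1)] .
      have "(\<lambda>r. S r \<inter> S' r) \<in> Q" using US US' by (simp add: Q_def eventually_conj)
      moreover have "E V (\<lambda>r. S r \<inter> S' r) \<subseteq> E U S"
        using V(2) pair_sums_mono[of "\<lambda>r. S r \<inter> S' r" S a] unfolding E_def by blast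
      moreover have "E V (\<lambda>r. S r \<inter> S' r) \<subseteq> E U' S'"
        using V(3) pair_sums_mono[of "\<lambda>r. S r \<inter> S' r" S' a] unfolding E_def by blast
      ultimately show ?thesis using V(1) US US' unfolding M_def by blast
    qed
    show "\<exists>B\<in>M. \<forall>x\<in>B. \<forall>y\<in>B. x + y \<in> A" if A: "A \<in> M" for A
    proof -
      obtain U S where US: "U \<in> N" "S \<in> Q" "A = E U S" using A unfolding M_def by blast
      obtain V where V: "V \<in> N" "\<And>x y. x \<in> V \<Longrightarrow> y \<in> V \<Longrightarrow> x + y \<in> U" using nbhds_add[OF N US(1)] by metis
      let ?S = "\<lambda>r. S (2 * r) \<inter> S (2 * r + 1)"
      have "?S \<in> Q" using US(2) by (simp add: Q_def eventually_conj)
      moreover have "x + y \<in> A" if xy: "x \<in> E V ?S" "y \<in> E V ?S" for x y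
      proof -
        obtain u c u' c' where uc: "u \<in> V" "u' \<in> V" "c \<in> pair_sums a ?S" "c' \<in> pair_sums a ?S" "x = u + c" "y = u' + c'"
          using xy unfolding E_def by blast
        have "c + c' \<in> pair_sums a S" by (rule pair_sums_add[OF uc(3,4)]) simp
        moreover have "u + u' \<in> U" using V uc by blast
        moreover have "x + y = (u + u') + (c + c')" using uc by (simp add: algebra_simps)
        ultimately show ?thesis unfolding US(3) E_def by blast
      qed
      ultimately show ?thesis using V(1) unfolding M_def by blast
    qed
  qed
  have coarser: "\<exists>U\<in>N. U \<subseteq> V" if V: "V \<in> M" for V
  proof -
    obtain U S where US: "U \<in> N" "V = E U S" using V unfolding M_def by blast
    have "u \<in> V" if "u \<in> U" for u
      using that pair_sums_zero[of a S] add_0_right[of u, symmetric] unfolding US(2) E_def by blast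
    then show ?thesis using US(1) by blast
  qed
  have kerM: "\<Inter>M \<subseteq> \<Inter>N"
  proof (rule ccontr)
    assume "\<not> \<Inter>M \<subseteq> \<Inter>N"
    then obtain g where g: "g \<in> \<Inter>M" "g \<notin> \<Inter>N" by blast
    obtain U S where US: "U \<in> N" "S \<in> Q" "\<And>u. u \<in> U \<Longrightarrow> u + g \<notin> pair_sums a S"
      using ker[OF g(2)] unfolding Q_def by blast
    have "g \<in> E U S" using g US unfolding M_def by blast
    then obtain u c where uc: "u \<in> U" "c \<in> pair_sums a S" "g = u + c" unfolding E_def by blast
    then have "- u + g = c" "- u \<in> U" using nbhds_uminus[OF N US(1)] by auto
    then show False using US(3) uc(2) by metis
  qed
  obtain V where V: "V \<in> M" "V \<subseteq> W" using minimal_nbhdsD(2)[OF min gM coarser kerM W] by blast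
  then obtain U S where US: "U \<in> N" "S \<in> Q" "E U S \<subseteq> W" unfolding M_def by blast
  have "a i - a j \<in> W" if "i \<in> S 0" "j \<in> S 0" for i j
  proof -
    have "a i - a j \<in> pair_sums a S" using that by (intro pair_sumsI[of "{0}" "\<lambda>_. i" _ "\<lambda>_. j"]) auto
    then have "a i - a j \<in> E U S"
      using nbhds_zero[OF N US(1)] add_0_left[of "a i - a j", symmetric] unfolding E_def by blast
    then show ?thesis using US(3) by blast
  qed
  then show ?thesis using US(2) unfolding Q_def by blast
qed

definition lincomb :: "(nat \<Rightarrow> 'a::ab_group_add) \<Rightarrow> (nat \<Rightarrow> int) \<Rightarrow> 'a" where
  "lincomb a c = (\<Sum>i | c i \<noteq> 0. zmul (c i) (a i))"

lemma lincomb_eq: "finite B \<Longrightarrow> {i. c i \<noteq> 0} \<subseteq> B \<Longrightarrow> lincomb a c = (\<Sum>i\<in>B. zmul (c i) (a i))"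
  unfolding lincomb_def by (rule sum.mono_neutral_left) auto

lemma lincomb_diff:
  assumes "finite {i. c i \<noteq> 0}" "finite {i. d i \<noteq> 0}"
  shows "lincomb a (\<lambda>i. c i - d i) = lincomb a c - lincomb a d"
proof -
  let ?B = "{i. c i \<noteq> 0} \<union> {i. d i \<noteq> 0}"
  have "lincomb a (\<lambda>i. c i - d i) = (\<Sum>i\<in>?B. zmul (c i - d i) (a i))"
    using assms by (intro lincomb_eq) auto
  also have "\<dots> = lincomb a c - lincomb a d"
    using assms lincomb_eq[of ?B c a] lincomb_eq[of ?B d a]
    by (auto simp: zmul.scale_left_diff_distrib sum_subtractf)
  finally show ?thesis .
qed

lemma lincomb_Max:
  assumes "finite {i. c i \<noteq> 0}" "c \<noteq> (\<lambda>_. 0)"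
  obtains J where "c J \<noteq> 0" "lincomb a c = zmul (c J) (a J) + (\<Sum>i<J. zmul (c i) (a i))"
    "\<And>i. c i \<noteq> 0 \<Longrightarrow> i \<le> J"
proof -
  let ?J = "Max {i. c i \<noteq> 0}"
  have ne: "{i. c i \<noteq> 0} \<noteq> {}" using assms(2) by auto
  have J: "c ?J \<noteq> 0" "\<And>i. c i \<noteq> 0 \<Longrightarrow> i \<le> ?J"
    using Max_in[OF assms(1) ne] Max_ge[OF assms(1)] by auto
  have "lincomb a c = (\<Sum>i\<in>insert ?J {..<?J}. zmul (c i) (a i))"
    using J by (intro lincomb_eq) (auto simp: le_less)
  then show ?thesis using that[OF J(1) _ J(2)] by simp
qed

lemma pair_sums_lincomb:
  assumes "x \<in> pair_sums a S" and S: "\<And>r r'. r \<le> r' \<Longrightarrow> S r' \<subseteq> S r"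
  obtains c where "finite {i. c i \<noteq> 0}" "x = lincomb a c" "(\<Sum>i | c i \<noteq> 0. c i) = 0"
    "\<And>i. c i \<noteq> 0 \<Longrightarrow> i \<in> S 0"
    "\<And>r. (\<Sum>i | c i \<noteq> 0 \<and> i \<notin> S r. \<bar>c i\<bar>) \<le> 2 * int r"
proof -
  obtain I i j where I: "finite I" "\<And>r. r \<in> I \<Longrightarrow> i r \<in> S r \<and> j r \<in> S r" "x = (\<Sum>r\<in>I. a (i r) - a (j r))"
    using assms(1) unfolding pair_sums_def by blast
  define c where "c k = (\<Sum>r\<in>I. of_bool (i r = k) - of_bool (j r = k) :: int)" for k
  define B where "B = i ` I \<union> j ` I"
  have B: "finite B" using I by (simp add: B_def)
  have sub: "{k. c k \<noteq> 0} \<subseteq> B"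
  proof
    fix k assume "k \<in> {k. c k \<noteq> 0}"
    then obtain r where "r \<in> I" "of_bool (i r = k) - of_bool (j r = k) \<noteq> (0::int)"
      unfolding c_def by (metis (mono_tags, lifting) mem_Collect_eq sum.neutral)
    then show "k \<in> B" unfolding B_def by (auto simp: of_bool_def split: if_splits)
  qed
  show ?thesis
  proof
    show fin: "finite {k. c k \<noteq> 0}" using B sub finite_subset by blast
    have "lincomb a c = (\<Sum>k\<in>B. zmul (c k) (a k))" by (rule lincomb_eq[OF B sub])
    also have "\<dots> = (\<Sum>k\<in>B. \<Sum>r\<in>I. zmul (of_bool (i r = k)) (a k) - zmul (of_bool (j r = k)) (a k))"
      by (simp add: c_def zmul.scale_sum_left zmul.scale_left_diff_distrib)
    also have "\<dots> = (\<Sum>r\<in>I. \<Sum>k\<in>B. zmul (of_bool (i r = k)) (a k) - zmul (of_bool (j r = k)) (a k))"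
      by (rule sum.swap)
    also have "\<dots> = (\<Sum>r\<in>I. a (i r) - a (j r))"
    proof (rule sum.cong[OF refl])
      fix r assume r: "r \<in> I"
      have "(\<Sum>k\<in>B. zmul (of_bool (l = k)) (a k)) = a l" if "l \<in> B" for l
      proof -
        have "(\<Sum>k\<in>B. zmul (of_bool (l = k)) (a k)) = (\<Sum>k\<in>B. if l = k then a k else 0)"
          by (rule sum.cong) (auto simp: zmul_one)
        then show ?thesis using that B by (simp add: sum.delta)
      qed
      then show "(\<Sum>k\<in>B. zmul (of_bool (i r = k)) (a k) - zmul (of_bool (j r = k)) (a k)) = a (i r) - a (j r)"
        using r by (simp add: sum_subtractf B_def)
    qed
    finally show "x = lincomb a c" using I by simp
    have "(\<Sum>k | c k \<noteq> 0. c k) = (\<Sum>k\<in>B. c k)"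
      using B sub by (intro sum.mono_neutral_left) auto
    also have "\<dots> = (\<Sum>r\<in>I. \<Sum>k\<in>B. of_bool (i r = k) - of_bool (j r = k))"
      unfolding c_def by (rule sum.swap)
    also have "\<dots> = 0"
    proof (rule sum.neutral, rule)
      fix r assume r: "r \<in> I"
      have "(\<Sum>k\<in>B. of_bool (l = k) :: int) = 1" if "l \<in> B" for l
        using that B by (simp add: of_bool_def sum.delta)
      then show "(\<Sum>k\<in>B. of_bool (i r = k) - of_bool (j r = k) :: int) = 0"
        using r by (simp add: sum_subtractf B_def)
    qed
    finally show "(\<Sum>k | c k \<noteq> 0. c k) = 0" .
    show "k \<in> S 0" if "c k \<noteq> 0" for k
      using sub that I(2) S[of 0] unfolding B_def by blast
    show "(\<Sum>k | c k \<noteq> 0 \<and> k \<notin> S r. \<bar>c k\<bar>) \<le> 2 * int r" for r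
    proof -
      have "(\<Sum>k | c k \<noteq> 0 \<and> k \<notin> S r. \<bar>c k\<bar>) \<le> (\<Sum>k\<in>B - S r. \<bar>c k\<bar>)"
        using B sub by (intro sum_mono2) auto
      also have "\<dots> \<le> (\<Sum>k\<in>B - S r. \<Sum>r'\<in>I. of_bool (i r' = k) + of_bool (j r' = k))"
      proof (rule sum_mono)
        fix k
        show "\<bar>c k\<bar> \<le> (\<Sum>r'\<in>I. of_bool (i r' = k) + of_bool (j r' = k))"
          unfolding c_def by (rule order_trans[OF sum_abs sum_mono]) auto
      qed
      also have "\<dots> = (\<Sum>r'\<in>I. \<Sum>k\<in>B - S r. of_bool (i r' = k) + of_bool (j r' = k))"
        by (rule sum.swap)
      also have "\<dots> \<le> (\<Sum>r'\<in>I. if r' < r then 2 else 0)"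
      proof (rule sum_mono)
        fix r' assume r': "r' \<in> I"
        have le1: "(\<Sum>k\<in>B - S r. of_bool (l = k) :: int) \<le> 1" for l
          using B by (simp add: of_bool_def sum.delta)
        have eq0: "(\<Sum>k\<in>B - S r. of_bool (l = k) :: int) = 0" if "l \<in> S r" for l
          using that by (intro sum.neutral) auto
        show "(\<Sum>k\<in>B - S r. of_bool (i r' = k) + of_bool (j r' = k)) \<le> (if r' < r then 2 else 0 :: int)"
        proof (cases "r' < r")
          case True
          then show ?thesis using le1[of "i r'"] le1[of "j r'"] by (simp add: sum.distrib)
        next
          case False
          then have "i r' \<in> S r" "j r' \<in> S r" using I(2)[OF r'] S[of r r'] by auto
          then show ?thesis using False by (simp add: sum.distrib eq0)
        qed
      qed
      also have "\<dots> = 2 * int (card (I \<inter> {..<r}))"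
        using I(1) by (simp add: sum.If_cases lessThan_def)
      also have "\<dots> \<le> 2 * int r"
        using card_mono[of "{..<r}" "I \<inter> {..<r}"] by simp
      finally show ?thesis .
    qed
  qed
qed

text \<open>Otherwise one chooses, term by term, a sequence whose combinations with bounded coefficients avoid a
  neighbourhood, contrary to \<open>minimal_nbhds_sequence\<close>.\<close>
lemma minimal_nbhds_multiples_big:
  assumes min: "minimal_nbhds N" and U: "U \<in> N"
  shows "\<exists>k>0. big {y. zmul k y \<in> U}"
proof (rule ccontr)
  assume "\<not> ?thesis"
  then have nbig: "\<not> big {y. zmul k y \<in> U}" if "k > 0" for k using that by blast
  have N: "group_nbhds N" by (rule minimal_nbhdsD(1)[OF min])
  have nbig: "\<not> big {y. zmul k y \<in> U}" if "k \<noteq> 0" for k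
  proof (cases "k > 0")
    case False
    have "{y. zmul k y \<in> U} = {y. zmul (- k) y \<in> U}"
      using nbhds_uminus[OF N U] by (auto simp: zmul_minus_left) (metis minus_minus)
    then show ?thesis using nbig[of "- k"] False that by simp
  qed (rule nbig)
  obtain W where W: "W \<in> N" "\<And>x y. x \<in> W \<Longrightarrow> y \<in> W \<Longrightarrow> x - y \<in> U"
    using nbhds_add[OF N U] by metis
  define CF :: "nat \<Rightarrow> (nat \<Rightarrow> int) set" where "CF J = PiE {..<J} (\<lambda>_. {- 4 * int J..4 * int J})" for J
  have "\<exists>a. \<forall>J. \<forall>k\<in>{- 4 * int J..4 * int J} - {0}. \<forall>c\<in>CF J.
      zmul k (a J) + (\<Sum>i<J. zmul (c i) (a i)) \<notin> W"
  proof (rule dependent_wellorder_choice)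
    fix J and a :: "nat \<Rightarrow> 'a"
    let ?I = "({- 4 * int J..4 * int J} - {0}) \<times> CF J"
    let ?D = "\<lambda>(k, c :: nat \<Rightarrow> int). {y. zmul k y \<in> U}"
    let ?A = "\<lambda>(k, c). {x. zmul k x + (\<Sum>i<J. zmul (c i) (a i)) \<in> W}"
    have fin: "finite ?I" unfolding CF_def by (intro finite_cartesian_product finite_PiE) auto
    have nb: "\<not> big (?D i)" if "i \<in> ?I" for i using that nbig by auto
    have di: "x - y \<in> ?D i" if "i \<in> ?I" "x \<in> ?A i" "y \<in> ?A i" for i x y
    proof -
      obtain k c where i: "i = (k, c)" by fastforce
      have "(zmul k x + (\<Sum>i<J. zmul (c i) (a i))) - (zmul k y + (\<Sum>i<J. zmul (c i) (a i))) \<in> U"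
        using that i by (intro W(2)) auto
      then show ?thesis by (simp add: i zmul.scale_right_diff_distrib)
    qed
    have "\<exists>x. \<forall>i\<in>?I. x \<notin> ?A i"
      by (rule ex_notin_small_sets[where D = ?D and A = ?A, OF fin nb di])
    then obtain x where "\<forall>i\<in>?I. x \<notin> ?A i" by (elim exE)
    then show "\<exists>x. \<forall>k\<in>{- 4 * int J..4 * int J} - {0}. \<forall>c\<in>CF J.
        zmul k x + (\<Sum>i<J. zmul (c i) (a i)) \<notin> W"
      by (intro exI[of _ x] ballI) auto
  qed auto
  then obtain a where a: "\<And>J k c. k \<in> {- 4 * int J..4 * int J} - {0} \<Longrightarrow> c \<in> CF J \<Longrightarrow>
      zmul k (a J) + (\<Sum>i<J. zmul (c i) (a i)) \<notin> W"
    by blast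
  have indep: "c = (\<lambda>_. 0)" if c: "finite {i. c i \<noteq> 0}" "\<And>i. \<bar>c i\<bar> \<le> 4 * int i" "lincomb a c \<in> W" for c
  proof (rule ccontr)
    assume "c \<noteq> (\<lambda>_. 0)"
    then obtain J where J: "c J \<noteq> 0" "lincomb a c = zmul (c J) (a J) + (\<Sum>i<J. zmul (c i) (a i))"
      using lincomb_Max[OF c(1)] by metis
    have "restrict c {..<J} \<in> CF J"
      unfolding CF_def restrict_PiE_iff
    proof
      fix i assume "i \<in> {..<J}"
      then show "c i \<in> {- 4 * int J..4 * int J}" using c(2)[of i] by (simp add: abs_le_iff)
    qed
    moreover have "c J \<in> {- 4 * int J..4 * int J} - {0}" using J(1) c(2)[of J] by (simp add: abs_le_iff)
    ultimately have "zmul (c J) (a J) + (\<Sum>i<J. zmul (restrict c {..<J} i) (a i)) \<notin> W" using a by blast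
    then show False using J(2) c(3) by simp
  qed
  have "\<exists>T. eventually (\<lambda>i. i \<in> T) sequentially \<and> (\<forall>i\<in>T. \<forall>j\<in>T. a i - a j \<in> W)"
  proof (rule minimal_nbhds_sequence[OF min W(1)])
    fix g assume "g \<notin> \<Inter>N"
    then obtain U' where U': "U' \<in> N" "g \<notin> U'" by blast
    obtain V where V: "V \<in> N" "\<And>x y. x \<in> V \<Longrightarrow> y \<in> V \<Longrightarrow> x - y \<in> W"
      using nbhds_add[OF N W(1)] by metis
    obtain V' where V': "V' \<in> N" "V' \<subseteq> V" "V' \<subseteq> U'" using nbhds_Int[OF N V(1) U'(1)] .
    define S :: "nat \<Rightarrow> nat \<Rightarrow> nat set" where "S n r = {i. n < i \<and> r < i}" for n r
    have coeffs: "\<exists>c. finite {i. c i \<noteq> 0} \<and> x = lincomb a c \<and> (\<forall>i. \<bar>c i\<bar> \<le> 2 * int i) \<and> (\<forall>i. c i \<noteq> 0 \<longrightarrow> n < i)"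
      if x: "x \<in> pair_sums a (S n)" for x n
    proof -
      have anti: "r \<le> r' \<Longrightarrow> S n r' \<subseteq> S n r" for r r' by (auto simp: S_def)
      obtain c where c: "finite {i. c i \<noteq> 0}" "x = lincomb a c" "(\<Sum>i | c i \<noteq> 0. c i) = 0" "\<And>i. c i \<noteq> 0 \<Longrightarrow> i \<in> S n 0"
        "\<And>r. (\<Sum>i | c i \<noteq> 0 \<and> i \<notin> S n r. \<bar>c i\<bar>) \<le> 2 * int r"
        by (rule pair_sums_lincomb[OF x anti], assumption, rule that)
      have "\<bar>c i\<bar> \<le> 2 * int i" for i
      proof (cases "c i = 0")
        case False
        have "\<bar>c i\<bar> \<le> (\<Sum>i' | c i' \<noteq> 0 \<and> i' \<notin> S n i. \<bar>c i'\<bar>)"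
          using False c(1) by (intro member_le_sum) (auto simp: S_def)
        then show ?thesis using c(5)[of i] by linarith
      qed simp
      then show ?thesis using c unfolding S_def by blast
    qed
    define close where "close b \<longleftrightarrow> finite {i. b i \<noteq> 0} \<and> (\<forall>i. \<bar>b i\<bar> \<le> 2 * int i) \<and> lincomb a b - g \<in> V" for b
    obtain n where n: "\<And>b i. close b \<Longrightarrow> b i \<noteq> 0 \<Longrightarrow> i \<le> n"
    proof (cases "\<exists>b. close b")
      case True
      then obtain b where b: "close b" by blast
      have eq: "b' = b" if b': "close b'" for b'
      proof -
        have fin: "finite {i. b' i - b i \<noteq> 0}"
          by (rule finite_subset[of _ "{i. b' i \<noteq> 0} \<union> {i. b i \<noteq> 0}"]) (use b b' in \<open>auto simp: close_def\<close>)
        have bnd: "\<bar>b' i - b i\<bar> \<le> 4 * int i" for i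
        proof -
          have "\<bar>b' i\<bar> \<le> 2 * int i" "\<bar>b i\<bar> \<le> 2 * int i" using b b' by (auto simp: close_def)
          then show ?thesis by linarith
        qed
        have "lincomb a b' - lincomb a b \<in> W"
          using V(2)[of "lincomb a b' - g" "lincomb a b - g"] b b' by (simp add: close_def)
        then have "lincomb a (\<lambda>i. b' i - b i) \<in> W"
          using b b' by (subst lincomb_diff) (auto simp: close_def)
        then have "(\<lambda>i. b' i - b i) = (\<lambda>_. 0)" by (rule indep[OF fin bnd])
        then have "b' i - b i = 0" for i by (rule fun_cong)
        then show ?thesis by (intro ext) simp
      qed
      have "i \<le> Max {i. b i \<noteq> 0}" if "close b'" "b' i \<noteq> 0" for b' i
        using b eq[OF that(1)] that(2) by (intro Max_ge) (auto simp: close_def)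
      then show ?thesis by (rule that)
    next
      case False
      then show ?thesis by (intro that[of 0]) blast
    qed
    have "u + g \<notin> pair_sums a (S n)" if u: "u \<in> V'" for u
    proof
      assume "u + g \<in> pair_sums a (S n)"
      from coeffs[OF this] obtain c where c: "finite {i. c i \<noteq> 0}" "u + g = lincomb a c"
        "\<And>i. \<bar>c i\<bar> \<le> 2 * int i" "\<And>i. c i \<noteq> 0 \<Longrightarrow> n < i"
        by blast
      have "lincomb a c - g = u" by (simp flip: c(2))
      then have cl: "close c" using c(1,3) u V'(2) unfolding close_def by auto
      have "c i = 0" for i using n[OF cl, of i] c(4)[of i] by force
      then have "u + g = 0" using c(2) by (simp add: lincomb_def)
      then have "g = - u" by (simp add: eq_neg_iff_add_eq_0 add.commute)
      then show False using u V'(3) U' nbhds_uminus[OF N U'(1)] by auto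
    qed
    moreover have "\<forall>r. eventually (\<lambda>i. i \<in> S n r) sequentially"
      by (auto simp: S_def eventually_conj eventually_gt_at_top)
    ultimately show "\<exists>U\<in>N. \<exists>S. (\<forall>r. eventually (\<lambda>i. i \<in> S r) sequentially) \<and> (\<forall>u\<in>U. u + g \<notin> pair_sums a S)"
      using V'(1) by (intro bexI[of _ V'] exI[of _ "S n"] conjI ballI) simp_all
  qed
  then obtain T n where T: "\<And>i. i \<ge> n \<Longrightarrow> i \<in> T" "\<And>i j. i \<in> T \<Longrightarrow> j \<in> T \<Longrightarrow> a i - a j \<in> W"
    unfolding eventually_sequentially by blast
  define c :: "nat \<Rightarrow> int" where "c i = (if i = n + 1 then 1 else if i = n + 2 then - 1 else 0)" for i
  have "lincomb a c = (\<Sum>i\<in>{n + 1, n + 2}. zmul (c i) (a i))"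
    by (rule lincomb_eq) (auto simp: c_def)
  then have "lincomb a c = a (n + 1) - a (n + 2)"
    by (simp add: c_def zmul_one zmul_minus_left)
  then have "lincomb a c \<in> W" using T by simp
  moreover have "finite {i. c i \<noteq> 0}" by (rule finite_subset[of _ "{n + 1, n + 2}"]) (auto simp: c_def)
  ultimately have "c = (\<lambda>_. 0)" by (intro indep) (auto simp: c_def)
  then have "c (n + 1) = 0" by (rule fun_cong)
  then show False by (simp add: c_def)
qed

section \<open>Almost periodicity of autocorrelations\<close>

lemma mean_iterated:
  assumes m: "mean m" and m': "mean m'"
  shows "mean (\<lambda>F. m (\<lambda>x. m' (\<lambda>y. F (x, y))))"
proof -
  have b: "bdd (\<lambda>y. F (x, y))" if "bdd F" for F :: "'a \<times> 'b \<Rightarrow> real" and x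
    using that by (rule bdd_comp)
  have b': "bdd (\<lambda>x. m' (\<lambda>y. F (x, y)))" if F: "bdd F" for F :: "'a \<times> 'b \<Rightarrow> real"
  proof -
    obtain B where "\<And>p. \<bar>F p\<bar> \<le> B" using F bdd_def by blast
    then show ?thesis by (intro bddI[of _ B] mean_abs_le[OF m' b[OF F]])
  qed
  show ?thesis
    unfolding mean_def
  proof (intro conjI allI impI)
    fix F G :: "'a \<times> 'b \<Rightarrow> real" assume "bdd F" "bdd G"
    then show "m (\<lambda>x. m' (\<lambda>y. F (x, y) + G (x, y))) = m (\<lambda>x. m' (\<lambda>y. F (x, y))) + m (\<lambda>x. m' (\<lambda>y. G (x, y)))"
      by (simp only: mean_add[OF m'] mean_add[OF m] b b')
  next
    fix F :: "'a \<times> 'b \<Rightarrow> real" and c assume "bdd F"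
    then show "m (\<lambda>x. m' (\<lambda>y. c * F (x, y))) = c * m (\<lambda>x. m' (\<lambda>y. F (x, y)))"
      by (simp only: mean_cmult[OF m'] mean_cmult[OF m] b b')
  next
    fix F :: "'a \<times> 'b \<Rightarrow> real" assume "bdd F" "\<forall>p. 0 \<le> F p"
    then show "0 \<le> m (\<lambda>x. m' (\<lambda>y. F (x, y)))"
      by (intro mean_nonneg[OF m] mean_nonneg[OF m'] b b') auto
  qed (simp add: mean_one[OF m] mean_one[OF m'])
qed

definition precompact_norm :: "('a::ab_group_add \<Rightarrow> real) \<Rightarrow> bool" where
  "precompact_norm \<rho> \<longleftrightarrow> (\<forall>x y. \<rho> (x + y) \<le> \<rho> x + \<rho> y) \<and> (\<forall>x. \<rho> (- x) = \<rho> x) \<and> \<rho> 0 = 0 \<and>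
     (\<forall>e>0. \<exists>F. finite F \<and> (\<forall>x. \<exists>f\<in>F. \<rho> (x - f) < e))"

lemma finite_range_representatives:
  assumes "finite (range c)" obtains F where "finite F" "\<And>x. \<exists>f\<in>F. c f = c x"
proof -
  let ?F = "(\<lambda>t. SOME y. c y = t) ` range c"
  have "\<exists>f\<in>?F. c f = c x" for x
    by (intro bexI[of _ "SOME y. c y = c x"]) (auto intro: someI)
  then show ?thesis using that[of ?F] assms by blast
qed

text \<open>With \<open>\<phi>\<close> the autocorrelation of the indicator of \<open>D\<close>, averages \<open>h\<close> of functions \<open>f (y + z) * f (y' + z)\<close> over
  finitely many \<open>z\<close> that nearly minimise the mean square approximate the autocorrelation \<open>k\<close> of \<open>\<phi>\<close> uniformly (parallelogram
  law and Cauchy--Schwarz). So \<open>k\<close> is almost periodic, and the norm is the uniform distance of \<open>k\<close> from its translate.\<close>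
lemma ex_precompact_norm_of_big:
  fixes D :: "'a::ab_group_add set"
  assumes D: "big D"
  obtains \<rho> where "precompact_norm \<rho>"
    "\<And>x. \<rho> x < 1 \<Longrightarrow> \<exists>p\<in>D. \<exists>q\<in>D. \<exists>r\<in>D. \<exists>s\<in>D. x = (p - q) + (r - s)"
proof -
  obtain m :: "('a \<Rightarrow> real) \<Rightarrow> real" where m: "invariant_mean m" using ex_invariant_mean by blast
  note mm = invariant_meanD(1)[OF m]
  define f where "f = indicat_real D"
  have f01: "0 \<le> f x" "f x \<le> 1" for x by (auto simp: f_def indicator_def)
  have bf: "bdd (\<lambda>x. f (h x))" for h :: "'b \<Rightarrow> 'a" unfolding f_def by (rule bdd_comp) simp
  define \<phi> where "\<phi> x = m (\<lambda>y. f y * f (y + x))" for x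
  have shift\<phi>: "m (\<lambda>y. f (y + z) * f (y + x)) = \<phi> (x - z)" for x z
    using invariant_meanD(2)[OF m bdd_mult[OF bf[of "\<lambda>y. y"] bf[of "\<lambda>y. y + (x - z)"]], of z]
    by (simp add: \<phi>_def algebra_simps)
  have \<phi>0: "0 \<le> \<phi> x" for x
    unfolding \<phi>_def by (intro mean_nonneg[OF mm] bdd_mult bf mult_nonneg_nonneg f01)
  have \<phi>1: "\<phi> x \<le> 1" for x
    using mean_mono[OF mm bdd_mult[OF bf[of "\<lambda>y. y"] bf[of "\<lambda>y. y + x"]], of "\<lambda>_. 1"] f01
    by (simp add: \<phi>_def mean_one[OF mm] mult_le_one)
  have b\<phi>: "bdd (\<lambda>x. \<phi> (h x))" for h :: "'b \<Rightarrow> 'a"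
    by (rule bddI[of _ 1]) (use \<phi>0 \<phi>1 in simp)
  define m2 where "m2 F = m (\<lambda>x. m (\<lambda>y. F (x, y)))" for F
  have mm2: "mean m2" unfolding m2_def[abs_def] by (rule mean_iterated[OF mm mm])
  define E where "E x x' = (\<lambda>(y, y'). f (y + x) * f (y' + x'))" for x x'
  have bE: "bdd (E x x')" for x x'
    unfolding E_def case_prod_beta by (intro bdd_mult bf)
  have E01: "0 \<le> E x x' p" "E x x' p \<le> 1" for x x' p
    unfolding E_def by (auto simp: case_prod_beta f01 mult_le_one)
  have EE: "m2 (\<lambda>p. E z z p * E x x' p) = \<phi> (x - z) * \<phi> (x' - z)" for x x' z
  proof -
    have "m2 (\<lambda>p. E z z p * E x x' p) =
        m (\<lambda>y. m (\<lambda>y'. (f (y + z) * f (y + x)) * (f (y' + z) * f (y' + x'))))"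
      by (simp add: m2_def E_def mult_ac)
    also have "\<dots> = m (\<lambda>y. (f (y + z) * f (y + x)) * \<phi> (x' - z))"
      by (simp add: mean_cmult[OF mm] bdd_mult[OF bf bf] shift\<phi>)
    also have "\<dots> = \<phi> (x - z) * \<phi> (x' - z)"
      by (simp add: mean_multc[OF mm] bdd_mult[OF bf bf] shift\<phi>)
    finally show ?thesis .
  qed
  define h where "h zs w p = (\<Sum>z\<leftarrow>zs. E (z + w) (z + w) p) / length zs" for zs w p
  have h_sum: "h zs w p = (\<Sum>i<length zs. E (zs ! i + w) (zs ! i + w) p) / length zs" for zs w p
    unfolding h_def by (simp add: sum_list_sum_nth atLeast0LessThan)
  have bh: "bdd (h zs w)" for zs w
    unfolding h_sum[abs_def] by (rule bdd_divide, rule bdd_sum, rule bE)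
  define Q where "Q zs w = m2 (\<lambda>p. (h zs w p)\<^sup>2)" for zs w
  have Qw: "Q zs w = Q zs 0" for zs w
  proof -
    have *: "h zs w (y, y') = h zs 0 (y + w, y' + w)" for y y'
      by (simp add: h_sum E_def algebra_simps)
    define G where "G = (\<lambda>p. (h zs 0 p)\<^sup>2)"
    have bG: "bdd G" unfolding G_def by (intro bdd_power2 bh)
    have bG': "bdd (\<lambda>y'. G (y, y'))" for y using bG by (rule bdd_comp)
    obtain B where B: "\<And>p. \<bar>G p\<bar> \<le> B" using bG bdd_def by blast
    have bG'': "bdd (\<lambda>y. m (\<lambda>y'. G (y, y')))" by (rule bddI[of _ B]) (rule mean_abs_le[OF mm bG' B])
    have "Q zs w = m (\<lambda>y. m (\<lambda>y'. G (y + w, y' + w)))"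
      by (simp add: Q_def m2_def G_def *)
    also have "\<dots> = m (\<lambda>y. m (\<lambda>y'. G (y + w, y')))"
      by (subst invariant_meanD(2)[OF m bG']) simp
    also have "\<dots> = m (\<lambda>y. m (\<lambda>y'. G (y, y')))"
      by (subst invariant_meanD(2)[OF m bG'']) simp
    finally show ?thesis by (simp add: Q_def m2_def G_def)
  qed
  have Q0: "0 \<le> Q zs w" for zs w unfolding Q_def by (intro mean_nonneg[OF mm2] bdd_power2 bh) auto
  have near_min: "\<exists>zs. zs \<noteq> [] \<and> (\<forall>zs'. zs' \<noteq> [] \<longrightarrow> Q zs 0 \<le> Q zs' 0 + e)" if "e > 0" for e
  proof -
    let ?X = "(\<lambda>zs. Q zs 0) ` {zs. zs \<noteq> []}"
    have bb: "bdd_below ?X" using Q0 by (auto intro!: bdd_belowI[of _ 0])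
    have "Inf ?X < Inf ?X + e" using that by simp
    moreover have "?X \<noteq> {}" by (auto intro!: exI[of _ "[0]"])
    ultimately obtain zs where zs: "zs \<noteq> []" "Q zs 0 < Inf ?X + e"
      using cInf_lessD[of ?X "Inf ?X + e"] by blast
    moreover have "Inf ?X \<le> Q zs' 0" if "zs' \<noteq> []" for zs' using that bb by (intro cInf_lower) auto
    ultimately show ?thesis by (intro exI[of _ zs]) force
  qed
  define K where "K zs w x x' = (\<Sum>i<length zs. \<phi> (x - (zs ! i + w)) * \<phi> (x' - (zs ! i + w))) / length zs" for zs w x x'
  have K: "K zs w x x' = m2 (\<lambda>p. h zs w p * E x x' p)" for zs w x x'
  proof -
    have "m2 (\<lambda>p. h zs w p * E x x' p) = m2 (\<lambda>p. (\<Sum>i<length zs. E (zs ! i + w) (zs ! i + w) p * E x x' p) / length zs)"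
      by (simp add: h_sum sum_distrib_right)
    also have "\<dots> = (\<Sum>i<length zs. m2 (\<lambda>p. E (zs ! i + w) (zs ! i + w) p * E x x' p)) / length zs"
      by (subst mean_divide[OF mm2], (rule bdd_sum bdd_mult bE)+, subst mean_sum[OF mm2], (rule bdd_mult bE refl)+)
    finally show ?thesis by (simp add: K_def EE)
  qed
  define \<kappa> where "\<kappa> x x' = m (\<lambda>w. \<phi> (x + w) * \<phi> (x' + w))" for x x'
  have \<kappa>: "\<kappa> x x' = \<kappa> (x - x') 0" for x x'
    using invariant_meanD(2)[OF m bdd_mult[OF b\<phi>[of "\<lambda>w. x - x' + w"] b\<phi>[of "\<lambda>w. 0 + w"]], of x']
    by (simp add: \<kappa>_def algebra_simps)
  have mK: "m (\<lambda>w. K zs w x x') = \<kappa> x x'" if "zs \<noteq> []" for zs x x'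
  proof -
    have *: "m (\<lambda>w. \<phi> (x - (z + w)) * \<phi> (x' - (z + w))) = \<kappa> x x'" for z
    proof -
      have "m (\<lambda>w. \<phi> (x - (z + w)) * \<phi> (x' - (z + w))) = m (\<lambda>w. \<phi> (x - z + w) * \<phi> (x' - z + w))"
        using invariant_meanD(3)[OF m bdd_mult[OF b\<phi>[of "\<lambda>w. x - z + w"] b\<phi>[of "\<lambda>w. x' - z + w"]]]
        by (simp add: algebra_simps)
      then show ?thesis using \<kappa>[of x x'] \<kappa>[of "x - z" "x' - z"] by (simp add: \<kappa>_def)
    qed
    have "m (\<lambda>w. K zs w x x') = (\<Sum>i<length zs. \<kappa> x x') / length zs"
      unfolding K_def
      by (subst mean_divide[OF mm], (rule bdd_sum bdd_mult b\<phi>)+, subst mean_sum[OF mm], (rule bdd_mult b\<phi>)+) (simp add: *)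
    then show ?thesis using that by simp
  qed
  have bK: "bdd (\<lambda>w. K zs w x x')" for zs x x'
    unfolding K_def by (rule bdd_divide, rule bdd_sum, rule bdd_mult; rule b\<phi>)
  have approx: "\<bar>K zs 0 x x' - \<kappa> x x'\<bar> \<le> 2 * e"
    if zs: "zs \<noteq> []" "\<And>zs'. zs' \<noteq> [] \<Longrightarrow> Q zs 0 \<le> Q zs' 0 + e\<^sup>2" and e: "e > 0" for zs x x' e
  proof -
    have *: "\<bar>K zs 0 x x' - K zs w x x'\<bar> \<le> 2 * e" for w
    proof -
      let ?zs = "zs @ map (\<lambda>z. z + w) zs"
      have mid: "h ?zs 0 p = (h zs 0 p + h zs w p) / 2" for p
      proof -
        have "h ?zs 0 p = ((\<Sum>z\<leftarrow>zs. E z z p) + (\<Sum>z\<leftarrow>zs. E (z + w) (z + w) p)) / (2 * length zs)"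
          by (simp add: h_def o_def)
        then show ?thesis by (simp only: h_def[of zs] add_divide_distrib) (simp add: mult.commute)
      qed
      have "m2 (\<lambda>p. (h zs 0 p - h zs w p)\<^sup>2) = m2 (\<lambda>p. 2 * (h zs 0 p)\<^sup>2 + 2 * (h zs w p)\<^sup>2 - 4 * (h ?zs 0 p)\<^sup>2)"
        unfolding mid by (rule arg_cong[where f = m2]) (auto simp: power2_eq_square field_simps)
      also have "\<dots> = 2 * Q zs 0 + 2 * Q zs w - 4 * Q ?zs 0"
        by (simp only: Q_def mean_add[OF mm2] mean_diff[OF mm2] mean_cmult[OF mm2] bdd_add bdd_cmult bdd_power2 bh)
      also have "\<dots> \<le> 4 * e\<^sup>2"
        using zs(2)[of ?zs] zs(1) by (simp add: Qw[of zs w])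
      finally have *: "m2 (\<lambda>p. (h zs 0 p - h zs w p)\<^sup>2) \<le> 4 * e\<^sup>2" .
      have E2: "m2 (\<lambda>p. (E x x' p)\<^sup>2) \<le> 1"
        using mean_mono[OF mm2 bdd_power2[OF bE[of x x']] bdd_const[of 1]] E01[of x x']
        by (simp add: mean_one[OF mm2] power_le_one)
      have "(K zs 0 x x' - K zs w x x')\<^sup>2 = (m2 (\<lambda>p. (h zs 0 p - h zs w p) * E x x' p))\<^sup>2"
        by (simp only: K left_diff_distrib mean_diff[OF mm2] bdd_mult bh bE)
      also have "\<dots> \<le> m2 (\<lambda>p. (h zs 0 p - h zs w p)\<^sup>2) * m2 (\<lambda>p. (E x x' p)\<^sup>2)"
        by (intro mean_CS[OF mm2] bdd_diff bh bE)
      also have "\<dots> \<le> (4 * e\<^sup>2) * 1"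
        by (intro mult_mono * E2 mean_nonneg[OF mm2] bdd_power2 bE) auto
      also have "\<dots> = (2 * e)\<^sup>2" by (simp add: power2_eq_square)
      finally have "\<bar>K zs 0 x x' - K zs w x x'\<bar> \<le> \<bar>2 * e\<bar>" by (simp only: abs_le_square_iff)
      then show ?thesis using e by simp
    qed
    have "\<bar>m (\<lambda>w. K zs 0 x x') - m (\<lambda>w. K zs w x x')\<bar> \<le> 2 * e"
      by (rule mean_dist_le[OF mm bdd_const bK *])
    then show ?thesis by (simp add: mean_const[OF mm] mK[OF zs(1)])
  qed
  define k where "k x = \<kappa> x 0" for x
  have k1: "\<bar>k x\<bar> \<le> 1" for x
  proof -
    have "\<bar>\<phi> (x + w) * \<phi> (0 + w)\<bar> \<le> 1" for w using \<phi>0 \<phi>1 by (simp add: abs_mult mult_le_one)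
    then show ?thesis unfolding k_def \<kappa>_def by (intro mean_abs_le[OF mm] bdd_mult b\<phi>)
  qed
  define \<rho>\<^sub>0 where "\<rho>\<^sub>0 x = (SUP u. \<bar>k (x + u) - k u\<bar>)" for x
  have bs: "bdd_above (range (\<lambda>u. \<bar>k (x + u) - k u\<bar>))" for x
  proof (rule bdd_aboveI2)
    show "\<bar>k (x + u) - k u\<bar> \<le> 2" for u using k1[of "x + u"] k1[of u] by linarith
  qed
  have \<rho>\<^sub>0_ge: "\<bar>k (x + u) - k u\<bar> \<le> \<rho>\<^sub>0 x" for x u
    unfolding \<rho>\<^sub>0_def using bs by (intro cSUP_upper) auto
  have \<rho>\<^sub>0_le: "\<rho>\<^sub>0 x \<le> B" if "\<And>u. \<bar>k (x + u) - k u\<bar> \<le> B" for x B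
    unfolding \<rho>\<^sub>0_def using that by (intro cSUP_least) auto
  have tri: "\<rho>\<^sub>0 (x + y) \<le> \<rho>\<^sub>0 x + \<rho>\<^sub>0 y" for x y
  proof (rule \<rho>\<^sub>0_le)
    fix u
    show "\<bar>k (x + y + u) - k u\<bar> \<le> \<rho>\<^sub>0 x + \<rho>\<^sub>0 y"
      using \<rho>\<^sub>0_ge[of x "y + u"] \<rho>\<^sub>0_ge[of y u] by (simp add: add.assoc)
  qed
  have neg_le: "\<rho>\<^sub>0 (- x) \<le> \<rho>\<^sub>0 x" for x
  proof (rule \<rho>\<^sub>0_le)
    fix u
    show "\<bar>k (- x + u) - k u\<bar> \<le> \<rho>\<^sub>0 x" using \<rho>\<^sub>0_ge[of x "- x + u"] by (simp add: abs_minus_commute)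
  qed
  have neg: "\<rho>\<^sub>0 (- x) = \<rho>\<^sub>0 x" for x using neg_le[of x] neg_le[of "- x"] by simp
  have pc: "\<exists>F. finite F \<and> (\<forall>x. \<exists>g\<in>F. \<rho>\<^sub>0 (x - g) < e)" if e: "e > 0" for e
  proof -
    obtain zs where zs: "zs \<noteq> []" "\<And>zs'. zs' \<noteq> [] \<Longrightarrow> Q zs 0 \<le> Q zs' 0 + (e / 12)\<^sup>2"
      using near_min[of "(e / 12)\<^sup>2"] e by auto
    obtain M :: nat where M: "M > 0" "1 / real M < e / 3"
      using e by (metis divide_pos_pos nat_approx_posE of_nat_Suc zero_less_Suc zero_less_numeral)
    define cell where "cell x = (\<lambda>i\<in>{..<length zs}. \<lfloor>\<phi> (x - zs ! i) * M\<rfloor>)" for x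
    have "range cell \<subseteq> PiE {..<length zs} (\<lambda>_. {0..int M})"
    proof
      fix c assume "c \<in> range cell"
      then obtain x where c: "c = cell x" by blast
      have "\<lfloor>\<phi> y * M\<rfloor> \<in> {0..int M}" for y
      proof -
        have "0 \<le> \<phi> y * M" "\<phi> y * M \<le> M" using \<phi>0[of y] \<phi>1[of y] M(1) by (auto simp: mult_le_cancel_right1)
        then show ?thesis by (simp add: floor_le_iff)
      qed
      then show "c \<in> PiE {..<length zs} (\<lambda>_. {0..int M})" unfolding c cell_def restrict_PiE_iff by blast
    qed
    then have "finite (range cell)" by (rule finite_subset) (intro finite_PiE; simp)
    then obtain F where F: "finite F" "\<And>x. \<exists>g\<in>F. cell g = cell x" using finite_range_representatives by metis
    have "\<rho>\<^sub>0 (x - g) < e" if "cell g = cell x" for x g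
    proof -
      have close: "\<bar>\<phi> (x - zs ! i) - \<phi> (g - zs ! i)\<bar> \<le> 1 / M" if "i < length zs" for i
      proof -
        have "\<lfloor>\<phi> (x - zs ! i) * M\<rfloor> = \<lfloor>\<phi> (g - zs ! i) * M\<rfloor>"
          using fun_cong[OF \<open>cell g = cell x\<close>, of i] that by (simp add: cell_def)
        then have "\<bar>\<phi> (x - zs ! i) * M - \<phi> (g - zs ! i) * M\<bar> \<le> 1" by linarith
        then have "\<bar>\<phi> (x - zs ! i) - \<phi> (g - zs ! i)\<bar> * M \<le> 1"
          using M(1) by (simp add: abs_mult flip: left_diff_distrib)
        then show ?thesis using M(1) by (simp add: field_simps)
      qed
      have Kc: "\<bar>K zs 0 x u - K zs 0 g u\<bar> \<le> 1 / M" for u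
      proof -
        have "\<bar>\<Sum>i<length zs. (\<phi> (x - zs ! i) - \<phi> (g - zs ! i)) * \<phi> (u - zs ! i)\<bar> \<le> (\<Sum>i<length zs. 1 / M)"
        proof (rule order_trans[OF sum_abs], rule sum_mono)
          fix i assume "i \<in> {..<length zs}"
          then have "\<bar>\<phi> (x - zs ! i) - \<phi> (g - zs ! i)\<bar> * \<bar>\<phi> (u - zs ! i)\<bar> \<le> 1 / M * 1"
            using close[of i] \<phi>0 \<phi>1 by (intro mult_mono) auto
          then show "\<bar>(\<phi> (x - zs ! i) - \<phi> (g - zs ! i)) * \<phi> (u - zs ! i)\<bar> \<le> 1 / M" by (simp add: abs_mult)
        qed
        then have S: "\<bar>\<Sum>i<length zs. (\<phi> (x - zs ! i) - \<phi> (g - zs ! i)) * \<phi> (u - zs ! i)\<bar> \<le> length zs * (1 / M)" by simp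
        have eq: "K zs 0 x u - K zs 0 g u = (\<Sum>i<length zs. (\<phi> (x - zs ! i) - \<phi> (g - zs ! i)) * \<phi> (u - zs ! i)) / length zs"
          by (simp add: K_def left_diff_distrib sum_subtractf diff_divide_distrib)
        have "\<bar>K zs 0 x u - K zs 0 g u\<bar> \<le> (length zs * (1 / M)) / length zs"
          unfolding eq abs_divide abs_of_nat by (rule divide_right_mono[OF S]) simp
        then show ?thesis using zs(1) by simp
      qed
      have "\<bar>k (x - g + u) - k u\<bar> \<le> e / 6 + e / 6 + 1 / M" for u
      proof -
        have "k (x - g + u) = \<kappa> x (g - u)" "k u = \<kappa> g (g - u)"
          using \<kappa>[of x "g - u"] \<kappa>[of g "g - u"] by (simp_all add: k_def algebra_simps)
        moreover have "\<bar>K zs 0 x (g - u) - \<kappa> x (g - u)\<bar> \<le> e / 6" "\<bar>K zs 0 g (g - u) - \<kappa> g (g - u)\<bar> \<le> e / 6"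
          using approx[OF zs] e by (simp_all)
        ultimately show ?thesis using Kc[of "g - u"] by linarith
      qed
      then have "\<rho>\<^sub>0 (x - g) \<le> e / 6 + e / 6 + 1 / M" by (rule \<rho>\<^sub>0_le)
      then show ?thesis using M(2) e by linarith
    qed
    then show ?thesis using F by metis
  qed
  have k_pos: "k 0 > 0"
  proof -
    obtain F where F: "finite F" "\<And>x. \<exists>g\<in>F. x - g \<in> D" using D unfolding big_def by blast
    have cover: "1 \<le> (\<Sum>g\<in>F. f (x - g))" for x
    proof -
      obtain g where g: "g \<in> F" "x - g \<in> D" using F by blast
      have "f (x - g) \<le> (\<Sum>g\<in>F. f (x - g))" using g F(1) f01 by (intro member_le_sum) auto
      then show ?thesis using g by (simp add: f_def)
    qed
    have inv: "m (\<lambda>x. f (x - g)) = m f" for g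
      using invariant_meanD(2)[OF m bf[of "\<lambda>y. y"], of "- g"] by simp
    have "1 = m (\<lambda>_. 1)" by (simp add: mean_one[OF mm])
    also have "\<dots> \<le> m (\<lambda>x. \<Sum>g\<in>F. f (x - g))" by (intro mean_mono[OF mm] bdd_const bdd_sum bf cover)
    also have "\<dots> = card F * m f" by (subst mean_sum[OF mm]) (simp_all add: bf inv)
    finally have mf: "m f > 0"
      by (metis linorder_not_less mult_nonneg_nonpos not_one_le_zero of_nat_0_le_iff order_trans)
    have inv: "m (\<lambda>x. \<phi> (x - g)) = m \<phi>" for g
      using invariant_meanD(2)[OF m b\<phi>[of "\<lambda>y. y"], of "- g"] by simp
    have "m f \<le> (\<Sum>g\<in>F. \<phi> (x - g))" for x
    proof -
      have "m (\<lambda>y. f y) \<le> m (\<lambda>y. \<Sum>g\<in>F. f y * f (y + (x - g)))"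
      proof (intro mean_mono[OF mm] bdd_sum bdd_mult bf)
        fix y
        have "f y * 1 \<le> f y * (\<Sum>g\<in>F. f (y + x - g))" by (intro mult_left_mono cover f01)
        then show "f y \<le> (\<Sum>g\<in>F. f y * f (y + (x - g)))" by (simp add: sum_distrib_left algebra_simps)
      qed
      also have "\<dots> = (\<Sum>g\<in>F. \<phi> (x - g))" by (subst mean_sum[OF mm]) (simp_all add: bdd_mult bf \<phi>_def)
      finally show ?thesis by simp
    qed
    then have "m (\<lambda>_. m f) \<le> m (\<lambda>x. \<Sum>g\<in>F. \<phi> (x - g))" by (intro mean_mono[OF mm] bdd_const bdd_sum b\<phi>)
    also have "\<dots> = card F * m \<phi>" by (subst mean_sum[OF mm]) (simp_all add: b\<phi> inv)
    finally have "m \<phi> > 0" using mf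
      by (simp add: mean_const[OF mm]) (metis linorder_not_less mult_nonneg_nonpos of_nat_0_le_iff order_less_le_trans)
    then have "0 < (m \<phi>)\<^sup>2" by simp
    also have "\<dots> \<le> k 0"
      using mean_CS[OF mm b\<phi>[of "\<lambda>y. y"] bdd_const[of 1]]
      by (simp add: k_def \<kappa>_def mean_one[OF mm] power2_eq_square)
    finally show ?thesis .
  qed
  define \<rho> where "\<rho> x = \<rho>\<^sub>0 x / k 0" for x
  show ?thesis
  proof
    show "precompact_norm \<rho>"
      unfolding precompact_norm_def
    proof (intro conjI allI impI)
      show "\<rho> (x + y) \<le> \<rho> x + \<rho> y" for x y
        using tri[of x y] k_pos unfolding \<rho>_def by (metis add_divide_distrib divide_right_mono less_imp_le)
      show "\<rho> (- x) = \<rho> x" for x by (simp add: \<rho>_def neg)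
      show "\<rho> 0 = 0" by (simp add: \<rho>_def \<rho>\<^sub>0_def)
      show "\<exists>F. finite F \<and> (\<forall>x. \<exists>g\<in>F. \<rho> (x - g) < e)" if "e > 0" for e
        using pc[of "e * k 0"] that k_pos by (simp add: \<rho>_def pos_divide_less_eq)
    qed
    fix x assume "\<rho> x < 1"
    then have "\<rho>\<^sub>0 x < k 0" using k_pos by (simp add: \<rho>_def)
    then have "k x \<noteq> 0" using \<rho>\<^sub>0_ge[of x 0] by auto
    have nz: "\<exists>p\<in>D. \<exists>q\<in>D. x = p - q" if "\<phi> x \<noteq> 0" for x
    proof (rule ccontr)
      assume "\<not> ?thesis"
      then have "f y * f (y + x) = 0" for y unfolding f_def indicator_def by force
      then have "\<phi> x = m (\<lambda>_. 0)" by (simp only: \<phi>_def)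
      then show False using that by (simp add: mean_const[OF mm])
    qed
    obtain w where "\<phi> (x + w) * \<phi> (0 + w) \<noteq> 0"
    proof (rule ccontr)
      assume "\<not> thesis"
      then have "\<And>w. \<phi> (x + w) * \<phi> (0 + w) = 0" using that by blast
      then have "k x = m (\<lambda>_. 0)" by (simp only: k_def \<kappa>_def)
      then show False using \<open>k x \<noteq> 0\<close> by (simp add: mean_const[OF mm])
    qed
    then obtain p q r s where "p \<in> D" "q \<in> D" "r \<in> D" "s \<in> D" "x + w = p - q" "w = r - s"
      using nz[of "x + w"] nz[of w] by auto
    moreover from this have "x = (p - q) + (s - r)" by (simp add: algebra_simps)
    ultimately show "\<exists>p\<in>D. \<exists>q\<in>D. \<exists>r\<in>D. \<exists>s\<in>D. x = (p - q) + (r - s)" by blast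
  qed
qed

section \<open>Precompactness of minimal torsion-free groups\<close>

lemma bigI: "finite F \<Longrightarrow> (\<And>x. \<exists>f\<in>F. x - f \<in> A) \<Longrightarrow> big A"
  unfolding big_def by (rule exI[of _ F]) simp

lemma bigE: assumes "big A" obtains F where "finite F" "\<And>x. \<exists>f\<in>F. x - f \<in> A"
  using assms unfolding big_def by (elim exE conjE) (rule that, assumption, erule spec)

lemma ex_ultrafilter_le:
  fixes F :: "'x filter"
  assumes "F \<noteq> bot"
  shows "\<exists>G\<le>F. G \<noteq> bot \<and> (\<forall>P. eventually P G \<or> eventually (\<lambda>x. \<not> P x) G)"
proof -
  let ?A = "{G. G \<le> F \<and> G \<noteq> bot}"
  have "\<exists>G\<in>?A. \<forall>H\<in>?A. H \<le> G \<longrightarrow> H = G"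
  proof (rule predicate_Zorn[where P = "\<lambda>G H. H \<le> G"])
    show "partial_order_on ?A (relation_of (\<lambda>G H. H \<le> G) ?A)"
      by (rule partial_order_on_relation_ofI) auto
    fix C assume C: "C \<in> Chains (relation_of (\<lambda>G H. H \<le> G) ?A)"
    then have CA: "C \<subseteq> ?A" and tot: "\<And>G H. G \<in> C \<Longrightarrow> H \<in> C \<Longrightarrow> G \<le> H \<or> H \<le> G"
      unfolding Chains_def relation_of_def by blast+
    show "\<exists>u\<in>?A. \<forall>a\<in>C. u \<le> a"
    proof (cases "C = {}")
      case True
      then show ?thesis using assms by auto
    next
      case False
      have "eventually P (Inf C) \<longleftrightarrow> (\<exists>b\<in>C. eventually P b)" for P
      proof (rule eventually_Inf_base[OF False])
        fix G H assume "G \<in> C" "H \<in> C"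
        then show "\<exists>x\<in>C. x \<le> inf G H" using tot[of G H] by (auto simp: inf.absorb1 inf.absorb2)
      qed
      then have "Inf C \<noteq> bot"
        using CA by (auto simp: trivial_limit_def)
      moreover obtain G where "G \<in> C" using False by blast
      then have "Inf C \<le> F" using CA Inf_lower[of G C] by (auto intro: order_trans)
      ultimately show ?thesis by (auto intro: Inf_lower)
    qed
  qed
  then obtain G where G: "G \<le> F" "G \<noteq> bot" "\<And>H. H \<le> F \<Longrightarrow> H \<noteq> bot \<Longrightarrow> H \<le> G \<Longrightarrow> H = G" by blast
  have "eventually P G \<or> eventually (\<lambda>x. \<not> P x) G" for P
  proof (cases "inf G (principal {x. P x}) = bot")
    case True
    then have "eventually (\<lambda>x. \<not> P x) G"
      unfolding trivial_limit_def eventually_inf_principal by simp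
    then show ?thesis by simp
  next
    case False
    then have eq: "inf G (principal {x. P x}) = G" using G by (meson inf_le1 order_trans)
    have "eventually P (inf G (principal {x. P x}))" by (simp add: eventually_inf_principal)
    then show ?thesis unfolding eq ..
  qed
  then show ?thesis using G by blast
qed

lemma prime_factor_induct:
  fixes k :: nat
  assumes k: "k > 0" "\<And>p. prime p \<Longrightarrow> p dvd k \<Longrightarrow> Q p"
    and one: "P 1" and mult: "\<And>p k. prime p \<Longrightarrow> Q p \<Longrightarrow> k > 0 \<Longrightarrow> P k \<Longrightarrow> P (p * k)"
  shows "P k"
  using k
proof (induction k rule: less_induct)
  case (less k)
  show ?case
  proof (cases "k = 1")
    case False
    then obtain p where p: "prime p" "p dvd k" using prime_factor_nat by blast
    then obtain l where l: "k = p * l" by blast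
    then have l0: "l > 0" using less.prems by auto
    have "l < k" using l l0 prime_gt_1_nat[OF p(1)] by simp
    then have "P l" using less.IH[of l] less.prems l l0 by simp
    then show ?thesis using mult[OF p(1) _ l0] less.prems(2)[OF p] l by simp
  qed (use one in simp)
qed

lemma ex_factor_split:
  fixes k :: nat
  assumes "k > 0"
  shows "\<exists>a b. k = a * b \<and> a > 0 \<and> b > 0 \<and> (\<forall>p. prime p \<longrightarrow> p dvd a \<longrightarrow> Q p) \<and> (\<forall>p. prime p \<longrightarrow> p dvd b \<longrightarrow> \<not> Q p)"
    (is "?P k")
proof (rule prime_factor_induct[where Q = "\<lambda>_. True" and P = ?P, OF assms])
  show "?P 1" by (intro exI[of _ 1]) auto
next
  fix p k :: nat assume p: "prime p" and "?P k"
  then obtain a b where ab: "k = a * b" "a > 0" "b > 0" "\<And>p. prime p \<Longrightarrow> p dvd a \<Longrightarrow> Q p"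
    "\<And>p. prime p \<Longrightarrow> p dvd b \<Longrightarrow> \<not> Q p" by blast
  have div: "q dvd c \<or> q = p" if "prime q" "q dvd p * c" for q c
    using that p by (metis prime_dvd_mult_iff primes_dvd_imp_eq)
  show "?P (p * k)"
  proof (cases "Q p")
    case True
    have "\<forall>q. prime q \<longrightarrow> q dvd p * a \<longrightarrow> Q q" using div ab(4) True by blast
    then show ?thesis using ab p by (intro exI[of _ "p * a"] exI[of _ b]) (auto simp: prime_gt_0_nat)
  next
    case False
    have "\<forall>q. prime q \<longrightarrow> q dvd p * b \<longrightarrow> \<not> Q q" using div ab(5) False by blast
    then show ?thesis using ab p by (intro exI[of _ a] exI[of _ "p * b"]) (auto simp: prime_gt_0_nat)
  qed
qed simp

lemma nbhds_zmul_le: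
  assumes N: "group_nbhds N" "U \<in> N"
  shows "\<exists>V\<in>N. \<forall>k. \<bar>k\<bar> \<le> int n \<longrightarrow> (\<forall>x\<in>V. zmul k x \<in> U)"
proof (induction n)
  case 0
  then show ?case using N nbhds_zero[OF N] by (intro bexI[of _ U]) auto
next
  case (Suc n)
  then obtain V where V: "V \<in> N" "\<And>k x. \<bar>k\<bar> \<le> int n \<Longrightarrow> x \<in> V \<Longrightarrow> zmul k x \<in> U" by blast
  obtain V' where V': "V' \<in> N" "\<And>x. x \<in> V' \<Longrightarrow> zmul (int n + 1) x \<in> U"
    using nbhds_zmul[OF N, where k = "int n + 1"] by metis
  obtain W where W: "W \<in> N" "W \<subseteq> V" "W \<subseteq> V'" using nbhds_Int[OF N(1) V(1) V'(1)] .
  have "zmul k x \<in> U" if kx: "\<bar>k\<bar> \<le> int (Suc n)" "x \<in> W" for k x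
  proof -
    consider "\<bar>k\<bar> \<le> int n" | "k = int n + 1" | "k = - (int n + 1)" using kx(1) by linarith
    then show ?thesis
    proof cases
      case 1 then show ?thesis using V(2) W(2) kx(2) by blast
    next
      case 2 then show ?thesis using V'(2) W(3) kx(2) by blast
    next
      case 3
      have "- zmul (int n + 1) x \<in> U" using V'(2) W(3) kx(2) by (intro nbhds_uminus[OF N]) blast
      then show ?thesis unfolding 3 zmul_minus_left .
    qed
  qed
  then show ?case using W(1) by blast
qed

definition plus_multiples :: "'a::ab_group_add set \<Rightarrow> nat \<Rightarrow> 'a set" where
  "plus_multiples W n = {x. \<exists>y. x - zmul (int n) y \<in> W}"

definition bad_prime :: "'a::ab_group_add set set \<Rightarrow> nat \<Rightarrow> bool" where
  "bad_prime N p \<longleftrightarrow> prime p \<and> (\<exists>W\<in>N. \<not> big (plus_multiples W p))"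

lemma good_multiples_big:
  assumes N: "group_nbhds N" and k: "k > 0" "\<And>p. prime p \<Longrightarrow> p dvd k \<Longrightarrow> \<not> bad_prime N p"
  shows "\<forall>W\<in>N. big (plus_multiples W k)"
proof (rule prime_factor_induct[where Q = "\<lambda>p. \<not> bad_prime N p", OF k])
  show "\<forall>W\<in>N. big (plus_multiples W 1)"
  proof
    fix W assume W: "W \<in> N"
    have "x - 0 \<in> plus_multiples W 1" for x
      unfolding plus_multiples_def using nbhds_zero[OF N W] by (auto intro!: exI[of _ x] simp: zmul_one)
    then show "big (plus_multiples W 1)" by (intro bigI[of "{0}"]) auto
  qed
next
  fix p k :: nat
  assume p: "prime p" "\<not> bad_prime N p" and k: "\<forall>W\<in>N. big (plus_multiples W k)"
  show "\<forall>W\<in>N. big (plus_multiples W (p * k))"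
  proof
    fix W assume "W \<in> N"
    then obtain W' where W': "W' \<in> N" "\<And>x y. x \<in> W' \<Longrightarrow> y \<in> W' \<Longrightarrow> x + y \<in> W" using nbhds_add[OF N] by metis
    obtain V where V: "V \<in> N" "\<And>x. x \<in> V \<Longrightarrow> zmul (int p) x \<in> W'"
      using nbhds_zmul[OF N W'(1), where k = "int p"] by metis
    have "big (plus_multiples W' p)" using p W'(1) unfolding bad_prime_def by blast
    then obtain F where F: "finite F" "\<And>x. \<exists>f\<in>F. x - f \<in> plus_multiples W' p" by (rule bigE) (rule that)
    have "big (plus_multiples V k)" using k V(1) by blast
    then obtain F' where F': "finite F'" "\<And>x. \<exists>f\<in>F'. x - f \<in> plus_multiples V k" by (rule bigE) (rule that)
    have cover: "\<exists>h\<in>(\<lambda>(f, f'). f + zmul (int p) f') ` (F \<times> F'). x - h \<in> plus_multiples W (p * k)" for x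
    proof -
      obtain f y where f: "f \<in> F" "x - f - zmul (int p) y \<in> W'" using F(2)[of x] unfolding plus_multiples_def by blast
      obtain f' z where f': "f' \<in> F'" "y - f' - zmul (int k) z \<in> V" using F'(2)[of y] unfolding plus_multiples_def by blast
      have "(x - f - zmul (int p) y) + zmul (int p) (y - f' - zmul (int k) z) \<in> W"
        by (intro W'(2) f V(2) f')
      also have "(x - f - zmul (int p) y) + zmul (int p) (y - f' - zmul (int k) z)
          = x - (f + zmul (int p) f') - zmul (int (p * k)) z"
        by (simp add: zmul.scale_right_diff_distrib algebra_simps)
      finally show ?thesis using f f' unfolding plus_multiples_def by force
    qed
    show "big (plus_multiples W (p * k))" by (rule bigI[OF _ cover]) (simp add: F(1) F'(1))
  qed
qed

lemma minimal_nbhds_smooth_multiples_big: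
  assumes min: "minimal_nbhds N" and U: "U \<in> N"
  shows "\<exists>k>0. big {y. zmul (int k) y \<in> U} \<and> (\<forall>p. prime p \<longrightarrow> p dvd k \<longrightarrow> bad_prime N p)"
proof -
  have N: "group_nbhds N" by (rule minimal_nbhdsD(1)[OF min])
  obtain V where V: "V \<in> N" "\<And>x y. x \<in> V \<Longrightarrow> y \<in> V \<Longrightarrow> x + y \<in> U" using nbhds_add[OF N U] by metis
  obtain l where l: "l > 0" "big {y. zmul l y \<in> V}" using minimal_nbhds_multiples_big[OF min V(1)] by blast
  obtain a b where ab: "nat l = a * b" "a > 0" "b > 0" "\<And>p. prime p \<Longrightarrow> p dvd a \<Longrightarrow> bad_prime N p"
    "\<And>p. prime p \<Longrightarrow> p dvd b \<Longrightarrow> \<not> bad_prime N p"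
    using ex_factor_split[of "nat l" "bad_prime N"] l(1) by auto
  have lab: "l = int a * int b" using ab(1) l(1) by (metis int_nat_eq less_imp_le of_nat_mult)
  obtain W where W: "W \<in> N" "\<And>x. x \<in> W \<Longrightarrow> zmul (int a) x \<in> V"
    using nbhds_zmul[OF N V(1), where k = "int a"] by metis
  have "big (plus_multiples W b)" using good_multiples_big[OF N ab(3,5)] W(1) by blast
  then obtain F where F: "finite F" "\<And>x. \<exists>f\<in>F. x - f \<in> plus_multiples W b" by (rule bigE) (rule that)
  obtain F' where F': "finite F'" "\<And>x. \<exists>f\<in>F'. x - f \<in> {y. zmul l y \<in> V}" using l(2) by (rule bigE) (rule that)
  have cover: "\<exists>h\<in>(\<lambda>(f, f'). f + zmul (int b) f') ` (F \<times> F'). x - h \<in> {y. zmul (int a) y \<in> U}" for x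
  proof -
    obtain f y where f: "f \<in> F" "x - f - zmul (int b) y \<in> W" using F(2)[of x] unfolding plus_multiples_def by blast
    obtain f' where f': "f' \<in> F'" "zmul l (y - f') \<in> V" using F'(2)[of y] by blast
    have "zmul (int a) (x - f - zmul (int b) y) + zmul l (y - f') \<in> U" by (intro V(2) W(2) f f')
    also have "zmul (int a) (x - f - zmul (int b) y) + zmul l (y - f') = zmul (int a) (x - (f + zmul (int b) f'))"
      unfolding lab by (simp add: zmul.scale_right_diff_distrib algebra_simps)
    finally show ?thesis using f f' by force
  qed
  have "big {y. zmul (int a) y \<in> U}" by (rule bigI[OF _ cover]) (simp add: F(1) F'(1))
  then show ?thesis using ab by blast
qed

text \<open>At most \<open>n - 1\<close> of the \<open>n\<close> positive and \<open>n\<close> negative units lie outside \<open>S (n - 1)\<close>, so one of each sign can be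
  cancelled against each other inside \<open>S (n - 1)\<close>, at cost \<open>e (n - 1)\<close>.\<close>
lemma norm_pairing_bound:
  fixes d :: "'i \<Rightarrow> int"
  assumes \<rho>: "precompact_norm \<rho>" and B: "finite B"
    and e: "\<And>r i j. i \<in> S r \<Longrightarrow> j \<in> S r \<Longrightarrow> \<rho> (a i - a j) \<le> e r"
  shows "(\<Sum>i\<in>B. d i) = 0 \<Longrightarrow> (\<Sum>i\<in>B. max (d i) 0) = int n \<Longrightarrow> (\<And>r. (\<Sum>i\<in>B - S r. \<bar>d i\<bar>) \<le> int r) \<Longrightarrow>
    \<rho> (\<Sum>i\<in>B. zmul (d i) (a i)) \<le> (\<Sum>t<n. e t)"
proof (induction n arbitrary: d)
  case 0
  have le: "d i \<le> 0" if "i \<in> B" for i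
  proof -
    have "max (d i) 0 \<le> (\<Sum>i\<in>B. max (d i) 0)" using that B by (intro member_le_sum) auto
    then show ?thesis using 0(2) by simp
  qed
  have "d i = 0" if "i \<in> B" for i
    using sum_nonneg_eq_0_iff[OF B, of "\<lambda>i. - d i"] le 0(1) that by (auto simp: sum_negf)
  then have "(\<Sum>i\<in>B. zmul (d i) (a i)) = 0" by simp
  then show ?case using \<rho> by (simp add: precompact_norm_def)
next
  case (Suc n)
  have neg: "(\<Sum>i\<in>B. max (- d i) 0) = int (Suc n)"
  proof -
    have "(\<Sum>i\<in>B. max (- d i) 0) = (\<Sum>i\<in>B. max (d i) 0 - d i)" by (rule sum.cong) auto
    then show ?thesis using Suc.prems by (simp add: sum_subtractf)
  qed
  have ex: "\<exists>i\<in>B \<inter> S n. f i > 0"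
    if f: "(\<Sum>i\<in>B. max (f i) 0) = int (Suc n)" "\<And>i. max (f i) 0 \<le> \<bar>d i\<bar>" for f :: "'i \<Rightarrow> int"
  proof (rule ccontr)
    assume no: "\<not> ?thesis"
    have "max (f i) 0 = 0" if "i \<in> B" "i \<in> S n" for i
    proof -
      have "\<not> f i > 0" using no that by blast
      then show ?thesis by simp
    qed
    then have "(\<Sum>i\<in>B. max (f i) 0) = (\<Sum>i\<in>B - S n. max (f i) 0)"
      by (intro sum.mono_neutral_right[OF B]) auto
    also have "\<dots> \<le> (\<Sum>i\<in>B - S n. \<bar>d i\<bar>)" by (rule sum_mono) (rule f(2))
    also have "\<dots> \<le> int n" by (rule Suc.prems(3))
    finally show False using f(1) by simp
  qed
  have "\<exists>i\<in>B \<inter> S n. d i > 0" by (rule ex[OF Suc.prems(2)]) auto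
  then obtain i where i: "i \<in> B" "i \<in> S n" "d i > 0" by blast
  have "\<exists>j\<in>B \<inter> S n. - d j > 0" by (rule ex[OF neg]) auto
  then obtain j where j: "j \<in> B" "j \<in> S n" "d j < 0" by auto
  have ij: "i \<noteq> j" using i j by auto
  define d' where "d' l = d l - of_bool (l = i) + of_bool (l = j)" for l
  have s1: "(\<Sum>l\<in>B. of_bool (l = m) :: int) = 1" if "m \<in> B" for m
    using that B by (simp add: of_bool_def sum.delta)
  have "(\<Sum>l\<in>B. d' l) = 0"
    using Suc.prems(1) i j by (simp add: d'_def sum.distrib sum_subtractf s1)
  moreover have "(\<Sum>l\<in>B. max (d' l) 0) = int n"
  proof -
    have "max (d' l) 0 = max (d l) 0 - of_bool (l = i)" for l
      using i j ij by (auto simp: d'_def)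
    then show ?thesis using Suc.prems(2) i by (simp add: sum_subtractf s1)
  qed
  moreover have "(\<Sum>l\<in>B - S r. \<bar>d' l\<bar>) \<le> int r" for r
  proof -
    have "(\<Sum>l\<in>B - S r. \<bar>d' l\<bar>) \<le> (\<Sum>l\<in>B - S r. \<bar>d l\<bar>)"
      by (rule sum_mono) (use i j in \<open>auto simp: d'_def\<close>)
    then show ?thesis using Suc.prems(3)[of r] by linarith
  qed
  ultimately have IH: "\<rho> (\<Sum>l\<in>B. zmul (d' l) (a l)) \<le> (\<Sum>t<n. e t)" by (rule Suc.IH)
  have s2: "(\<Sum>l\<in>B. zmul (of_bool (l = m)) (a l)) = a m" if "m \<in> B" for m
  proof -
    have "(\<Sum>l\<in>B. zmul (of_bool (l = m)) (a l)) = (\<Sum>l\<in>B. if l = m then a l else 0)"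
      by (rule sum.cong) (auto simp: zmul_one)
    then show ?thesis using that B by simp
  qed
  have "(\<Sum>l\<in>B. zmul (d l) (a l)) = (\<Sum>l\<in>B. zmul (d' l) (a l)) + (a i - a j)"
    using i j by (simp add: d'_def zmul_add_left zmul.scale_left_diff_distrib sum.distrib sum_subtractf s2)
  then have "\<rho> (\<Sum>l\<in>B. zmul (d l) (a l)) \<le> \<rho> (\<Sum>l\<in>B. zmul (d' l) (a l)) + \<rho> (a i - a j)"
    using \<rho> by (simp add: precompact_norm_def)
  then show ?case using IH e[OF i(2) j(2)] by simp
qed

lemma lincomb_zmul: "lincomb a (\<lambda>i. k * c i) = zmul k (lincomb a c)" if "finite {i. c i \<noteq> 0}"
proof -
  have "lincomb a (\<lambda>i. k * c i) = (\<Sum>i | c i \<noteq> 0. zmul (k * c i) (a i))"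
    using that by (intro lincomb_eq) auto
  then show ?thesis by (simp add: lincomb_def zmul.scale_sum_right)
qed

lemma not_big_imp_sequence:
  assumes N: "group_nbhds N"
    and U: "\<And>p. bad_prime N p \<Longrightarrow> U p \<in> N" "\<And>p. bad_prime N p \<Longrightarrow> \<not> big (plus_multiples (U p) p)"
  shows "\<exists>W a. \<forall>p. bad_prime N p \<longrightarrow> W p \<in> N \<and>
    (\<forall>c. finite {i. c i \<noteq> 0} \<longrightarrow> (\<forall>i. c i \<noteq> 0 \<longrightarrow> p \<le> i) \<longrightarrow> lincomb a c \<in> W p \<longrightarrow> (\<forall>i. int p dvd c i))"
proof -
  have "\<exists>W\<in>N. \<forall>l. \<bar>l\<bar> \<le> int p \<longrightarrow> (\<forall>x\<in>W. \<forall>y\<in>W. zmul l (x - y) \<in> U p)" if p: "bad_prime N p" for p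
  proof -
    obtain V where V: "V \<in> N" "\<And>l x. \<bar>l\<bar> \<le> int p \<Longrightarrow> x \<in> V \<Longrightarrow> zmul l x \<in> U p"
      using nbhds_zmul_le[OF N U(1)[OF p]] by blast
    obtain W where W: "W \<in> N" "\<And>x y. x \<in> W \<Longrightarrow> y \<in> W \<Longrightarrow> x - y \<in> V" using nbhds_add[OF N V(1)] by metis
    then show ?thesis using V(2) by (intro bexI[of _ W] allI impI ballI) auto
  qed
  then obtain W where W: "\<And>p. bad_prime N p \<Longrightarrow> W p \<in> N"
    "\<And>p l x y. bad_prime N p \<Longrightarrow> \<bar>l\<bar> \<le> int p \<Longrightarrow> x \<in> W p \<Longrightarrow> y \<in> W p \<Longrightarrow> zmul l (x - y) \<in> U p"
    by metis
  define CF :: "nat \<Rightarrow> nat \<Rightarrow> (nat \<Rightarrow> int) set" where "CF p J = PiE {..<J} (\<lambda>_. {0..<int p})" for p J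
  have "\<exists>a. \<forall>J. \<forall>p. bad_prime N p \<longrightarrow> p \<le> J \<longrightarrow> (\<forall>k\<in>{1..<int p}. \<forall>c\<in>CF p J.
      zmul k (a J) + (\<Sum>i<J. zmul (c i) (a i)) \<notin> plus_multiples (W p) p)"
  proof (rule dependent_wellorder_choice)
    fix J and a :: "nat \<Rightarrow> 'a"
    let ?I = "Sigma {p. bad_prime N p \<and> p \<le> J} (\<lambda>p. {1..<int p} \<times> CF p J)"
    let ?D = "\<lambda>(p, k :: int, c :: nat \<Rightarrow> int). plus_multiples (U p) p"
    let ?A = "\<lambda>(p, k, c). {x. zmul k x + (\<Sum>i<J. zmul (c i) (a i)) \<in> plus_multiples (W p) p}"
    have fin: "finite ?I" unfolding CF_def by (intro finite_SigmaI finite_cartesian_product finite_PiE) auto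
    have nb: "\<not> big (?D i)" if "i \<in> ?I" for i using that U(2) by auto
    have di: "x - y \<in> ?D i" if i: "i \<in> ?I" and xy: "x \<in> ?A i" "y \<in> ?A i" for i x y
    proof -
      obtain p k c where ipkc: "i = (p, k, c)" by (metis prod.collapse)
      have p: "bad_prime N p" and k: "1 \<le> k" "k < int p" using i ipkc by auto
      have "prime (int p)" using p by (simp add: bad_prime_def)
      moreover have "\<not> int p dvd k" using k zdvd_not_zless[of k "int p"] by auto
      ultimately have "coprime (int p) k" by (rule prime_imp_coprime)
      then obtain l' v where lv: "l' * k + v * int p = 1"
        using bezout_int[of k "int p"] by (auto simp: coprime_commute)
      define l where "l = l' mod int p"
      define t where "t = - v - k * (l' div int p)"
      have "k * l = k * l' - k * (l' div int p) * int p"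
        unfolding l_def by (simp add: minus_mult_div_eq_mod[symmetric] algebra_simps)
      also have "\<dots> = 1 + int p * t" using lv unfolding t_def by (simp add: algebra_simps)
      finally have t: "k * l = 1 + int p * t" .
      have l: "0 \<le> l" "l \<le> int p" using k unfolding l_def by (simp_all add: less_imp_le)
      let ?S = "\<Sum>i<J. zmul (c i) (a i)"
      obtain u where u: "zmul k x + ?S - zmul (int p) u \<in> W p" using xy(1) ipkc unfolding plus_multiples_def by auto
      obtain v where v: "zmul k y + ?S - zmul (int p) v \<in> W p" using xy(2) ipkc unfolding plus_multiples_def by auto
      have "zmul l ((zmul k x + ?S - zmul (int p) u) - (zmul k y + ?S - zmul (int p) v)) \<in> U p"
        by (rule W(2)[OF p _ u v]) (use l in simp)
      also have "zmul l ((zmul k x + ?S - zmul (int p) u) - (zmul k y + ?S - zmul (int p) v))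
          = zmul (k * l) (x - y) - zmul (int p) (zmul l (u - v))"
        by (simp add: zmul.scale_right_diff_distrib zmul_add_right algebra_simps)
      also have "\<dots> = (x - y) - zmul (int p) (zmul l (u - v) - zmul t (x - y))"
        unfolding t by (simp add: zmul.scale_right_diff_distrib zmul_add_left zmul_one algebra_simps)
      finally show ?thesis unfolding ipkc plus_multiples_def by auto
    qed
    have "\<exists>x. \<forall>i\<in>?I. x \<notin> ?A i"
      by (rule ex_notin_small_sets[where D = ?D and A = ?A, OF fin nb di])
    then obtain x where x: "\<forall>i\<in>?I. x \<notin> ?A i" by (elim exE)
    show "\<exists>x. \<forall>p. bad_prime N p \<longrightarrow> p \<le> J \<longrightarrow> (\<forall>k\<in>{1..<int p}. \<forall>c\<in>CF p J.
        zmul k x + (\<Sum>i<J. zmul (c i) (a i)) \<notin> plus_multiples (W p) p)"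
    proof (intro exI[of _ x] allI impI ballI)
      fix p k c assume "bad_prime N p" "p \<le> J" "k \<in> {1..<int p}" "c \<in> CF p J"
      then have "(p, k, c) \<in> ?I" by simp
      then have "x \<notin> ?A (p, k, c)" using x by blast
      then show "zmul k x + (\<Sum>i<J. zmul (c i) (a i)) \<notin> plus_multiples (W p) p" by simp
    qed
  qed auto
  then obtain a where a: "\<And>J p k c. bad_prime N p \<Longrightarrow> p \<le> J \<Longrightarrow> k \<in> {1..<int p} \<Longrightarrow> c \<in> CF p J \<Longrightarrow>
      zmul k (a J) + (\<Sum>i<J. zmul (c i) (a i)) \<notin> plus_multiples (W p) p"
    by blast
  have "int p dvd c i" if p: "bad_prime N p" and c: "finite {i. c i \<noteq> 0}" "\<And>i. c i \<noteq> 0 \<Longrightarrow> p \<le> i"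
    "lincomb a c \<in> W p" for p c i
  proof (rule ccontr)
    assume ndvd: "\<not> int p dvd c i"
    have p0: "int p > 0" using p by (auto simp: bad_prime_def prime_gt_0_nat)
    define d where "d = (\<lambda>i. c i - int p * (c i div int p))"
    have d: "d i = c i mod int p" for i by (simp add: d_def minus_mult_div_eq_mod)
    have fin: "finite {i. d i \<noteq> 0}" by (rule finite_subset[OF _ c(1)]) (auto simp: d_def)
    have fin': "finite {i. int p * (c i div int p) \<noteq> 0}" "finite {i. c i div int p \<noteq> 0}"
      by (rule finite_subset[OF _ c(1)], auto)+
    have "lincomb a d = lincomb a c - zmul (int p) (lincomb a (\<lambda>i. c i div int p))"
      unfolding d_def by (simp only: lincomb_diff[OF c(1) fin'(1)] lincomb_zmul[OF fin'(2)])
    then have "lincomb a d - zmul (int p) (- lincomb a (\<lambda>i. c i div int p)) = lincomb a c" by simp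
    then have mem: "lincomb a d \<in> plus_multiples (W p) p"
      unfolding plus_multiples_def using c(3) by (intro CollectI exI) (erule ssubst)
    have "d i \<noteq> 0" using ndvd d[of i] by (simp add: dvd_eq_mod_eq_0)
    then have "d \<noteq> (\<lambda>_. 0)" by auto
    then obtain J where J: "d J \<noteq> 0" "lincomb a d = zmul (d J) (a J) + (\<Sum>i<J. zmul (d i) (a i))"
      using lincomb_Max[OF fin] by metis
    have "c J \<noteq> 0" using J(1) d[of J] by auto
    then have "p \<le> J" by (rule c(2))
    moreover have "restrict d {..<J} \<in> CF p J" unfolding CF_def restrict_PiE_iff using d p0 by simp
    moreover have "d J \<in> {1..<int p}"
    proof -
      have "0 \<le> d J" "d J < int p" using d[of J] p0 by simp_all
      then show ?thesis using J(1) by simp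
    qed
    ultimately have "zmul (d J) (a J) + (\<Sum>i<J. zmul (restrict d {..<J} i) (a i)) \<notin> plus_multiples (W p) p"
      using a[OF p] by blast
    then show False using J(2) mem by simp
  qed
  then show ?thesis using W(1) by (intro exI[of _ W] exI[of _ a] allI impI conjI) blast+
qed

text \<open>For a sequence independent modulo all bad primes, small linear combinations have coefficients divisible by any
  prescribed product \<open>k\<close> of bad primes. An element common to the coarser neighbourhoods is then \<open>k\<close> times an element
  of small norm, hence in the kernel, although the differences of the sequence do not become small.\<close>
lemma minimal_nbhds_no_bad_prime:
  assumes min: "minimal_nbhds N" and tf: "\<And>n x. n > 0 \<Longrightarrow> zmul n x \<in> \<Inter>N \<Longrightarrow> x \<in> \<Inter>N"
  shows "\<not> bad_prime N p\<^sub>0"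
proof
  assume p\<^sub>0: "bad_prime N p\<^sub>0"
  have N: "group_nbhds N" by (rule minimal_nbhdsD(1)[OF min])
  have "\<forall>p. \<exists>U. bad_prime N p \<longrightarrow> U \<in> N \<and> \<not> big (plus_multiples U p)" unfolding bad_prime_def by blast
  then obtain U0 where U0: "\<And>p. bad_prime N p \<Longrightarrow> U0 p \<in> N" "\<And>p. bad_prime N p \<Longrightarrow> \<not> big (plus_multiples (U0 p) p)" by metis
  have "\<exists>W a. \<forall>p. bad_prime N p \<longrightarrow> W p \<in> N \<and>
    (\<forall>c. finite {i. c i \<noteq> 0} \<longrightarrow> (\<forall>i. c i \<noteq> 0 \<longrightarrow> p \<le> i) \<longrightarrow> lincomb a c \<in> W p \<longrightarrow> (\<forall>i. int p dvd c i))"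
    by (rule not_big_imp_sequence[OF N U0])
  then obtain W a where Wa: "\<forall>p. bad_prime N p \<longrightarrow> W p \<in> N \<and>
    (\<forall>c. finite {i. c i \<noteq> 0} \<longrightarrow> (\<forall>i. c i \<noteq> 0 \<longrightarrow> p \<le> i) \<longrightarrow> lincomb a c \<in> W p \<longrightarrow> (\<forall>i. int p dvd c i))"
    by (elim exE)
  have W: "\<And>p. bad_prime N p \<Longrightarrow> W p \<in> N" using Wa by simp
  have dvd: "int p dvd c i" if "bad_prime N p" "finite {i. c i \<noteq> 0}" "\<And>i. c i \<noteq> 0 \<Longrightarrow> p \<le> i" "lincomb a c \<in> W p" for p c i
    using Wa that by simp
  have dvd_smooth: "\<exists>V\<in>N. \<exists>n. \<forall>c. finite {i. c i \<noteq> 0} \<longrightarrow> (\<forall>i. c i \<noteq> 0 \<longrightarrow> n \<le> i) \<longrightarrow> lincomb a c \<in> V \<longrightarrow> (\<forall>i. int k dvd c i)"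
    (is "?P k") if k: "k > 0" "\<And>p. prime p \<Longrightarrow> p dvd k \<Longrightarrow> bad_prime N p" for k
  proof (rule prime_factor_induct[where Q = "bad_prime N" and P = ?P, OF k])
    show "?P 1" using W[OF p\<^sub>0] by auto
  next
    fix p k :: nat assume p: "prime p" "bad_prime N p" and k: "k > 0" and "?P k"
    then obtain V n where V: "V \<in> N" and n: "\<And>c i. finite {i. c i \<noteq> 0} \<Longrightarrow> (\<And>i. c i \<noteq> 0 \<Longrightarrow> n \<le> i) \<Longrightarrow> lincomb a c \<in> V \<Longrightarrow> int k dvd c i"
      by meson
    obtain V1 where V1: "V1 \<in> N" "\<And>x. zmul (int k) x \<in> V1 \<Longrightarrow> x \<in> W p"
    proof (rule minimal_nbhds_zmul[OF min _ W[OF p(2)], of "int k"])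
      show "x \<in> \<Inter>N" if "zmul (int k) x \<in> \<Inter>N" for x using tf[of "int k" x] k that by simp
    qed (rule that)
    obtain V2 where V2: "V2 \<in> N" "V2 \<subseteq> V" "V2 \<subseteq> V1" using nbhds_Int[OF N V V1(1)] .
    have "int (p * k) dvd c i" if c: "finite {i. c i \<noteq> 0}" "\<And>i. c i \<noteq> 0 \<Longrightarrow> max n p \<le> i" "lincomb a c \<in> V2" for c i
    proof -
      have "int k dvd c i" for i using c V2(2) by (intro n) auto
      then obtain d where d: "\<And>i. c i = int k * d i" unfolding dvd_def by metis
      have fin: "finite {i. d i \<noteq> 0}" using c(1) k by (simp add: d)
      have "lincomb a c = zmul (int k) (lincomb a d)" using lincomb_zmul[OF fin, of a "int k"] d by presburger
      then have "lincomb a d \<in> W p" using c(3) V2(3) V1(2) by auto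
      moreover have "p \<le> i" if "d i \<noteq> 0" for i using c(2)[of i] that k by (simp add: d)
      ultimately have "int p dvd d i" by (intro dvd[OF p(2) fin])
      then show ?thesis by (simp add: d mult.commute mult_dvd_mono)
    qed
    then show "?P (p * k)" using V2(1) by blast
  qed
  obtain F :: "nat filter" where F: "F \<le> sequentially" "F \<noteq> bot" "\<And>P. eventually P F \<or> eventually (\<lambda>x. \<not> P x) F"
    using ex_ultrafilter_le[of sequentially] by auto
  have small: "\<exists>T. eventually (\<lambda>i. i \<in> T) F \<and> (\<forall>i\<in>T. \<forall>j\<in>T. \<rho> (a i - a j) \<le> e)" if \<rho>: "precompact_norm \<rho>" and e: "e > 0" for \<rho> e
  proof -
    have "e / 2 > 0" using e by simp
    then obtain G where G: "finite G" "\<And>x. \<exists>g\<in>G. \<rho> (x - g) < e / 2" using \<rho> unfolding precompact_norm_def by meson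
    have "\<exists>g\<in>G. eventually (\<lambda>i. \<rho> (a i - g) < e / 2) F"
    proof (rule ccontr)
      assume "\<not> ?thesis"
      then have "\<forall>g\<in>G. eventually (\<lambda>i. \<not> \<rho> (a i - g) < e / 2) F" using F(3) by blast
      then have "eventually (\<lambda>i. \<forall>g\<in>G. \<not> \<rho> (a i - g) < e / 2) F" using G(1) by (simp add: eventually_ball_finite)
      then have "eventually (\<lambda>i. False) F" by (rule eventually_mono) (use G(2) in blast)
      then show False using F(2) by (simp add: trivial_limit_def)
    qed
    then obtain g where g: "eventually (\<lambda>i. \<rho> (a i - g) < e / 2) F" by blast
    have "\<rho> (a i - a j) \<le> e" if "\<rho> (a i - g) < e / 2" "\<rho> (a j - g) < e / 2" for i j
    proof -
      have "\<rho> ((a i - g) + - (a j - g)) \<le> \<rho> (a i - g) + \<rho> (- (a j - g))" "\<rho> (- (a j - g)) = \<rho> (a j - g)"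
        using \<rho> unfolding precompact_norm_def by blast+
      then show ?thesis using that by simp
    qed
    then show ?thesis using g by (intro exI[of _ "{i. \<rho> (a i - g) < e / 2}"]) auto
  qed
  have "\<exists>T. eventually (\<lambda>i. i \<in> T) F \<and> (\<forall>i\<in>T. \<forall>j\<in>T. a i - a j \<in> W p\<^sub>0)"
  proof (rule minimal_nbhds_sequence[OF min W[OF p\<^sub>0]], rule ccontr)
    fix g assume g: "g \<notin> \<Inter>N" and no: "\<not> (\<exists>U\<in>N. \<exists>S. (\<forall>r. eventually (\<lambda>i. i \<in> S r) F) \<and> (\<forall>u\<in>U. u + g \<notin> pair_sums a S))"
    then obtain U where U: "U \<in> N" "g \<notin> U" by blast
    obtain U1 where U1: "U1 \<in> N" "\<And>x y. x \<in> U1 \<Longrightarrow> y \<in> U1 \<Longrightarrow> x - y \<in> U" using nbhds_add[OF N U(1)] by metis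
    obtain U2 where U2: "U2 \<in> N" "\<And>x. x \<in> U2 \<Longrightarrow> zmul (int p\<^sub>0) x \<in> U1"
      using nbhds_zmul[OF N U1(1), where k = "int p\<^sub>0"] by metis
    obtain U3 where U3: "U3 \<in> N" "\<And>x y z w. x \<in> U3 \<Longrightarrow> y \<in> U3 \<Longrightarrow> z \<in> U3 \<Longrightarrow> w \<in> U3 \<Longrightarrow> x + y + (z + w) \<in> U2"
      using nbhds_add4[OF N U2(1)] by metis
    obtain k' where k': "k' > 0" "big {y. zmul (int k') y \<in> U3}" "\<And>p. prime p \<Longrightarrow> p dvd k' \<Longrightarrow> bad_prime N p"
      using minimal_nbhds_smooth_multiples_big[OF min U3(1)] by blast
    obtain \<rho> where \<rho>: "precompact_norm \<rho>"
      "\<And>x. \<rho> x < 1 \<Longrightarrow> \<exists>p\<in>{y. zmul (int k') y \<in> U3}. \<exists>q\<in>{y. zmul (int k') y \<in> U3}. \<exists>r\<in>{y. zmul (int k') y \<in> U3}.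
         \<exists>s\<in>{y. zmul (int k') y \<in> U3}. x = (p - q) + (r - s)"
      using ex_precompact_norm_of_big[OF k'(2)] by blast
    define k where "k = p\<^sub>0 * k'"
    have p\<^sub>0': "prime p\<^sub>0" using p\<^sub>0 by (simp add: bad_prime_def)
    have k2: "k \<ge> 2" using k'(1) prime_ge_2_nat[OF p\<^sub>0'] unfolding k_def
      by (metis One_nat_def Suc_leI mult.right_neutral mult_le_mono)
    have \<rho>k: "zmul (int k) x \<in> U1" if x: "\<rho> x < 1" for x
    proof -
      obtain p q r s where h: "zmul (int k') p \<in> U3" "zmul (int k') q \<in> U3" "zmul (int k') r \<in> U3" "zmul (int k') s \<in> U3"
        "x = (p - q) + (r - s)" using \<rho>(2)[OF x] by blast
      have "zmul (int k') p + - zmul (int k') q + (zmul (int k') r + - zmul (int k') s) \<in> U2"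
        by (intro U3(2) nbhds_uminus[OF N U3(1)] h)
      also have "zmul (int k') p + - zmul (int k') q + (zmul (int k') r + - zmul (int k') s) = zmul (int k') x"
        unfolding h(5) by (simp add: zmul_add_right zmul.scale_right_diff_distrib)
      finally have "zmul (int p\<^sub>0) (zmul (int k') x) \<in> U1" by (rule U2(2))
      then show ?thesis by (simp add: k_def)
    qed
    have smooth: "bad_prime N p" if "prime p" "p dvd k" for p
      using that p\<^sub>0 p\<^sub>0' k'(3) unfolding k_def by (metis prime_dvd_mult_iff primes_dvd_imp_eq)
    have "\<exists>V\<in>N. \<exists>n. \<forall>c. finite {i. c i \<noteq> 0} \<longrightarrow> (\<forall>i. c i \<noteq> 0 \<longrightarrow> n \<le> i) \<longrightarrow> lincomb a c \<in> V \<longrightarrow> (\<forall>i. int k dvd c i)"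
      by (rule dvd_smooth[OF _ smooth]) (use k2 in auto)
    then obtain V n where V: "V \<in> N" and n': "\<forall>c. finite {i. c i \<noteq> 0} \<longrightarrow> (\<forall>i. c i \<noteq> 0 \<longrightarrow> n \<le> i) \<longrightarrow> lincomb a c \<in> V \<longrightarrow> (\<forall>i. int k dvd c i)"
      by (elim bexE exE)
    have n: "int k dvd c i" if "finite {i. c i \<noteq> 0}" "\<And>i. c i \<noteq> 0 \<Longrightarrow> n \<le> i" "lincomb a c \<in> V" for c i
      using n' that by simp
    obtain V2 where V2: "V2 \<in> N" "\<And>x y. x \<in> V2 \<Longrightarrow> y \<in> V2 \<Longrightarrow> x - y \<in> V" using nbhds_add[OF N V] by metis
    obtain V3 where V3: "V3 \<in> N" "V3 \<subseteq> V2" "V3 \<subseteq> U1" using nbhds_Int[OF N V2(1) U1(1)] .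
    define e :: "nat \<Rightarrow> real" where "e r = (1 / 2) ^ (r + 2)" for r
    have "\<exists>T. eventually (\<lambda>i. i \<in> T) F \<and> (\<forall>i\<in>T. \<forall>j\<in>T. \<rho> (a i - a j) \<le> e r)" for r
      by (rule small[OF \<rho>(1)]) (simp add: e_def)
    then obtain T where T: "\<And>r. eventually (\<lambda>i. i \<in> T r) F" "\<And>r i j. i \<in> T r \<Longrightarrow> j \<in> T r \<Longrightarrow> \<rho> (a i - a j) \<le> e r"
      by metis
    define S where "S n' r = {i. (\<forall>r'\<in>{..r}. i \<in> T r') \<and> n \<le> i \<and> n' \<le> i}" for n' r
    have ge: "eventually (\<lambda>i. l \<le> i) F" for l
      using F(1) eventually_ge_at_top[of l] unfolding le_filter_def by blast
    have SF: "eventually (\<lambda>i. i \<in> S n' r) F" for n' r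
    proof -
      have "eventually (\<lambda>i. \<forall>r'\<in>{..r}. i \<in> T r') F" by (rule eventually_ball_finite) (simp_all add: T(1))
      then show ?thesis unfolding S_def mem_Collect_eq by (intro eventually_conj ge)
    qed
    have S_anti: "S n' r' \<subseteq> S n' r" if "r \<le> r'" for n' r r' using that by (auto simp: S_def)
    have mem: "\<exists>u\<in>V3. u + g \<in> pair_sums a (S n')" for n' using no V3(1) SF by blast
    obtain u where u: "u \<in> V3" "u + g \<in> pair_sums a (S 0)" using mem by blast
    obtain c where c: "finite {i. c i \<noteq> 0}" "u + g = lincomb a c" "(\<Sum>i | c i \<noteq> 0. c i) = 0"
      "\<And>i. c i \<noteq> 0 \<Longrightarrow> i \<in> S 0 0" "\<And>r. (\<Sum>i | c i \<noteq> 0 \<and> i \<notin> S 0 r. \<bar>c i\<bar>) \<le> 2 * int r"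
      by (rule pair_sums_lincomb[OF u(2) S_anti], assumption, rule that)
    obtain n' where n': "\<And>i. c i \<noteq> 0 \<Longrightarrow> i < n'" using c(1) unfolding finite_nat_iff_bounded by blast
    obtain u' where u': "u' \<in> V3" "u' + g \<in> pair_sums a (S n')" using mem by blast
    obtain c' where c': "finite {i. c' i \<noteq> 0}" "u' + g = lincomb a c'" "(\<Sum>i | c' i \<noteq> 0. c' i) = 0"
      "\<And>i. c' i \<noteq> 0 \<Longrightarrow> i \<in> S n' 0" "\<And>r. (\<Sum>i | c' i \<noteq> 0 \<and> i \<notin> S n' r. \<bar>c' i\<bar>) \<le> 2 * int r"
      by (rule pair_sums_lincomb[OF u'(2) S_anti], assumption, rule that)
    have "int k dvd c i - c' i" for i
    proof (rule n)
      show "finite {i. c i - c' i \<noteq> 0}"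
        by (rule finite_subset[of _ "{i. c i \<noteq> 0} \<union> {i. c' i \<noteq> 0}"]) (use c(1) c'(1) in auto)
      show "n \<le> i" if "c i - c' i \<noteq> 0" for i
        using that c(4)[of i] c'(4)[of i] by (cases "c i = 0") (auto simp: S_def)
      have "lincomb a c - lincomb a c' = u - u'" by (simp flip: c(2) c'(2))
      also have "\<dots> \<in> V" using V2(2) V3(2) u u' by blast
      finally show "lincomb a (\<lambda>i. c i - c' i) \<in> V" using c(1) c'(1) by (simp add: lincomb_diff)
    qed
    moreover have "c' i = 0" if "c i \<noteq> 0" for i
      using n'[OF that] c'(4)[of i] by (force simp: S_def)
    ultimately have "int k dvd c i" for i by (metis diff_zero dvd_0_right)
    then obtain d where d: "\<And>i. c i = int k * d i" unfolding dvd_def by metis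
    have k0: "int k \<noteq> 0" using k2 by simp
    have supp: "{i. c i \<noteq> 0} = {i. d i \<noteq> 0}" using k0 by (auto simp: d)
    let ?B = "{i. d i \<noteq> 0}"
    have finB: "finite ?B" using c(1) supp by simp
    have "\<rho> (\<Sum>i\<in>?B. zmul (d i) (a i)) \<le> (\<Sum>t<nat (\<Sum>i\<in>?B. max (d i) 0). e t)"
    proof (rule norm_pairing_bound[OF \<rho>(1) finB, of "S 0"])
      show "\<rho> (a i - a j) \<le> e r" if "i \<in> S 0 r" "j \<in> S 0 r" for r i j using that T(2) by (auto simp: S_def)
      have "int k * (\<Sum>i\<in>?B. d i) = 0" using c(3) unfolding supp by (simp add: d sum_distrib_left)
      then show "(\<Sum>i\<in>?B. d i) = 0" using k0 by simp
      show "(\<Sum>i\<in>?B. max (d i) 0) = int (nat (\<Sum>i\<in>?B. max (d i) 0))" by (simp add: sum_nonneg)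
      show "(\<Sum>i\<in>?B - S 0 r. \<bar>d i\<bar>) \<le> int r" for r
      proof -
        have "2 * (\<Sum>i\<in>?B - S 0 r. \<bar>d i\<bar>) \<le> int k * (\<Sum>i\<in>?B - S 0 r. \<bar>d i\<bar>)"
          using k2 by (intro mult_right_mono sum_nonneg) auto
        also have "\<dots> = (\<Sum>i | c i \<noteq> 0 \<and> i \<notin> S 0 r. \<bar>c i\<bar>)"
        proof -
          have "{i. c i \<noteq> 0 \<and> i \<notin> S 0 r} = ?B - S 0 r" using supp by blast
          then show ?thesis by (simp add: d sum_distrib_left abs_mult)
        qed
        also have "\<dots> \<le> 2 * int r" by (rule c(5))
        finally show ?thesis by simp
      qed
    qed
    also have "\<dots> < 1"
    proof -
      have "(\<Sum>t<l. e t) = 1 / 2 - (1 / 2) ^ (l + 1)" for l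
        by (induction l) (simp_all add: e_def field_simps)
      then show ?thesis by (smt (verit) zero_less_power field_sum_of_halves)
    qed
    finally have "zmul (int k) (lincomb a d) \<in> U1" unfolding lincomb_def by (rule \<rho>k)
    then have "u + g \<in> U1" using c(2) lincomb_zmul[OF finB, of a "int k"] d by (metis ext)
    then have "(u + g) - u \<in> U" using u V3(3) by (intro U1(2)) auto
    then show False using U(2) by simp
  qed
  then obtain T where T: "eventually (\<lambda>i. i \<in> T) F" "\<And>i j. i \<in> T \<Longrightarrow> j \<in> T \<Longrightarrow> a i - a j \<in> W p\<^sub>0" by blast
  have ex: "\<exists>i\<ge>l. i \<in> T" for l
  proof -
    have "eventually (\<lambda>i. l \<le> i) F" using F(1) eventually_ge_at_top[of l] unfolding le_filter_def by blast
    then have "eventually (\<lambda>i. l \<le> i \<and> i \<in> T) F" using T(1) by (rule eventually_conj)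
    then show ?thesis using F(2) eventually_happens' by blast
  qed
  obtain i where i: "i \<ge> p\<^sub>0" "i \<in> T" using ex by blast
  obtain j where j: "j \<ge> i + 1" "j \<in> T" using ex by blast
  define c :: "nat \<Rightarrow> int" where "c l = (if l = i then 1 else if l = j then - 1 else 0)" for l
  have "lincomb a c = (\<Sum>l\<in>{i, j}. zmul (c l) (a l))" by (rule lincomb_eq) (auto simp: c_def)
  then have "lincomb a c = a i - a j" using j by (simp add: c_def zmul_one zmul_minus_left)
  then have mem: "lincomb a c \<in> W p\<^sub>0" using T(2) i j by simp
  have fin: "finite {i. c i \<noteq> 0}" by (rule finite_subset[of _ "{i, j}"]) (auto simp: c_def)
  have "int p\<^sub>0 dvd c i" by (rule dvd[OF p\<^sub>0 fin _ mem]) (use i j in \<open>auto simp: c_def split: if_splits\<close>)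
  then show False using p\<^sub>0 by (auto simp: c_def bad_prime_def)
qed

theorem minimal_nbhds_precompact:
  assumes min: "minimal_nbhds N" and tf: "\<And>n x. n > 0 \<Longrightarrow> zmul n x \<in> \<Inter>N \<Longrightarrow> x \<in> \<Inter>N" and U: "U \<in> N"
  shows "big U"
proof -
  obtain k where k: "k > 0" "big {y. zmul (int k) y \<in> U}" "\<And>p. prime p \<Longrightarrow> p dvd k \<Longrightarrow> bad_prime N p"
    using minimal_nbhds_smooth_multiples_big[OF min U] by blast
  have "\<not> bad_prime N p" for p by (rule minimal_nbhds_no_bad_prime[OF min tf])
  then have "k = 1" using k(3) prime_factor_nat by blast
  then show ?thesis using k(2) by (simp add: zmul_one)
qed

section \<open>Convolution on precompact groups\<close>

locale precompact_nbhds =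
  fixes N :: "'a::ab_group_add set set" and m :: "('a \<Rightarrow> real) \<Rightarrow> real"
  assumes N: "group_nbhds N" and big: "U \<in> N \<Longrightarrow> big U" and m: "invariant_mean m"
begin

lemmas mean_m = invariant_meanD(1)[OF m]
lemmas m_shift = invariant_meanD(2)[OF m]
lemmas m_neg = invariant_meanD(3)[OF m]

definition uc :: "('a \<Rightarrow> real) \<Rightarrow> bool" where
  "uc f \<longleftrightarrow> bdd f \<and> (\<forall>e>0. \<exists>U\<in>N. \<forall>x. \<forall>u\<in>U. \<bar>f (x + u) - f x\<bar> \<le> e)"

lemma uc_bdd: "uc f \<Longrightarrow> bdd f"
  by (simp add: uc_def)

lemma ucE:
  assumes "uc f" "e > 0" obtains U where "U \<in> N" "\<And>x u. u \<in> U \<Longrightarrow> \<bar>f (x + u) - f x\<bar> \<le> e"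
  using assms unfolding uc_def by blast

lemma m_reflect: "bdd f \<Longrightarrow> m (\<lambda>y. f (x - y)) = m f"
  using m_neg[of "\<lambda>y. f (x + y)"] m_shift[of f x] bdd_comp[of f "\<lambda>y. x + y"] by (simp add: add.commute)

lemma mean_swap:
  assumes A: "bdd A" and B: "bdd B" and c: "uc c"
  shows "m (\<lambda>x. m (\<lambda>y. A x * B y * c (x - y))) = m (\<lambda>y. m (\<lambda>x. A x * B y * c (x - y)))"
proof -
  let ?M = "\<lambda>F. m (\<lambda>x. m (\<lambda>y. F (x, y)))" and ?M' = "\<lambda>F. m (\<lambda>y. m (\<lambda>x. F (x, y)))"
  have M: "mean ?M" by (rule mean_iterated[OF mean_m mean_m])
  have M': "mean ?M'"
  proof -
    have M: "mean (\<lambda>F. m (\<lambda>x. m (\<lambda>y. F (x, y))))" by (rule mean_iterated[OF mean_m mean_m])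
    have b: "bdd (\<lambda>p. F (prod.swap p))" if "bdd F" for F :: "'a \<times> 'a \<Rightarrow> real" using that by (rule bdd_comp)
    show ?thesis
      unfolding mean_def
    proof (intro conjI allI impI)
      show "?M' (\<lambda>p. F p + G p) = ?M' F + ?M' G" if "bdd F" "bdd G" for F G
        using mean_add[OF M b[OF that(1)] b[OF that(2)]] by simp
      show "?M' (\<lambda>p. k * F p) = k * ?M' F" if "bdd F" for F k
        using mean_cmult[OF M b[OF that]] by simp
      show "0 \<le> ?M' F" if "bdd F" "\<forall>p. 0 \<le> F p" for F
        using mean_nonneg[OF M b[OF that(1)]] that(2) by simp
    qed (simp add: mean_one[OF mean_m])
  qed
  define F where "F = (\<lambda>(x, y). A x * B y * c (x - y))"
  obtain a where a: "a > 0" "\<And>x. \<bar>A x\<bar> \<le> a" using bddE[OF A] by blast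
  obtain b where b: "b > 0" "\<And>x. \<bar>B x\<bar> \<le> b" using bddE[OF B] by blast
  have bF: "bdd F"
    unfolding F_def case_prod_beta
    by (intro bdd_mult bdd_comp[OF A] bdd_comp[OF B] bdd_comp[OF uc_bdd[OF c]])
  have "\<bar>?M F - ?M' F\<bar> \<le> 2 * e" if e: "e > 0" for e
  proof -
    have e': "e / (a * b) > 0" using e a b by simp
    obtain U where U: "U \<in> N" "\<And>x u. u \<in> U \<Longrightarrow> \<bar>c (x + u) - c x\<bar> \<le> e / (a * b)"
      using ucE[OF c e'] by blast
    obtain R where R: "finite R" "\<And>x. \<exists>g\<in>R. x - g \<in> U" using big[OF U(1)] by (rule bigE) (rule that)
    then obtain g where g: "\<And>x. g x \<in> R" "\<And>x. x - g x \<in> U" by metis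
    define G where "G = (\<lambda>(x, y). \<Sum>r\<in>R. (A x * of_bool (g x = r)) * (B y * c (r - y)))"
    have G: "G (x, y) = A x * B y * c (g x - y)" for x y
    proof -
      have "G (x, y) = (\<Sum>r\<in>R. if g x = r then A x * B y * c (r - y) else 0)"
        unfolding G_def by (auto intro!: sum.cong)
      then show ?thesis using R(1) g(1) by simp
    qed
    have b1: "bdd (\<lambda>x. A x * of_bool (g x = r))" for r
      by (intro bdd_mult A bddI[of _ 1]) simp
    have b2: "bdd (\<lambda>y. B y * c (r - y))" for r
      by (intro bdd_mult B bdd_comp[OF uc_bdd[OF c]])
    have bG: "bdd G"
      unfolding G_def case_prod_beta by (intro bdd_sum bdd_mult bdd_comp[OF b1] bdd_comp[OF b2])
    have FG: "\<bar>F p - G p\<bar> \<le> e" for p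
    proof -
      obtain x y where p: "p = (x, y)" by fastforce
      have "\<bar>c (x - y) - c (g x - y)\<bar> \<le> e / (a * b)"
        using U(2)[OF g(2)[of x], of "g x - y"] by (simp add: algebra_simps)
      then have "\<bar>A x * B y\<bar> * \<bar>c (x - y) - c (g x - y)\<bar> \<le> (a * b) * (e / (a * b))"
        using a b by (intro mult_mono) (auto simp: abs_mult intro: mult_mono)
      then show ?thesis using a b by (simp add: p F_def G right_diff_distrib[symmetric] abs_mult)
    qed
    have "?M G = (\<Sum>r\<in>R. m (\<lambda>x. A x * of_bool (g x = r)) * m (\<lambda>y. B y * c (r - y)))"
      unfolding G_def case_prod_conv
      by (subst mean_sum[OF mean_m], (intro bdd_cmult b2), simp only: mean_cmult[OF mean_m b2], subst mean_sum[OF mean_m])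
        (simp_all add: mean_multc[OF mean_m b1] bdd_mult b1)
    moreover have "?M' G = (\<Sum>r\<in>R. m (\<lambda>x. A x * of_bool (g x = r)) * m (\<lambda>y. B y * c (r - y)))"
      unfolding G_def case_prod_conv
      by (subst mean_sum[OF mean_m], (intro bdd_mult b1 bdd_const), simp only: mean_multc[OF mean_m b1], subst mean_sum[OF mean_m])
        (simp_all only: mean_cmult[OF mean_m b2] bdd_cmult b2)
    ultimately have "?M G = ?M' G" by simp
    moreover have "\<bar>?M F - ?M G\<bar> \<le> e" by (rule mean_dist_le[OF M bF bG FG])
    moreover have "\<bar>?M' F - ?M' G\<bar> \<le> e" by (rule mean_dist_le[OF M' bF bG FG])
    ultimately show ?thesis by linarith
  qed
  note * = this
  define D where "D = \<bar>?M F - ?M' F\<bar>"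
  have D: "D \<le> 2 * e" if "e > 0" for e unfolding D_def by (rule *[OF that])
  have "D = 0"
    using D[of "D / 4"] by (cases "D > 0") (simp_all add: D_def)
  then have "?M F = ?M' F" by (simp add: D_def)
  then show ?thesis by (simp add: F_def)
qed

definition conv :: "('a \<Rightarrow> real) \<Rightarrow> ('a \<Rightarrow> real) \<Rightarrow> 'a \<Rightarrow> real" where
  "conv a b x = m (\<lambda>y. a (x - y) * b y)"

lemma bdd_conv_arg: "bdd a \<Longrightarrow> bdd b \<Longrightarrow> bdd (\<lambda>y. a (x - y) * b y)"
  by (rule bdd_mult[OF bdd_comp[of a "\<lambda>y. x - y"]])

lemma conv_assoc:
  assumes a: "uc a" and b: "uc b" and c: "uc c"
  shows "conv (conv a b) c x = conv a (conv b c) x"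
proof -
  have ba: "bdd a" and bb: "bdd b" and bc: "bdd c" using assms by (auto dest: uc_bdd)
  have "conv (conv a b) c x = m (\<lambda>z. m (\<lambda>y. c z * a (x - y) * b (y - z)))"
  proof -
    have "conv a b (x - z) * c z = m (\<lambda>y. c z * a (x - y) * b (y - z))" for z
    proof -
      have "m (\<lambda>y. a (x - (y + z)) * b (y + z - z)) = m (\<lambda>y. a (x - y) * b (y - z))"
        by (rule m_shift) (intro bdd_mult bdd_comp[OF ba] bdd_comp[OF bb])
      then have "conv a b (x - z) = m (\<lambda>y. a (x - y) * b (y - z))"
        by (simp add: conv_def algebra_simps)
      moreover have "m (\<lambda>y. c z * (a (x - y) * b (y - z))) = c z * m (\<lambda>y. a (x - y) * b (y - z))"
        by (rule mean_cmult[OF mean_m]) (intro bdd_mult bdd_comp[OF ba] bdd_comp[OF bb])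
      ultimately show ?thesis by (simp only: mult.assoc mult.commute[of _ "c z"])
    qed
    then show ?thesis by (simp add: conv_def[of "conv a b"])
  qed
  also have "\<dots> = m (\<lambda>y. m (\<lambda>z. a (x - y) * c z * b (y - z)))"
    using mean_swap[OF bdd_comp[OF ba, of "\<lambda>y. x - y"] bc b] by (simp add: mult_ac)
  also have "\<dots> = conv a (conv b c) x"
  proof -
    have "m (\<lambda>z. a (x - y) * (b (y - z) * c z)) = a (x - y) * conv b c y" for y
      unfolding conv_def by (rule mean_cmult[OF mean_m]) (intro bdd_conv_arg bb bc)
    then show ?thesis by (simp add: conv_def[of a] mult_ac)
  qed
  finally show ?thesis .
qed

lemma conv_CS:
  assumes "bdd a" "bdd b"
  shows "(conv a b x)\<^sup>2 \<le> m (\<lambda>y. (a y)\<^sup>2) * m (\<lambda>y. (b y)\<^sup>2)"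
  using mean_CS[OF mean_m bdd_comp[OF assms(1), of "\<lambda>y. x - y"] assms(2)] m_reflect[OF bdd_power2[OF assms(1)], of x]
  by (simp add: conv_def)

lemma uc_conv:
  assumes a: "uc a" and b: "uc b"
  shows "uc (conv a b)"
proof -
  have ba: "bdd a" and bb: "bdd b" using assms by (auto dest: uc_bdd)
  obtain A where A: "A > 0" "\<And>x. \<bar>a x\<bar> \<le> A" using bddE[OF ba] by blast
  obtain B where B: "B > 0" "\<And>x. \<bar>b x\<bar> \<le> B" using bddE[OF bb] by blast
  show ?thesis
    unfolding uc_def
  proof (intro conjI allI impI)
    show "bdd (conv a b)"
    proof (rule bddI)
      show "\<bar>conv a b x\<bar> \<le> A * B" for x
        unfolding conv_def
        by (rule mean_abs_le[OF mean_m bdd_conv_arg[OF ba bb]]) (use A B in \<open>simp add: abs_mult mult_mono\<close>)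
    qed
    fix e :: real assume e: "e > 0"
    then have "e / B > 0" using B by simp
    then obtain U where U: "U \<in> N" "\<And>x u. u \<in> U \<Longrightarrow> \<bar>a (x + u) - a x\<bar> \<le> e / B" using ucE[OF a] by blast
    have "\<bar>conv a b (x + u) - conv a b x\<bar> \<le> e" if u: "u \<in> U" for x u
      unfolding conv_def
    proof (rule mean_dist_le[OF mean_m bdd_conv_arg[OF ba bb] bdd_conv_arg[OF ba bb]])
      fix y
      have "\<bar>a (x + u - y) - a (x - y)\<bar> \<le> e / B" using U(2)[OF u, of "x - y"] by (simp add: algebra_simps)
      then have "\<bar>a (x + u - y) - a (x - y)\<bar> * \<bar>b y\<bar> \<le> (e / B) * B"
        using B e by (intro mult_mono) auto
      then show "\<bar>a (x + u - y) * b y - a (x - y) * b y\<bar> \<le> e"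
        using B by (simp add: left_diff_distrib[symmetric] abs_mult)
    qed
    then show "\<exists>U\<in>N. \<forall>x. \<forall>u\<in>U. \<bar>conv a b (x + u) - conv a b x\<bar> \<le> e" using U(1) by blast
  qed
qed

lemma m_conv:
  assumes "uc a" "uc b" shows "m (conv a b) = m a * m b"
proof -
  have ba: "bdd a" and bb: "bdd b" using assms by (auto dest: uc_bdd)
  have "m (conv a b) = m (\<lambda>y. m (\<lambda>x. b y * a (x - y)))"
    using mean_swap[OF bdd_const[of 1] bb assms(1)] by (simp add: conv_def[abs_def] mult_ac)
  also have "\<dots> = m (\<lambda>y. b y * m a)"
  proof -
    have "m (\<lambda>x. b y * a (x - y)) = b y * m a" for y
      using mean_cmult[OF mean_m bdd_comp[OF ba, of "\<lambda>x. x - y"]] m_shift[OF ba, of "- y"] by simp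
    then show ?thesis by simp
  qed
  finally show ?thesis by (simp add: mean_multc[OF mean_m bb] mult.commute)
qed

lemma mean_square_pos:
  assumes a: "uc a" and x: "a x \<noteq> 0"
  shows "0 < m (\<lambda>y. (a y)\<^sup>2)"
proof -
  have ba: "bdd a" using a by (rule uc_bdd)
  define c where "c = \<bar>a x\<bar> / 2"
  have c: "c > 0" using x by (simp add: c_def)
  obtain U where U: "U \<in> N" "\<And>x u. u \<in> U \<Longrightarrow> \<bar>a (x + u) - a x\<bar> \<le> c" using ucE[OF a c] by blast
  obtain F where F: "finite F" "\<And>x. \<exists>g\<in>F. x - g \<in> U" using big[OF U(1)] by (rule bigE) (rule that)
  have le: "c\<^sup>2 \<le> (\<Sum>g\<in>F. (a (y + (x - g)))\<^sup>2)" for y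
  proof -
    obtain g where g: "g \<in> F" "y - g \<in> U" using F by blast
    have "x + (y - g) = y + (x - g)" by (simp add: algebra_simps)
    then have "\<bar>a (y + (x - g)) - a x\<bar> \<le> c" using U(2)[OF g(2), of x] by metis
    then have "c \<le> \<bar>a (y + (x - g))\<bar>" unfolding c_def by linarith
    then have "c\<^sup>2 \<le> \<bar>a (y + (x - g))\<bar>\<^sup>2" using c by (intro power_mono) auto
    also have "\<dots> \<le> (\<Sum>g\<in>F. (a (y + (x - g)))\<^sup>2)"
      unfolding power2_abs using g(1) F(1) by (intro member_le_sum) auto
    finally show ?thesis .
  qed
  have b2: "bdd (\<lambda>y. (a (y + z))\<^sup>2)" for z by (intro bdd_power2 bdd_comp[OF ba])
  have "c\<^sup>2 = m (\<lambda>_. c\<^sup>2)" by (simp add: mean_const[OF mean_m])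
  also have "\<dots> \<le> m (\<lambda>y. \<Sum>g\<in>F. (a (y + (x - g)))\<^sup>2)"
    by (intro mean_mono[OF mean_m] bdd_const bdd_sum b2 le)
  also have "\<dots> = (\<Sum>g\<in>F. m (\<lambda>y. (a (y + (x - g)))\<^sup>2))" by (rule mean_sum[OF mean_m b2])
  also have "\<dots> = card F * m (\<lambda>y. (a y)\<^sup>2)"
    using m_shift[OF bdd_power2[OF ba]] by simp
  finally have le': "c\<^sup>2 \<le> card F * m (\<lambda>y. (a y)\<^sup>2)" .
  show ?thesis
  proof (rule ccontr)
    assume "\<not> ?thesis"
    then have "card F * m (\<lambda>y. (a y)\<^sup>2) \<le> 0" by (simp add: mult_nonneg_nonpos)
    then have "c\<^sup>2 \<le> 0" using le' by linarith
    then show False using c by simp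
  qed
qed

end

context precompact_nbhds
begin

text \<open>Power iteration: the normalised convolution powers of \<open>f\<close> converge to the spectral projection for the
  largest eigenvalue of the convolution operator of \<open>f * f\<close>.\<close>
lemma ex_convolution_idempotent:
  assumes C: "\<And>x y. x \<in> C \<Longrightarrow> y \<in> C \<Longrightarrow> x + y \<in> C"
    and f: "uc f" "\<And>x. f (- x) = f x" "\<And>x. x \<notin> C \<Longrightarrow> f x = 0" "m f = 0" "f x\<^sub>0 \<noteq> 0"
  shows "\<exists>P. uc P \<and> (\<forall>x. P (- x) = P x) \<and> (\<forall>x. x \<notin> C \<longrightarrow> P x = 0) \<and> m P = 0 \<and> P 0 > 0 \<and>
    (\<forall>x. conv P P x = P x) \<and> (\<forall>h. (\<forall>x. f (x + h) = f x) \<longrightarrow> (\<forall>x. P (x + h) = P x))"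
proof -
  define K where "K a \<longleftrightarrow> uc a \<and> (\<forall>x. a (- x) = a x) \<and> (\<forall>x. x \<notin> C \<longrightarrow> a x = 0) \<and> m a = 0 \<and>
    (\<forall>h. (\<forall>x. f (x + h) = f x) \<longrightarrow> (\<forall>x. a (x + h) = a x))" for a
  have Kuc: "K a \<Longrightarrow> uc a" for a by (simp add: K_def)
  have Kb: "K a \<Longrightarrow> bdd a" for a by (simp add: K_def uc_bdd)
  have Keven: "K a \<Longrightarrow> a (- x) = a x" for a x by (simp add: K_def)
  have Kconv: "K (conv a b)" if a: "K a" and b: "K b" for a b
    unfolding K_def
  proof (intro conjI allI impI)
    show "uc (conv a b)" using a b by (intro uc_conv Kuc)
    show "conv a b (- x) = conv a b x" for x
    proof -
      have "conv a b (- x) = m (\<lambda>y. a (x - (- y)) * b (- y))"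
      proof -
        have "a (- x - y) = a (x - (- y))" for y using Keven[OF a, of "x + y"] by simp
        then show ?thesis using Keven[OF b] by (simp add: conv_def)
      qed
      also have "\<dots> = conv a b x"
        unfolding conv_def by (rule m_neg[OF bdd_conv_arg[OF Kb[OF a] Kb[OF b]]])
      finally show ?thesis .
    qed
    show "conv a b x = 0" if x: "x \<notin> C" for x
    proof -
      have "a (x - y) * b y = 0" for y
        using C[of "x - y" y] x a b unfolding K_def by (metis diff_add_cancel mult_eq_0_iff)
      then show ?thesis by (simp only: conv_def mean_const[OF mean_m])
    qed
    show "m (conv a b) = 0" using a b by (simp add: m_conv K_def)
    fix h x assume "\<forall>x. f (x + h) = f x"
    then have "a (x + h) = a x" for x using a unfolding K_def by blast
    from this[of "x - y" for y] show "conv a b (x + h) = conv a b x"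
      by (simp add: conv_def algebra_simps)
  qed
  define ip where "ip a b = m (\<lambda>x. a x * b x)" for a b
  have conv0: "conv a b 0 = ip a b" if "K a" for a b
    using Keven[OF that] by (simp add: conv_def ip_def)
  have CS: "\<bar>conv a b x\<bar> \<le> sqrt (ip a a) * sqrt (ip b b)" if "K a" "bdd b" for a b x
    using conv_CS[OF Kb[OF that(1)] that(2), of x]
    by (simp add: ip_def power2_eq_square[symmetric] real_sqrt_mult[symmetric] real_le_rsqrt)
  have ip_nonneg: "0 \<le> ip a a" if "bdd a" for a
    unfolding ip_def using that by (intro mean_nonneg[OF mean_m] bdd_mult) auto
  define p where "p = rec_nat f (\<lambda>_. conv f)"
  have p0: "p 0 = f" and pS: "p (Suc n) = conv f (p n)" for n by (simp_all add: p_def)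
  have Kf: "K f" using f by (simp add: K_def)
  have Kp: "K (p n)" for n by (induction n) (simp_all add: p0 pS Kf Kconv)
  have pp: "conv (p a) (p b) = p (Suc (a + b))" for a b
  proof (induction a)
    case (Suc a)
    have "conv (p (Suc a)) (p b) x = conv f (conv (p a) (p b)) x" for x
      unfolding pS by (intro conv_assoc Kuc Kf Kp)
    then show ?case by (auto simp: Suc pS[of "Suc (a + b)"])
  qed (simp add: p0 pS)
  define \<sigma> where "\<sigma> n = p (Suc (n + n)) 0" for n
  have ipp: "ip (p a) (p b) = p (Suc (a + b)) 0" for a b
    using conv0[OF Kp, of a "p b"] pp[of a b] by simp
  have \<sigma>_ip: "\<sigma> n = ip (p n) (p n)" for n by (simp add: ipp \<sigma>_def)
  define q where "q n = p (Suc (n + n))" for n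
  have Kq: "K (q n)" for n by (simp add: q_def Kp)
  have q0: "q n 0 = \<sigma> n" for n by (simp add: q_def \<sigma>_def)
  have q_le: "\<bar>q n x\<bar> \<le> \<sigma> n" for n x
    using CS[OF Kp Kb[OF Kp], of n n x] ip_nonneg[OF Kb[OF Kp], of n] by (simp add: pp q_def \<sigma>_ip)
  have qq: "conv (q a) (q b) = q (Suc (a + b))" for a b
    by (simp add: q_def pp add_ac)
  have \<sigma>_nonneg: "0 \<le> \<sigma> n" for n by (simp add: \<sigma>_ip ip_nonneg Kb Kp)
  have submult: "\<sigma> (Suc (a + b)) \<le> \<sigma> a * \<sigma> b" for a b
  proof -
    have "\<sigma> (Suc (a + b)) = ip (q a) (q b)" using conv0[OF Kq, of a "q b"] by (simp add: qq q0)
    moreover have "\<bar>ip (q a) (q b)\<bar> \<le> \<sigma> a * \<sigma> b"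
      unfolding ip_def
      by (rule mean_abs_le[OF mean_m bdd_mult[OF Kb[OF Kq] Kb[OF Kq]]]) (simp add: abs_mult mult_mono q_le \<sigma>_nonneg)
    ultimately show ?thesis by simp
  qed
  have logconvex: "(\<sigma> (Suc n))\<^sup>2 \<le> \<sigma> n * \<sigma> (Suc (Suc n))" for n
  proof -
    have "\<sigma> (Suc n) = ip (p n) (p (Suc (Suc n)))" by (simp add: ipp \<sigma>_def)
    then show ?thesis
      using mean_CS[OF mean_m Kb[OF Kp[of n]] Kb[OF Kp[of "Suc (Suc n)"]]]
      by (simp add: \<sigma>_ip ip_def power2_eq_square)
  qed
  have \<sigma>_pos: "\<sigma> n > 0" for n
  proof -
    have zero: "\<sigma> (j + i) = 0" if "\<sigma> j = 0" for i j
    proof (induction i)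
      case (Suc i)
      then show ?case using logconvex[of "j + i"] by simp
    qed (simp add: that)
    have "\<exists>j\<ge>n. \<sigma> j > 0"
    proof (induction n)
      case 0
      have "\<sigma> 0 > 0" using mean_square_pos[OF f(1,5)] by (simp add: \<sigma>_ip p0 ip_def power2_eq_square)
      then show ?case by blast
    next
      case (Suc n)
      then obtain j where j: "j \<ge> n" "\<sigma> j > 0" by blast
      then have "p (Suc (j + j)) 0 \<noteq> 0" by (simp add: \<sigma>_def)
      then have "\<sigma> (Suc (j + j)) > 0"
        using mean_square_pos[OF Kuc[OF Kp]] by (simp add: \<sigma>_ip ip_def power2_eq_square)
      then show ?case using j by (intro exI[of _ "Suc (j + j)"]) auto
    qed
    then obtain j where "j \<ge> n" "\<sigma> j > 0" by blast
    then have "\<sigma> n \<noteq> 0" using zero[of n "j - n"] by auto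
    then show ?thesis using \<sigma>_nonneg[of n] by simp
  qed
  define r where "r n = \<sigma> (Suc n) / \<sigma> n" for n
  have r_mono: "incseq r"
    by (rule incseq_SucI) (use logconvex \<sigma>_pos in \<open>simp add: r_def frac_le_eq divide_le_0_iff field_simps power2_eq_square\<close>)
  have r_le: "r n \<le> \<sigma> 0" for n
    using submult[of n 0] \<sigma>_pos[of n] by (simp add: r_def field_simps)
  obtain L where L: "r \<longlonglongrightarrow> L" "\<And>n. r n \<le> L"
    using incseq_convergent[OF r_mono, of "\<sigma> 0"] r_le by blast
  have L0: "L > 0" using L(2)[of 0] \<sigma>_pos[of 0] \<sigma>_pos[of 1] by (auto simp: r_def intro: less_le_trans[rotated])
  define s where "s n = \<sigma> n / L ^ Suc n" for n
  have r_power: "r n ^ Suc a \<le> \<sigma> a" for n a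
  proof -
    have "r n ^ i * \<sigma> n \<le> \<sigma> (n + i)" for i
    proof (induction i)
      case (Suc i)
      have "r n * (r n ^ i * \<sigma> n) \<le> r (n + i) * \<sigma> (n + i)"
        by (rule mult_mono[OF incseqD[OF r_mono] Suc]) (simp_all add: r_def \<sigma>_nonneg)
      then have "r n ^ Suc i * \<sigma> n \<le> r (n + i) * \<sigma> (n + i)" by (simp add: mult.assoc)
      then show ?case using \<sigma>_pos[of "n + i"] by (simp add: r_def)
    qed simp
    from this[of "Suc a"] have "r n ^ Suc a * \<sigma> n \<le> \<sigma> a * \<sigma> n"
      using submult[of a n] by (simp add: add.commute)
    then show ?thesis using \<sigma>_pos[of n] by simp
  qed
  have s_ge: "s a \<ge> 1" for a
  proof -
    have "(\<lambda>n. r n ^ Suc a) \<longlonglongrightarrow> L ^ Suc a" by (intro tendsto_power L)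
    then have "L ^ Suc a \<le> \<sigma> a" by (rule LIMSEQ_le_const2) (use r_power in blast)
    then show ?thesis using L0 by (simp add: s_def)
  qed
  have s_dec: "decseq s"
  proof (rule decseq_SucI)
    fix n
    have "\<sigma> (Suc n) \<le> L * \<sigma> n" using L(2)[of n] \<sigma>_pos[of n] by (simp add: r_def field_simps)
    then show "s (Suc n) \<le> s n" using L0 by (simp add: s_def field_simps)
  qed
  obtain s' where s_lim: "s \<longlonglongrightarrow> s'" "\<And>n. s' \<le> s n"
    using decseq_convergent[OF s_dec, of 1] s_ge by blast
  define h where "h n = (\<lambda>x. q n x / L ^ Suc n)" for n
  have Lp: "L ^ n > 0" for n using L0 by simp
  have Kh: "K (h n)" for n
    unfolding K_def
  proof (intro conjI allI impI)
    show "uc (h n)"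
      unfolding uc_def
    proof (intro conjI allI impI)
      show "bdd (h n)" unfolding h_def by (rule bdd_divide[OF Kb[OF Kq]])
      fix e :: real assume "e > 0"
      then have "e * L ^ Suc n > 0" using Lp[of "Suc n"] by (rule mult_pos_pos)
      then obtain U where U: "U \<in> N" "\<And>x u. u \<in> U \<Longrightarrow> \<bar>q n (x + u) - q n x\<bar> \<le> e * L ^ Suc n"
        using ucE[OF Kuc[OF Kq]] by blast
      have "\<bar>h n (x + u) - h n x\<bar> \<le> e" if "u \<in> U" for x u
      proof -
        have "\<bar>h n (x + u) - h n x\<bar> = \<bar>q n (x + u) - q n x\<bar> / L ^ Suc n"
          unfolding h_def diff_divide_distrib[symmetric] abs_divide using Lp[of "Suc n"] by simp
        also have "\<dots> \<le> e" using U(2)[OF that, of x] Lp[of "Suc n"] by (simp only: pos_divide_le_eq)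
        finally show ?thesis .
      qed
      then show "\<exists>U\<in>N. \<forall>x. \<forall>u\<in>U. \<bar>h n (x + u) - h n x\<bar> \<le> e" using U(1) by blast
    qed
    show "m (h n) = 0"
      using mean_divide[OF mean_m Kb[OF Kq[of n]], of "L ^ Suc n"] Kq[of n] unfolding h_def K_def by simp
    show "h n (- x) = h n x" for x using Keven[OF Kq] by (simp add: h_def)
    show "h n x = 0" if "x \<notin> C" for x using Kq[of n] that by (simp add: h_def K_def)
    show "h n (x + z) = h n x" if "\<forall>x. f (x + z) = f x" for z x using Kq[of n] that by (simp add: h_def K_def)
  qed
  have hh: "conv (h a) (h b) x = h (Suc (a + b)) x" for a b x
  proof -
    have "conv (h a) (h b) x = m (\<lambda>y. q a (x - y) * q b y / (L ^ Suc a * L ^ Suc b))"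
      by (simp add: conv_def h_def)
    also have "\<dots> = conv (q a) (q b) x / (L ^ Suc a * L ^ Suc b)"
      unfolding conv_def by (rule mean_divide[OF mean_m bdd_conv_arg[OF Kb[OF Kq] Kb[OF Kq]]])
    also have "\<dots> = h (Suc (a + b)) x" by (simp add: qq h_def power_add)
    finally show ?thesis .
  qed
  have h0: "h n 0 = s n" for n by (simp add: h_def s_def q0)
  have iph: "ip (h a) (h b) = s (Suc (a + b))" for a b
    using conv0[OF Kh, of a "h b"] by (simp add: hh h0)
  have step: "\<bar>h (Suc n) x - h (Suc k) x\<bar> \<le> sqrt (s 1 * (s (Suc (n + n)) + s (Suc (k + k)) - 2 * s (Suc (n + k))))" for n k x
  proof -
    let ?D = "\<lambda>x. h n x - h k x"
    have bD: "bdd ?D" by (intro bdd_diff Kb Kh)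
    have "ip ?D ?D = m (\<lambda>x. h n x * h n x + h k x * h k x - 2 * (h n x * h k x))"
      unfolding ip_def by (rule arg_cong[where f = m]) (auto simp: algebra_simps)
    also have "\<dots> = ip (h n) (h n) + ip (h k) (h k) - 2 * ip (h n) (h k)"
      unfolding ip_def by (simp only: mean_add[OF mean_m] mean_diff[OF mean_m] mean_cmult[OF mean_m] bdd_add bdd_mult bdd_cmult Kb Kh)
    finally have ipD: "ip ?D ?D = s (Suc (n + n)) + s (Suc (k + k)) - 2 * s (Suc (n + k))" by (simp add: iph)
    have "h (Suc n) x - h (Suc k) x = conv (h 0) (h n) x - conv (h 0) (h k) x" by (simp add: hh)
    also have "\<dots> = conv (h 0) ?D x"
      unfolding conv_def right_diff_distrib by (rule mean_diff[OF mean_m, symmetric]) (intro bdd_conv_arg Kb Kh)+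
    finally have "\<bar>h (Suc n) x - h (Suc k) x\<bar> \<le> sqrt (ip (h 0) (h 0)) * sqrt (ip ?D ?D)"
      using CS[OF Kh bD] by simp
    then show ?thesis unfolding ipD by (simp add: iph real_sqrt_mult)
  qed
  have s1: "s 1 > 0" using s_ge[of 1] by simp
  have cauchy: "\<exists>M. \<forall>n\<ge>M. \<forall>k\<ge>M. \<forall>x. \<bar>h n x - h k x\<bar> \<le> e" if e: "e > 0" for e
  proof -
    define d where "d = e\<^sup>2 / (2 * s 1)"
    have d: "d > 0" using e s1 by (simp add: d_def)
    obtain M where M: "\<And>n. n \<ge> M \<Longrightarrow> \<bar>s n - s'\<bar> < d"
      using LIMSEQ_D[OF s_lim(1) d] by auto
    have "\<bar>h (Suc n) x - h (Suc k) x\<bar> \<le> e" if "n \<ge> M" "k \<ge> M" for n k x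
    proof -
      have "s (Suc (n + n)) + s (Suc (k + k)) - 2 * s (Suc (n + k)) \<le> 2 * d"
        using M[of "Suc (n + n)"] M[of "Suc (k + k)"] s_lim(2)[of "Suc (n + k)"] that by simp
      then have "s 1 * (s (Suc (n + n)) + s (Suc (k + k)) - 2 * s (Suc (n + k))) \<le> s 1 * (2 * d)"
        using s1 by (intro mult_left_mono) auto
      also have "\<dots> = e\<^sup>2" using s1 by (simp add: d_def)
      finally have "sqrt (s 1 * (s (Suc (n + n)) + s (Suc (k + k)) - 2 * s (Suc (n + k)))) \<le> e"
        using e by (intro real_le_lsqrt) auto
      then show ?thesis using step[of n x k] by linarith
    qed
    note * = this
    have "\<bar>h n x - h k x\<bar> \<le> e" if "n \<ge> Suc M" "k \<ge> Suc M" for n k x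
      using *[of "n - 1" "k - 1" x] that by (cases n; cases k) auto
    then show ?thesis by blast
  qed
  define P where "P x = lim (\<lambda>n. h n x)" for x
  have lim: "(\<lambda>n. h n x) \<longlonglongrightarrow> P x" for x
  proof -
    have "Cauchy (\<lambda>n. h n x)"
      unfolding Cauchy_altdef2
    proof (intro allI impI)
      fix e :: real assume "e > 0"
      then obtain M where M: "\<forall>n\<ge>M. \<forall>k\<ge>M. \<forall>x. \<bar>h n x - h k x\<bar> \<le> e / 2" using cauchy[of "e / 2"] by auto
      have "\<bar>h n x - h M x\<bar> < e" if "n \<ge> M" for n
      proof -
        have "\<bar>h n x - h M x\<bar> \<le> e / 2" using M that by blast
        then show ?thesis using \<open>e > 0\<close> by linarith
      qed
      then show "\<exists>M. \<forall>n\<ge>M. dist (h n x) (h M x) < e" by (auto simp: dist_real_def)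
    qed
    then show ?thesis unfolding P_def by (simp add: Cauchy_convergent_iff convergent_LIMSEQ_iff)
  qed
  have unif: "\<exists>M. \<forall>n\<ge>M. \<forall>x. \<bar>P x - h n x\<bar> \<le> e" if e: "e > 0" for e
  proof -
    obtain M where M: "\<forall>n\<ge>M. \<forall>k\<ge>M. \<forall>x. \<bar>h n x - h k x\<bar> \<le> e" using cauchy[OF e] by blast
    have "\<bar>P x - h n x\<bar> \<le> e" if "n \<ge> M" for n x
    proof (rule LIMSEQ_le_const2)
      show "(\<lambda>k. \<bar>h k x - h n x\<bar>) \<longlonglongrightarrow> \<bar>P x - h n x\<bar>" by (intro tendsto_intros lim)
      show "\<exists>M. \<forall>k\<ge>M. \<bar>h k x - h n x\<bar> \<le> e" using M that by blast
    qed
    then show ?thesis by blast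
  qed
  have hb: "\<bar>h n x\<bar> \<le> s 0" for n x
  proof -
    have "\<bar>h n x\<bar> \<le> s n" unfolding h_def s_def abs_divide using q_le[of n x] L0 by (simp add: divide_right_mono)
    then show ?thesis using decseqD[OF s_dec, of 0 n] by simp
  qed
  have Pb: "\<bar>P x\<bar> \<le> s 0" for x
    by (rule LIMSEQ_le_const2[OF tendsto_rabs[OF lim]]) (use hb in blast)
  have bP: "bdd P" using Pb by (rule bddI)
  have s0: "s 0 > 0" using s_ge[of 0] by simp
  have "uc P"
    unfolding uc_def
  proof (intro conjI allI impI bP)
    fix e :: real assume "e > 0"
    then have e3: "e / 3 > 0" by simp
    obtain n where n: "\<And>x. \<bar>P x - h n x\<bar> \<le> e / 3" using unif[OF e3] by blast
    obtain U where U: "U \<in> N" "\<And>x u. u \<in> U \<Longrightarrow> \<bar>h n (x + u) - h n x\<bar> \<le> e / 3" using ucE[OF Kuc[OF Kh] e3] by blast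
    have "\<bar>P (x + u) - P x\<bar> \<le> e" if "u \<in> U" for x u
      using n[of x] n[of "x + u"] U(2)[OF that, of x] by linarith
    then show "\<exists>U\<in>N. \<forall>x. \<forall>u\<in>U. \<bar>P (x + u) - P x\<bar> \<le> e" using U(1) by blast
  qed
  moreover have "P (- x) = P x" for x
    using LIMSEQ_unique[OF lim[of "- x"]] lim[of x] Keven[OF Kh] by simp
  moreover have "P x = 0" if "x \<notin> C" for x
    using LIMSEQ_unique[OF lim[of x], of 0] Kh that by (simp add: K_def)
  moreover have "m P = 0"
  proof (rule ccontr)
    assume "m P \<noteq> 0"
    then obtain n where n: "\<And>x. \<bar>P x - h n x\<bar> \<le> \<bar>m P\<bar> / 2" using unif[of "\<bar>m P\<bar> / 2"] by auto
    have "\<bar>m P - m (h n)\<bar> \<le> \<bar>m P\<bar> / 2" by (rule mean_dist_le[OF mean_m bP Kb[OF Kh] n])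
    then show False using Kh[of n] \<open>m P \<noteq> 0\<close> by (simp add: K_def)
  qed
  moreover have "P 0 > 0"
  proof -
    have "1 \<le> P 0" by (rule LIMSEQ_le_const[OF lim]) (use s_ge h0 in auto)
    then show ?thesis by simp
  qed
  moreover have "conv P P x = P x" for x
  proof -
    have close: "\<bar>conv P P x - P x\<bar> \<le> (2 * s 0 + 1) * e" if e: "e > 0" for e
    proof -
      obtain M where M: "\<And>n x. n \<ge> M \<Longrightarrow> \<bar>P x - h n x\<bar> \<le> e" using unif[OF e] by blast
      have "\<bar>conv P P x - conv (h M) (h M) x\<bar> \<le> 2 * s 0 * e"
        unfolding conv_def
      proof (rule mean_dist_le[OF mean_m bdd_conv_arg[OF bP bP] bdd_conv_arg[OF Kb[OF Kh] Kb[OF Kh]]])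
        fix y
        have "P (x - y) * P y - h M (x - y) * h M y = (P (x - y) - h M (x - y)) * P y + h M (x - y) * (P y - h M y)"
          by (simp add: algebra_simps)
        moreover have "\<bar>(P (x - y) - h M (x - y)) * P y\<bar> \<le> e * s 0"
          unfolding abs_mult using M[of M] Pb e by (intro mult_mono) auto
        moreover have "\<bar>h M (x - y) * (P y - h M y)\<bar> \<le> s 0 * e"
          unfolding abs_mult using M[of M] hb s0 by (intro mult_mono) auto
        ultimately show "\<bar>P (x - y) * P y - h M (x - y) * h M y\<bar> \<le> 2 * s 0 * e" by (simp add: mult.commute)
      qed
      moreover have "\<bar>P x - conv (h M) (h M) x\<bar> \<le> e" unfolding hh by (rule M) simp
      ultimately show ?thesis by (simp add: distrib_right)
    qed
    show ?thesis
    proof (rule ccontr)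
      assume "conv P P x \<noteq> P x"
      then have pos: "\<bar>conv P P x - P x\<bar> > 0" by simp
      have "2 * s 0 + 1 > 0" using s0 by simp
      then have "(2 * s 0 + 1) * (\<bar>conv P P x - P x\<bar> / (2 * (2 * s 0 + 1))) = \<bar>conv P P x - P x\<bar> / 2"
        by (simp add: field_simps)
      moreover have "\<bar>conv P P x - P x\<bar> / (2 * (2 * s 0 + 1)) > 0" using pos s0 by simp
      ultimately have "\<bar>conv P P x - P x\<bar> \<le> \<bar>conv P P x - P x\<bar> / 2" using close by metis
      then show False using pos by simp
    qed
  qed
  moreover have "P (x + z) = P x" if "\<forall>x. f (x + z) = f x" for z x
  proof -
    have "h n (x + z) = h n x" for n using Kh[of n] that by (simp add: K_def)
    then show ?thesis using LIMSEQ_unique[OF lim[of "x + z"]] lim[of x] by simp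
  qed
  ultimately show ?thesis by blast
qed

end

section \<open>Norms from convolution idempotents\<close>

lemma list_split_sum:
  fixes w :: "'x \<Rightarrow> real"
  assumes "0 \<le> t" "t < (\<Sum>x\<leftarrow>L. w x)"
  shows "\<exists>A p B. L = A @ p # B \<and> (\<Sum>x\<leftarrow>A. w x) \<le> t \<and> t < (\<Sum>x\<leftarrow>A. w x) + w p"
  using assms
proof (induction L arbitrary: t)
  case (Cons q L)
  show ?case
  proof (cases "t < w q")
    case True
    then show ?thesis using Cons.prems by (intro exI[of _ "[]"] exI[of _ q] exI[of _ L]) simp
  next
    case False
    then obtain A p B where "L = A @ p # B" "(\<Sum>x\<leftarrow>A. w x) \<le> t - w q" "t - w q < (\<Sum>x\<leftarrow>A. w x) + w p"
      using Cons.IH[of "t - w q"] Cons.prems by auto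
    then show ?thesis by (intro exI[of _ "q # A"] exI[of _ p] exI[of _ B]) simp
  qed
qed simp

lemma chain_sum_mem:
  fixes W :: "nat \<Rightarrow> 'a::ab_group_add set" and L :: "(nat \<times> 'a) list"
  assumes zero: "\<And>n. 0 \<in> W n" and dec: "\<And>n. W (Suc n) \<subseteq> W n"
    and add: "\<And>n x y z. x \<in> W (Suc n) \<Longrightarrow> y \<in> W (Suc n) \<Longrightarrow> z \<in> W (Suc n) \<Longrightarrow> x + y + z \<in> W n"
    and L: "\<And>n x. (n, x) \<in> set L \<Longrightarrow> x \<in> W n" and le: "(\<Sum>p\<leftarrow>L. (1 / 2) ^ fst p) < (1 / 2 :: real) ^ m"
  shows "(\<Sum>p\<leftarrow>L. snd p) \<in> W m"
  using L le
proof (induction L arbitrary: m rule: length_induct)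
  case (1 L)
  let ?w = "\<lambda>p :: nat \<times> 'a. (1 / 2 :: real) ^ fst p"
  have nonneg: "0 \<le> (\<Sum>p\<leftarrow>A. ?w p)" for A :: "(nat \<times> 'a) list" by (intro sum_list_nonneg) auto
  show ?case
  proof (cases "L = []")
    case False
    then obtain q L' where "L = q # L'" by (cases L) auto
    then have pos: "0 < (\<Sum>p\<leftarrow>L. ?w p)" using nonneg[of L'] by (simp add: add_pos_nonneg)
    let ?t = "(\<Sum>p\<leftarrow>L. ?w p) / 2"
    obtain A p B where AB: "L = A @ p # B" "(\<Sum>x\<leftarrow>A. ?w x) \<le> ?t" "?t < (\<Sum>x\<leftarrow>A. ?w x) + ?w p"
      using list_split_sum[of ?t ?w L] pos by auto
    have total: "(\<Sum>p\<leftarrow>L. ?w p) = (\<Sum>x\<leftarrow>A. ?w x) + ?w p + (\<Sum>x\<leftarrow>B. ?w x)" by (simp add: AB(1))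
    have t: "?t < (1 / 2) ^ Suc m" using "1.prems"(2) by simp
    have "(\<Sum>p\<leftarrow>A. snd p) \<in> W (Suc m)"
      using "1.IH" "1.prems"(1) AB(2) t by (simp add: AB(1))
    moreover have "(\<Sum>p\<leftarrow>B. snd p) \<in> W (Suc m)"
    proof -
      have "(\<Sum>x\<leftarrow>B. ?w x) < (1 / 2) ^ Suc m" using total AB(3) t by linarith
      then show ?thesis using "1.IH" "1.prems"(1) by (simp add: AB(1))
    qed
    moreover have "snd p \<in> W (Suc m)"
    proof -
      have "?w p < (1 / 2) ^ m" using total nonneg[of A] nonneg[of B] "1.prems"(2) by linarith
      then have "m < fst p" using power_decreasing[of "fst p" m "1 / 2 :: real"] by (cases "m < fst p") auto
      then have "Suc m \<le> fst p" by simp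
      then have "W (fst p) \<subseteq> W (Suc m)" using lift_Suc_antimono_le[of W] dec by blast
      then show ?thesis using "1.prems"(1)[of "fst p" "snd p"] by (auto simp: AB(1))
    qed
    ultimately have "(\<Sum>p\<leftarrow>A. snd p) + snd p + (\<Sum>p\<leftarrow>B. snd p) \<in> W m" by (intro add)
    then show ?thesis by (simp add: AB(1) add.assoc)
  qed (simp add: zero)
qed

lemma chain_norm:
  fixes W :: "nat \<Rightarrow> 'a::ab_group_add set"
  assumes zero: "\<And>n. 0 \<in> W n" and dec: "\<And>n. W (Suc n) \<subseteq> W n" and neg: "\<And>n x. x \<in> W n \<Longrightarrow> - x \<in> W n"
    and add: "\<And>n x y z. x \<in> W (Suc n) \<Longrightarrow> y \<in> W (Suc n) \<Longrightarrow> z \<in> W (Suc n) \<Longrightarrow> x + y + z \<in> W n"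
    and UNIV: "W 0 = UNIV"
  shows "\<exists>\<nu>. (\<forall>x. 0 \<le> \<nu> x) \<and> (\<forall>x. \<nu> (- x) = \<nu> x) \<and> (\<forall>x y. \<nu> (x + y) \<le> \<nu> x + \<nu> y) \<and>
    (\<forall>n. \<forall>x\<in>W n. \<nu> x \<le> (1 / 2 :: real) ^ n) \<and> (\<forall>n x. \<nu> x < (1 / 2) ^ n \<longrightarrow> x \<in> W n)"
proof -
  define X where "X x = {\<Sum>p\<leftarrow>L. (1 / 2 :: real) ^ fst p | L. (\<forall>(n, y)\<in>set L. y \<in> W n) \<and> (\<Sum>p\<leftarrow>L. snd p) = x}" for x
  define \<nu> where "\<nu> x = Inf (X x)" for x
  have X_ge: "0 \<le> r" if "r \<in> X x" for r x
    using that unfolding X_def by (auto intro!: sum_list_nonneg)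
  have bb: "bdd_below (X x)" for x by (rule bdd_belowI[OF X_ge])
  have X1: "(1 / 2) ^ n \<in> X x" if "x \<in> W n" for x n
    unfolding X_def using that by (intro CollectI exI[of _ "[(n, x)]"]) simp
  have ne: "X x \<noteq> {}" for x using X1[of x 0] UNIV by auto
  have le: "\<nu> x \<le> r" if "r \<in> X x" for x r unfolding \<nu>_def by (rule cInf_lower[OF that bb])
  have lt: "\<exists>r\<in>X x. r < t" if "\<nu> x < t" for x t
    using that unfolding \<nu>_def by (rule cInf_lessD[OF ne])
  have "0 \<le> \<nu> x" for x unfolding \<nu>_def by (rule cInf_greatest[OF ne X_ge])
  moreover have "\<nu> (- x) = \<nu> x" for x
  proof -
    have sub: "X x \<subseteq> X (- x)" for x
    proof
      fix r assume "r \<in> X x"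
      then obtain L where L: "r = (\<Sum>p\<leftarrow>L. (1 / 2) ^ fst p)" "\<forall>(n, y)\<in>set L. y \<in> W n" "(\<Sum>p\<leftarrow>L. snd p) = x"
        unfolding X_def by blast
      let ?L = "map (\<lambda>(n, y). (n, - y)) L"
      have "r = (\<Sum>p\<leftarrow>?L. (1 / 2) ^ fst p)" unfolding L(1) by (simp add: o_def case_prod_beta)
      moreover have "\<forall>(n, y)\<in>set ?L. y \<in> W n" using L(2) neg by auto
      moreover have "(\<Sum>p\<leftarrow>?L. snd p) = - x"
        unfolding L(3)[symmetric] by (simp add: o_def case_prod_beta uminus_sum_list_map)
      ultimately show "r \<in> X (- x)" unfolding X_def by blast
    qed
    have "X (- x) = X x" using sub[of x] sub[of "- x"] by auto
    then show ?thesis by (simp add: \<nu>_def)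
  qed
  moreover have "\<nu> (x + y) \<le> \<nu> x + \<nu> y" for x y
  proof (rule field_le_epsilon)
    fix e :: real assume "e > 0"
    obtain r where r: "r \<in> X x" "r < \<nu> x + e / 2" using lt[of x "\<nu> x + e / 2"] \<open>e > 0\<close> by auto
    obtain s where s: "s \<in> X y" "s < \<nu> y + e / 2" using lt[of y "\<nu> y + e / 2"] \<open>e > 0\<close> by auto
    have "r + s \<in> X (x + y)"
    proof -
      obtain L where L: "r = (\<Sum>p\<leftarrow>L. (1 / 2) ^ fst p)" "\<forall>(n, y)\<in>set L. y \<in> W n" "(\<Sum>p\<leftarrow>L. snd p) = x"
        using r(1) unfolding X_def by blast
      obtain L' where L': "s = (\<Sum>p\<leftarrow>L'. (1 / 2) ^ fst p)" "\<forall>(n, y)\<in>set L'. y \<in> W n" "(\<Sum>p\<leftarrow>L'. snd p) = y"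
        using s(1) unfolding X_def by blast
      show ?thesis unfolding X_def using L L' by (intro CollectI exI[of _ "L @ L'"]) auto
    qed
    then have "\<nu> (x + y) \<le> r + s" by (rule le)
    then show "\<nu> (x + y) \<le> \<nu> x + \<nu> y + e" using r(2) s(2) by linarith
  qed
  moreover have "\<nu> x \<le> (1 / 2) ^ n" if "x \<in> W n" for n x using le[OF X1[OF that]] .
  moreover have "x \<in> W n" if less: "\<nu> x < (1 / 2) ^ n" for n x
  proof -
    obtain r where r: "r \<in> X x" "r < (1 / 2) ^ n" using lt[OF less] by blast
    then obtain L where L: "(\<Sum>p\<leftarrow>L. (1 / 2) ^ fst p) < (1 / 2 :: real) ^ n" "\<forall>(n, y)\<in>set L. y \<in> W n" "(\<Sum>p\<leftarrow>L. snd p) = x"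
      unfolding X_def by blast
    have "(\<Sum>p\<leftarrow>L. snd p) \<in> W n" by (rule chain_sum_mem[of W]) (use zero dec add L in auto)
    then show ?thesis by (simp add: L(3))
  qed
  ultimately show ?thesis by blast
qed

context precompact_nbhds
begin

text \<open>\<open>\<rho> x\<close> is the \<open>L\<^sup>2\<close> distance of a convolution idempotent \<open>P\<close> from its translate by \<open>x\<close>.\<close>
lemma ex_doubling_norm:
  assumes C: "0 \<in> C" "\<And>x y. x \<in> C \<Longrightarrow> y \<in> C \<Longrightarrow> x + y \<in> C" "\<And>x. x \<in> C \<Longrightarrow> - x \<in> C" "U\<^sub>0 \<in> N" "U\<^sub>0 \<subseteq> C"
    and H: "0 \<in> H" "\<And>x y. x \<in> H \<Longrightarrow> y \<in> H \<Longrightarrow> x + y \<in> H" "\<And>x. x \<in> H \<Longrightarrow> - x \<in> H" "H \<subseteq> C"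
    and x\<^sub>0: "x\<^sub>0 \<in> C" "U \<in> N" "\<And>h. h \<in> H \<Longrightarrow> x\<^sub>0 - h \<notin> U"
  shows "\<exists>\<rho> :: 'a \<Rightarrow> real. (\<forall>x. 0 \<le> \<rho> x) \<and> (\<forall>x. \<rho> (- x) = \<rho> x) \<and> (\<forall>x y. \<rho> (x + y) \<le> \<rho> x + \<rho> y) \<and>
    (\<forall>e>0. \<exists>U\<in>N. \<forall>u\<in>U. \<rho> u \<le> e) \<and> (\<forall>x. (\<rho> x)\<^sup>2 * (4 - (\<rho> x)\<^sup>2) \<le> (\<rho> (x + x))\<^sup>2) \<and> (\<forall>h\<in>H. \<rho> h = 0) \<and>
    (\<exists>x\<in>C. \<rho> x \<noteq> 0)"
proof -
  obtain U1 where U1: "U1 \<in> N" "U1 \<subseteq> U\<^sub>0" "U1 \<subseteq> U" using nbhds_Int[OF N C(4) x\<^sub>0(2)] .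
  have "\<exists>V. \<forall>n. (V n \<in> N \<and> V n \<subseteq> U1) \<and> (\<forall>x\<in>V (Suc n). \<forall>y\<in>V (Suc n). \<forall>z\<in>V (Suc n). x + y + z \<in> V n)"
  proof (rule dependent_nat_choice)
    show "\<exists>V. V \<in> N \<and> V \<subseteq> U1" using U1 by blast
    fix V and n :: nat assume V: "V \<in> N \<and> V \<subseteq> U1"
    obtain V' where V': "V' \<in> N" "V' \<subseteq> V" "\<And>x y z w. x \<in> V' \<Longrightarrow> y \<in> V' \<Longrightarrow> z \<in> V' \<Longrightarrow> w \<in> V' \<Longrightarrow> x + y + (z + w) \<in> V"
      using nbhds_add4[OF N, of V] V by blast
    have "x + y + z \<in> V" if "x \<in> V'" "y \<in> V'" "z \<in> V'" for x y z
      using V'(3)[OF that nbhds_zero[OF N V'(1)]] by simp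
    then show "\<exists>V'. (V' \<in> N \<and> V' \<subseteq> U1) \<and> (\<forall>x\<in>V'. \<forall>y\<in>V'. \<forall>z\<in>V'. x + y + z \<in> V)"
      using V V'(1,2) by (intro exI[of _ V']) auto
  qed
  then obtain V where V: "\<And>n. V n \<in> N" "\<And>n. V n \<subseteq> U1"
    "\<And>n x y z. x \<in> V (Suc n) \<Longrightarrow> y \<in> V (Suc n) \<Longrightarrow> z \<in> V (Suc n) \<Longrightarrow> x + y + z \<in> V n" by blast
  define W where "W n = (case n of 0 \<Rightarrow> UNIV | Suc k \<Rightarrow> {x. \<exists>h\<in>H. x - h \<in> V k})" for n
  have W0: "W 0 = UNIV" and WS: "W (Suc k) = {x. \<exists>h\<in>H. x - h \<in> V k}" for k by (simp_all add: W_def)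
  have HW: "h \<in> W n" if "h \<in> H" for h n
    using that nbhds_zero[OF N V(1)] by (cases n) (auto simp: W0 WS intro!: bexI[of _ h])
  have W_add: "x + y + z \<in> W n" if "x \<in> W (Suc n)" "y \<in> W (Suc n)" "z \<in> W (Suc n)" for n x y z
  proof (cases n)
    case (Suc k)
    obtain h h' h'' where h: "h \<in> H" "h' \<in> H" "h'' \<in> H" "x - h \<in> V n" "y - h' \<in> V n" "z - h'' \<in> V n"
      using \<open>x \<in> W (Suc n)\<close> \<open>y \<in> W (Suc n)\<close> \<open>z \<in> W (Suc n)\<close> unfolding WS by blast
    have "(x - h) + (y - h') + (z - h'') \<in> V k" using h V(3) by (simp add: Suc)
    then have "(x + y + z) - (h + h' + h'') \<in> V k" by (simp add: algebra_simps)
    moreover have "h + h' + h'' \<in> H" using h H(2) by blast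
    ultimately show ?thesis unfolding Suc WS by blast
  qed (simp add: W0)
  have W_neg: "- x \<in> W n" if x: "x \<in> W n" for n x
  proof (cases n)
    case (Suc k)
    obtain h where h: "h \<in> H" "x - h \<in> V k" using x unfolding Suc WS by blast
    have "- (x - h) \<in> V k" by (rule nbhds_uminus[OF N V(1) h(2)])
    then have "- x - (- h) \<in> V k" by simp
    then show ?thesis unfolding Suc WS using H(3)[OF h(1)] by blast
  qed (simp add: W0)
  have W_dec: "W (Suc n) \<subseteq> W n" for n
  proof
    fix x assume "x \<in> W (Suc n)"
    then have "x + 0 + 0 \<in> W n" by (rule W_add[OF _ HW[OF H(1)] HW[OF H(1)]])
    then show "x \<in> W n" by simp
  qed
  have "\<exists>\<nu>. (\<forall>x. 0 \<le> \<nu> x) \<and> (\<forall>x. \<nu> (- x) = \<nu> x) \<and> (\<forall>x y. \<nu> (x + y) \<le> \<nu> x + \<nu> y) \<and>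
    (\<forall>n. \<forall>x\<in>W n. \<nu> x \<le> (1 / 2 :: real) ^ n) \<and> (\<forall>n x. \<nu> x < (1 / 2) ^ n \<longrightarrow> x \<in> W n)"
    by (rule chain_norm) (fact HW[OF H(1)] W_dec W_neg W_add W0)+
  then obtain \<nu> where \<nu>': "\<forall>x. 0 \<le> \<nu> x" "\<forall>x. \<nu> (- x) = \<nu> x" "\<forall>x y. \<nu> (x + y) \<le> \<nu> x + \<nu> y"
    "\<forall>n. \<forall>x\<in>W n. \<nu> x \<le> (1 / 2 :: real) ^ n" "\<forall>n x. \<nu> x < (1 / 2) ^ n \<longrightarrow> x \<in> W n"
    by (elim exE conjE) (rule that)
  note \<nu> = \<nu>'[rule_format]
  have \<nu>_small: "\<nu> u \<le> (1 / 2) ^ Suc n" if "u \<in> V n" for n u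
    using that H(1) by (intro \<nu>(4)) (auto simp: WS intro!: bexI[of _ 0])
  have \<nu>H: "\<nu> h = 0" if "h \<in> H" for h
  proof (rule ccontr)
    assume "\<nu> h \<noteq> 0"
    then have "\<nu> h > 0" using \<nu>(1)[of h] by simp
    then obtain n where "(1 / 2) ^ n < \<nu> h" using real_arch_pow_inv[of "\<nu> h" "1 / 2"] by auto
    then show False using \<nu>(4)[OF HW[OF that, of n]] by simp
  qed
  have \<nu>x\<^sub>0: "1 / 2 \<le> \<nu> x\<^sub>0"
  proof (rule ccontr)
    assume "\<not> ?thesis"
    then have "x\<^sub>0 \<in> W (Suc 0)" by (intro \<nu>(5)) simp
    then show False using x\<^sub>0(3) V(2) U1(3) unfolding WS by blast
  qed
  have \<nu>0: "\<nu> 0 = 0" by (rule \<nu>H[OF H(1)])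
  have VC: "u \<in> C" if "u \<in> V n" for u n using that V(2) U1(2) C(5) by blast
  have C_iff: "x + u \<in> C \<longleftrightarrow> x \<in> C" if "u \<in> C" for x u
    using C(2)[of x u] C(2)[of "x + u" "- u"] C(3)[OF that] that by auto
  define I where "I = indicat_real C"
  define g where "g x = max 0 (1 - 2 * \<nu> x) * I x" for x
  have I_shift: "I (x + u) = I x" if "u \<in> C" for x u
    using C_iff[OF that, of x] by (simp add: I_def indicator_def)
  have I_neg: "I (- x) = I x" for x
    using C(3)[of x] C(3)[of "- x"] by (auto simp: I_def indicator_def)
  have ucI: "uc I"
    unfolding uc_def
  proof (intro conjI allI impI)
    show "bdd I" by (simp add: I_def)
    show "\<exists>U\<in>N. \<forall>x. \<forall>u\<in>U. \<bar>I (x + u) - I x\<bar> \<le> e" if "e > 0" for e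
      using V(1)[of 0] VC[of _ 0] that by (intro bexI[of _ "V 0"]) (auto simp: I_shift)
  qed
  have mI: "0 < m I"
  proof -
    have "I 0 \<noteq> 0" by (simp add: I_def C(1))
    moreover have "(\<lambda>y. (I y)\<^sup>2) = I" by (auto simp: I_def indicator_def)
    ultimately show ?thesis using mean_square_pos[OF ucI] by metis
  qed
  have \<nu>_dist: "\<bar>\<nu> (x + u) - \<nu> x\<bar> \<le> \<nu> u" for x u
    using \<nu>(3)[of x u] \<nu>(3)[of "x + u" "- u"] \<nu>(2)[of u] by auto
  have g_dist: "\<bar>g (x + u) - g x\<bar> \<le> 2 * \<nu> u" if "u \<in> C" for x u
  proof -
    have "\<bar>max 0 (1 - 2 * \<nu> (x + u)) - max 0 (1 - 2 * \<nu> x)\<bar> \<le> 2 * \<nu> u"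
      using \<nu>_dist[of x u] by (auto simp: max_def abs_if split: if_splits)
    then show ?thesis using \<nu>(1)[of u] C_iff[OF that, of x] by (cases "x \<in> C") (simp_all add: g_def I_def)
  qed
  have bg: "bdd g"
    by (rule bddI[of _ 1]) (use \<nu>(1) in \<open>auto simp: g_def I_def indicator_def\<close>)
  define c where "c = m g / m I"
  define f where "f x = g x - c * I x" for x
  have bI: "bdd I" using ucI by (rule uc_bdd)
  have f_dist: "\<bar>f (x + u) - f x\<bar> \<le> 2 * \<nu> u" if "u \<in> C" for x u
    using g_dist[OF that, of x] by (simp add: f_def I_shift[OF that])
  have f_uc: "uc f"
    unfolding uc_def
  proof (intro conjI allI impI)
    show "bdd f" unfolding f_def[abs_def] by (intro bdd_diff bdd_cmult bg bI)
    fix e :: real assume "e > 0"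
    then obtain n where n: "(1 / 2) ^ n < e" using real_arch_pow_inv[of e "1 / 2"] by auto
    have "\<bar>f (x + u) - f x\<bar> \<le> e" if "u \<in> V n" for x u
      using f_dist[OF VC[OF that], of x] \<nu>_small[OF that] n by simp
    then show "\<exists>U\<in>N. \<forall>x. \<forall>u\<in>U. \<bar>f (x + u) - f x\<bar> \<le> e" using V(1) by blast
  qed
  have f_even: "f (- x) = f x" for x by (simp add: f_def g_def \<nu>(2) I_neg)
  have f_supp: "f x = 0" if "x \<notin> C" for x using that by (simp add: f_def g_def I_def)
  have f_mean: "m f = 0"
  proof -
    have "m f = m g - c * m I"
      unfolding f_def[abs_def] by (simp only: mean_diff[OF mean_m bg bdd_cmult[OF bI]] mean_cmult[OF mean_m bI])
    then show ?thesis using mI by (simp add: c_def)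
  qed
  obtain y where y: "f y \<noteq> 0"
  proof (cases "c = 0")
    case True
    have "f 0 \<noteq> 0" using True by (simp add: f_def g_def \<nu>0 I_def C(1))
    then show ?thesis by (rule that)
  next
    case False
    have "f x\<^sub>0 \<noteq> 0" using False \<nu>x\<^sub>0 by (simp add: f_def g_def I_def x\<^sub>0(1))
    then show ?thesis by (rule that)
  qed
  have "\<exists>P. uc P \<and> (\<forall>x. P (- x) = P x) \<and> (\<forall>x. x \<notin> C \<longrightarrow> P x = 0) \<and> m P = 0 \<and> P 0 > 0 \<and>
    (\<forall>x. conv P P x = P x) \<and> (\<forall>h. (\<forall>x. f (x + h) = f x) \<longrightarrow> (\<forall>x. P (x + h) = P x))"
    by (rule ex_convolution_idempotent[of C f y]) (fact C(2) f_uc f_even f_supp f_mean y)+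
  then obtain P where P': "uc P" "\<forall>x. P (- x) = P x" "\<forall>x. x \<notin> C \<longrightarrow> P x = 0" "m P = 0" "P 0 > 0"
    "\<forall>x. conv P P x = P x" "\<forall>h. (\<forall>x. f (x + h) = f x) \<longrightarrow> (\<forall>x. P (x + h) = P x)"
    by (elim exE conjE) (rule that)
  note P = P'[rule_format]
  have bP: "bdd (\<lambda>y. P (y + a))" for a by (rule bdd_comp[OF uc_bdd[OF P(1)]])
  have ipP: "m (\<lambda>y. P (y + a) * P (y + b)) = P (a - b)" for a b
  proof -
    have "P (a - b) = m (\<lambda>y. P (a - b - y) * P y)" using P(6)[of "a - b"] by (simp add: conv_def)
    also have "\<dots> = m (\<lambda>y. P (a - b - (- b - y)) * P (- b - y))"
      by (rule m_reflect[symmetric]) (rule bdd_conv_arg[OF uc_bdd[OF P(1)] uc_bdd[OF P(1)]])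
    also have "\<dots> = m (\<lambda>y. P (y + a) * P (y + b))"
    proof -
      have "P (- b - y) = P (y + b)" for y using P(2)[of "y + b"] by (simp add: algebra_simps)
      moreover have "a - b - (- b - y) = y + a" for y by (simp add: algebra_simps)
      ultimately show ?thesis by (simp only:)
    qed
    finally show ?thesis ..
  qed
  define D where "D x = (\<lambda>y. P (y + x) - P y)" for x
  have bD: "bdd (\<lambda>y. D x (y + z))" for x z
    unfolding D_def add.assoc by (intro bdd_diff bP)
  have bD0: "bdd (D x)" for x using bD[of x 0] by simp
  have ipD: "m (\<lambda>y. D x y * D x (y + z)) = 2 * P z - P (z + x) - P (z - x)" for x z
  proof -
    have "(\<lambda>y. D x y * D x (y + z)) = (\<lambda>y. P (y + x) * P (y + (z + x)) - P (y + x) * P (y + z) - P (y + 0) * P (y + (z + x)) + P (y + 0) * P (y + z))"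
      by (auto simp: D_def algebra_simps)
    then have "m (\<lambda>y. D x y * D x (y + z)) = P (x - (z + x)) - P (x - z) - P (0 - (z + x)) + P (0 - z)"
      by (simp only: mean_add[OF mean_m] mean_diff[OF mean_m] bdd_add bdd_diff bdd_mult bP ipP)
    moreover have "P (x - z) = P (z - x)" using P(2)[of "z - x"] by simp
    moreover have "P (- z - x) = P (z + x)" using P(2)[of "z + x"] by simp
    ultimately show ?thesis by (simp add: P(2))
  qed
  define \<rho> where "\<rho> x = sqrt (m (\<lambda>y. (D x y)\<^sup>2))" for x
  have \<rho>2: "(\<rho> x)\<^sup>2 = 2 * P 0 - 2 * P x" and sq: "m (\<lambda>y. (D x y)\<^sup>2) = (\<rho> x)\<^sup>2" for x
  proof -
    have "0 \<le> m (\<lambda>y. (D x y)\<^sup>2)" by (intro mean_nonneg[OF mean_m] bdd_power2 bD0) simp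
    then show "m (\<lambda>y. (D x y)\<^sup>2) = (\<rho> x)\<^sup>2" by (simp add: \<rho>_def)
    then show "(\<rho> x)\<^sup>2 = 2 * P 0 - 2 * P x" using ipD[of x 0] by (simp add: power2_eq_square P(2))
  qed
  have \<rho>_nonneg: "0 \<le> \<rho> x" for x
    unfolding \<rho>_def by (intro real_sqrt_ge_zero mean_nonneg[OF mean_m] bdd_power2 bD0) simp
  have \<rho>_neg: "\<rho> (- x) = \<rho> x" for x
    by (rule power2_eq_imp_eq) (simp_all add: \<rho>2 \<rho>_nonneg P(2))
  have tri: "\<rho> (x + z) \<le> \<rho> x + \<rho> z" for x z
  proof (rule power2_le_imp_le)
    have eq: "(D (x + z) y)\<^sup>2 = (D x (y + z))\<^sup>2 + (D z y)\<^sup>2 + 2 * (D x (y + z) * D z y)" for y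
      by (simp add: D_def power2_eq_square algebra_simps)
    have s1: "m (\<lambda>y. (D x (y + z))\<^sup>2) = (\<rho> x)\<^sup>2"
      using m_shift[OF bdd_power2[OF bD0[of x]], of z] sq[of x] by simp
    have "(m (\<lambda>y. D x (y + z) * D z y))\<^sup>2 \<le> (\<rho> x)\<^sup>2 * (\<rho> z)\<^sup>2"
      using mean_CS[OF mean_m bD[of x z] bD0[of z]] by (simp add: s1 sq)
    then have "m (\<lambda>y. D x (y + z) * D z y) \<le> \<rho> x * \<rho> z"
      using \<rho>_nonneg by (metis mult_nonneg_nonneg power2_le_imp_le power_mult_distrib)
    moreover have "(\<rho> (x + z))\<^sup>2 = (\<rho> x)\<^sup>2 + (\<rho> z)\<^sup>2 + 2 * m (\<lambda>y. D x (y + z) * D z y)"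
      unfolding sq[of "x + z", symmetric] eq
      by (simp only: mean_add[OF mean_m] mean_cmult[OF mean_m] bdd_add bdd_cmult bdd_power2 bdd_mult bD bD0 s1 sq)
    ultimately show "(\<rho> (x + z))\<^sup>2 \<le> (\<rho> x + \<rho> z)\<^sup>2" by (simp add: power2_eq_square algebra_simps)
  qed (simp add: \<rho>_nonneg)
  have cont: "\<exists>U\<in>N. \<forall>u\<in>U. \<rho> u \<le> e" if e: "e > 0" for e
  proof -
    have "e\<^sup>2 / 2 > 0" using e by simp
    then obtain U where U: "U \<in> N" "\<And>x u. u \<in> U \<Longrightarrow> \<bar>P (x + u) - P x\<bar> \<le> e\<^sup>2 / 2" using ucE[OF P(1)] by blast
    have "\<rho> u \<le> e" if "u \<in> U" for u
    proof (rule power2_le_imp_le)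
      have "\<bar>P u - P 0\<bar> \<le> e\<^sup>2 / 2" using U(2)[OF that, of 0] by simp
      then show "(\<rho> u)\<^sup>2 \<le> e\<^sup>2" unfolding \<rho>2 by linarith
    qed (use e in simp)
    then show ?thesis using U(1) by blast
  qed
  have doubling: "(\<rho> x)\<^sup>2 * (4 - (\<rho> x)\<^sup>2) \<le> (\<rho> (x + x))\<^sup>2" for x
  proof -
    define w where "w y = 2 * P y - P (y + x) - P (y - x)" for y
    have w: "w y = m (\<lambda>z. D x z * D x (z + y))" for y by (simp add: w_def ipD)
    have w_le: "\<bar>w y\<bar> \<le> (\<rho> x)\<^sup>2" for y
    proof -
      have s1: "m (\<lambda>z. (D x (z + y))\<^sup>2) = (\<rho> x)\<^sup>2"
        using m_shift[OF bdd_power2[OF bD0[of x]], of y] sq[of x] by simp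
      have "(w y)\<^sup>2 \<le> ((\<rho> x)\<^sup>2)\<^sup>2"
        unfolding w power2_eq_square[of "(\<rho> x)\<^sup>2"]
        using mean_CS[OF mean_m bD0[of x] bD[of x y]] by (simp only: s1 sq)
      then show ?thesis using abs_le_square_iff[of "w y" "(\<rho> x)\<^sup>2"] by simp
    qed
    have "m (\<lambda>y. (w y)\<^sup>2) \<le> m (\<lambda>_. ((\<rho> x)\<^sup>2)\<^sup>2)"
    proof (rule mean_mono[OF mean_m])
      show "bdd (\<lambda>y. (w y)\<^sup>2)" using w_le by (intro bdd_power2 bddI)
      show "(w y)\<^sup>2 \<le> ((\<rho> x)\<^sup>2)\<^sup>2" for y
        using w_le[of y] abs_le_square_iff[of "w y" "(\<rho> x)\<^sup>2"] by simp
    qed simp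
    then have le: "m (\<lambda>y. (w y)\<^sup>2) \<le> ((\<rho> x)\<^sup>2)\<^sup>2" by (simp add: mean_const[OF mean_m])
    have "(\<lambda>y. (w y)\<^sup>2) = (\<lambda>y. 4 * (P (y + 0) * P (y + 0)) + P (y + x) * P (y + x) + P (y + - x) * P (y + - x)
       - 4 * (P (y + 0) * P (y + x)) - 4 * (P (y + 0) * P (y + - x)) + 2 * (P (y + x) * P (y + - x)))"
      by (auto simp: w_def power2_eq_square algebra_simps)
    then have "m (\<lambda>y. (w y)\<^sup>2) = 4 * P (0 - 0) + P (x - x) + P (- x - - x) - 4 * P (0 - x) - 4 * P (0 - - x) + 2 * P (x - - x)"
      by (simp only: mean_add[OF mean_m] mean_diff[OF mean_m] mean_cmult[OF mean_m] bdd_add bdd_diff bdd_cmult bdd_mult bP ipP)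
    then have "m (\<lambda>y. (w y)\<^sup>2) = 6 * P 0 - 8 * P x + 2 * P (x + x)" by (simp add: P(2))
    also have "\<dots> = 4 * (\<rho> x)\<^sup>2 - (\<rho> (x + x))\<^sup>2" unfolding \<rho>2 by simp
    finally show ?thesis using le by (simp add: power2_eq_square algebra_simps)
  qed
  have \<rho>H: "\<rho> h = 0" if h: "h \<in> H" for h
  proof -
    have "h \<in> C" using h H(4) by blast
    then have "f (x + h) = f x" for x using f_dist[of h x] \<nu>H[OF h] by simp
    then have "P (0 + h) = P 0" by (rule P(7))
    then have "(\<rho> h)\<^sup>2 = 0" unfolding \<rho>2 by simp
    then show ?thesis by simp
  qed
  have "\<exists>x\<in>C. \<rho> x \<noteq> 0"
  proof (rule ccontr)
    assume "\<not> ?thesis"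
    then have zero: "\<rho> x = 0" if "x \<in> C" for x using that by blast
    have "P x = P 0 * I x" for x
    proof (cases "x \<in> C")
      case True
      then show ?thesis using \<rho>2[of x] zero[OF True] by (simp add: I_def)
    qed (simp add: I_def P(3))
    then have "P = (\<lambda>x. P 0 * I x)" by (rule ext)
    then have "m P = m (\<lambda>x. P 0 * I x)" by (rule arg_cong)
    also have "\<dots> = P 0 * m I" by (rule mean_cmult[OF mean_m bI])
    finally show False using P(4,5) mI by simp
  qed
  then show ?thesis
    by (intro exI[of _ \<rho>] conjI allI ballI impI \<rho>_nonneg \<rho>_neg tri cont doubling \<rho>H)
qed

end

section \<open>Locally connected precompact groups\<close>

primrec nsum :: "'a::ab_group_add set \<Rightarrow> nat \<Rightarrow> 'a set" where
  "nsum V 0 = {0}"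
| "nsum V (Suc n) = {x + v | x v. x \<in> nsum V n \<and> v \<in> V}"

lemma nsum_SucI: "x \<in> nsum V n \<Longrightarrow> v \<in> V \<Longrightarrow> x + v \<in> nsum V (Suc n)"
  by auto

lemma nsum_SucE:
  assumes "x \<in> nsum V (Suc n)" obtains y v where "y \<in> nsum V n" "v \<in> V" "x = y + v"
  using assms by auto

lemma nsum_add: "x \<in> nsum V a \<Longrightarrow> y \<in> nsum V b \<Longrightarrow> x + y \<in> nsum V (a + b)"
proof (induction b arbitrary: y)
  case (Suc b)
  then obtain z v where "z \<in> nsum V b" "v \<in> V" "y = z + v" by (elim nsum_SucE)
  then show ?case using nsum_SucI[OF Suc.IH] Suc.prems by (simp only: add.assoc[symmetric] add_Suc_right)
qed simp

lemma nsum_uminus: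
  assumes "\<And>v. v \<in> V \<Longrightarrow> - v \<in> V" shows "x \<in> nsum V n \<Longrightarrow> - x \<in> nsum V n"
proof (induction n arbitrary: x)
  case (Suc n)
  then obtain z v where zv: "z \<in> nsum V n" "v \<in> V" "x = z + v" by (elim nsum_SucE)
  have "- z + - v \<in> nsum V (Suc n)" by (rule nsum_SucI[OF Suc.IH[OF zv(1)] assms[OF zv(2)]])
  then show ?case by (simp only: zv(3) minus_add_distrib)
qed simp

lemma nsum_mono: assumes "0 \<in> V" "a \<le> b" shows "nsum V a \<subseteq> nsum V b"
proof (rule lift_Suc_mono_le[OF _ assms(2)])
  fix n show "nsum V n \<subseteq> nsum V (Suc n)"
  proof
    fix x assume "x \<in> nsum V n"
    from nsum_SucI[OF this assms(1)] show "x \<in> nsum V (Suc n)" by (simp only: add_0_right)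
  qed
qed

definition span_nsum :: "'a::ab_group_add set \<Rightarrow> 'a set" where
  "span_nsum V = (\<Union>n. nsum (V \<union> uminus ` V) n)"

lemma span_nsum_zero: "0 \<in> span_nsum V"
  unfolding span_nsum_def by (rule UN_I[of 0]) simp_all

lemma span_nsum_add: "x \<in> span_nsum V \<Longrightarrow> y \<in> span_nsum V \<Longrightarrow> x + y \<in> span_nsum V"
  unfolding span_nsum_def using nsum_add by blast

lemma span_nsum_uminus: "x \<in> span_nsum V \<Longrightarrow> - x \<in> span_nsum V"
  unfolding span_nsum_def using nsum_uminus[of "V \<union> uminus ` V"] by fastforce

lemma span_nsum_superset: "V \<subseteq> span_nsum V"
proof
  fix x assume "x \<in> V"
  then have "0 + x \<in> nsum (V \<union> uminus ` V) (Suc 0)" by (intro nsum_SucI) auto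
  then show "x \<in> span_nsum V" unfolding span_nsum_def add_0_left by (rule UN_I[OF UNIV_I])
qed

lemma span_nsum_subset:
  assumes "V \<subseteq> S" "0 \<in> S" "\<And>x y. x \<in> S \<Longrightarrow> y \<in> S \<Longrightarrow> x + y \<in> S" "\<And>x. x \<in> S \<Longrightarrow> - x \<in> S"
  shows "span_nsum V \<subseteq> S"
proof -
  have "x \<in> nsum (V \<union> uminus ` V) n \<Longrightarrow> x \<in> S" for x n
  proof (induction n arbitrary: x)
    case (Suc n)
    then obtain z v where "z \<in> nsum (V \<union> uminus ` V) n" "v \<in> V \<union> uminus ` V" "x = z + v" by (elim nsum_SucE)
    then show ?case using Suc.IH assms by blast
  qed (simp add: assms)
  then show ?thesis unfolding span_nsum_def by blast
qed

definition chain_connected :: "'a::ab_group_add set set \<Rightarrow> 'a set \<Rightarrow> bool" where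
  "chain_connected N V \<longleftrightarrow> (\<forall>S. \<forall>W\<in>N. 0 \<in> S \<longrightarrow> (\<forall>s\<in>S. \<forall>w\<in>W. s + w \<in> V \<longrightarrow> s + w \<in> S) \<longrightarrow> V \<subseteq> S)"

lemma chain_connectedD:
  assumes "chain_connected N V" "W \<in> N" "0 \<in> S" "\<And>s w. s \<in> S \<Longrightarrow> w \<in> W \<Longrightarrow> s + w \<in> V \<Longrightarrow> s + w \<in> S"
  shows "V \<subseteq> S"
proof -
  have "\<forall>W\<in>N. 0 \<in> S \<longrightarrow> (\<forall>s\<in>S. \<forall>w\<in>W. s + w \<in> V \<longrightarrow> s + w \<in> S) \<longrightarrow> V \<subseteq> S"
    using assms(1) unfolding chain_connected_def by (rule spec)
  then have "0 \<in> S \<longrightarrow> (\<forall>s\<in>S. \<forall>w\<in>W. s + w \<in> V \<longrightarrow> s + w \<in> S) \<longrightarrow> V \<subseteq> S"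
    using assms(2) by (rule bspec)
  then show ?thesis using assms(3,4) by simp
qed

context precompact_nbhds
begin

lemma chain_connected_span:
  assumes "chain_connected N V" "W \<in> N" "W \<subseteq> V'"
  shows "V \<subseteq> span_nsum V'"
  by (rule chain_connectedD[OF assms(1,2)])
    (use assms(3) span_nsum_zero span_nsum_add span_nsum_superset in blast)+

lemma nbhds_halving:
  assumes half: "\<And>U. U \<in> N \<Longrightarrow> \<exists>V\<in>N. \<forall>x. x + x \<in> V \<longrightarrow> x \<in> U" and U: "U \<in> N"
  shows "\<exists>W\<in>N. \<forall>z. zmul (2 ^ s) z \<in> W \<longrightarrow> (\<forall>j\<le>s. zmul (2 ^ j) z \<in> U)"
  using U
proof (induction s arbitrary: U)
  case 0
  then show ?case by (intro bexI[of _ U]) (auto simp: zmul_one)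
next
  case (Suc s)
  obtain V where V: "V \<in> N" "\<And>x. x + x \<in> V \<Longrightarrow> x \<in> U" using half[OF Suc.prems] by blast
  obtain V' where V': "V' \<in> N" "V' \<subseteq> V" "V' \<subseteq> U" using nbhds_Int[OF N V(1) Suc.prems] .
  obtain W where W: "W \<in> N" "\<And>z j. zmul (2 ^ s) z \<in> W \<Longrightarrow> j \<le> s \<Longrightarrow> zmul (2 ^ j) z \<in> V'"
    using Suc.IH[OF V'(1)] by blast
  have dbl: "zmul (2 ^ i) (z + z) = zmul (2 ^ Suc i) z" for i z
    using zmul_zmul[of "2 ^ i" 2 z] by (simp add: zmul_two mult.commute)
  have "zmul (2 ^ j) z \<in> U" if z: "zmul (2 ^ Suc s) z \<in> W" and j: "j \<le> Suc s" for z j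
  proof -
    have zz: "zmul (2 ^ s) (z + z) \<in> W" using z by (simp only: dbl)
    show ?thesis
    proof (cases j)
      case 0
      have "z + z \<in> V'" using W(2)[OF zz, of 0] by (simp add: zmul_one)
      then show ?thesis using V V'(2) 0 by (auto simp: zmul_one)
    next
      case (Suc i)
      then have "zmul (2 ^ i) (z + z) \<in> V'" using W(2)[OF zz] j by simp
      then show ?thesis using V'(3) unfolding dbl Suc by blast
    qed
  qed
  then show ?case using W(1) by blast
qed

theorem chain_connected_imp_discrete:
  assumes half: "\<And>U. U \<in> N \<Longrightarrow> \<exists>V\<in>N. \<forall>x. x + x \<in> V \<longrightarrow> x \<in> U"
    and conn: "\<And>U. U \<in> N \<Longrightarrow> \<exists>V. V \<subseteq> U \<and> chain_connected N V \<and> (\<exists>W\<in>N. W \<subseteq> V)"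
  shows "\<exists>U\<in>N. U \<subseteq> \<Inter>N"
proof (rule ccontr)
  assume nd: "\<not> ?thesis"
  obtain U\<^sub>0 where "U\<^sub>0 \<in> N" using N unfolding group_nbhds_def by blast
  then obtain V\<^sub>0 W\<^sub>0 where V\<^sub>0: "chain_connected N V\<^sub>0" "W\<^sub>0 \<in> N" "W\<^sub>0 \<subseteq> V\<^sub>0" using conn by blast
  define C where "C = span_nsum V\<^sub>0"
  have C: "0 \<in> C" "\<And>x y. x \<in> C \<Longrightarrow> y \<in> C \<Longrightarrow> x + y \<in> C" "\<And>x. x \<in> C \<Longrightarrow> - x \<in> C"
    unfolding C_def by (fact span_nsum_zero span_nsum_add span_nsum_uminus)+
  have C_diff: "x - y \<in> C" if "x \<in> C" "y \<in> C" for x y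
    using C(2)[OF that(1) C(3)[OF that(2)]] by simp
  have W\<^sub>0C: "W\<^sub>0 \<subseteq> C" using V\<^sub>0(3) span_nsum_superset unfolding C_def by blast
  have C_eq: "V \<subseteq> C" "C = span_nsum V" if "chain_connected N V" "W \<in> N" "W \<subseteq> V" for V W
  proof -
    show VC: "V \<subseteq> C" unfolding C_def by (rule chain_connected_span[OF that(1) V\<^sub>0(2,3)])
    have "C \<subseteq> span_nsum V" unfolding C_def
      by (rule span_nsum_subset[OF chain_connected_span[OF V\<^sub>0(1) that(2,3)]])
        (fact span_nsum_zero span_nsum_add span_nsum_uminus)+
    moreover have "span_nsum V \<subseteq> C" by (rule span_nsum_subset[OF VC]) (fact C)+
    ultimately show "C = span_nsum V" by blast
  qed
  text \<open>A norm vanishing on doubles has no values strictly between 0 and 2.\<close>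
  have dense2: "\<exists>y\<in>C. x - (y + y) \<in> U" if x: "x \<in> C" and U: "U \<in> N" for x U
  proof (rule ccontr)
    assume no: "\<not> ?thesis"
    let ?H = "{y + y | y. y \<in> C}"
    have H: "0 \<in> ?H" "\<And>x y. x \<in> ?H \<Longrightarrow> y \<in> ?H \<Longrightarrow> x + y \<in> ?H" "\<And>x. x \<in> ?H \<Longrightarrow> - x \<in> ?H" "?H \<subseteq> C"
    proof -
      show "0 \<in> ?H" using C(1) by (intro CollectI exI[of _ 0]) simp
      show "x + y \<in> ?H" if xy: "x \<in> ?H" "y \<in> ?H" for x y
      proof -
        obtain a b where ab: "a \<in> C" "b \<in> C" "x = a + a" "y = b + b" using xy by blast
        then have "x + y = (a + b) + (a + b)" by (simp add: algebra_simps)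
        then show ?thesis using C(2)[OF ab(1,2)] by blast
      qed
      show "- x \<in> ?H" if x: "x \<in> ?H" for x
      proof -
        obtain a where a: "a \<in> C" "x = a + a" using x by blast
        then have "- x = - a + - a" by simp
        then show ?thesis using C(3)[OF a(1)] by blast
      qed
      show "?H \<subseteq> C" using C(2) by blast
    qed
    have sep: "x - h \<notin> U" if "h \<in> ?H" for h using no that by blast
    have "\<exists>\<rho> :: 'a \<Rightarrow> real. (\<forall>x. 0 \<le> \<rho> x) \<and> (\<forall>x. \<rho> (- x) = \<rho> x) \<and> (\<forall>x y. \<rho> (x + y) \<le> \<rho> x + \<rho> y) \<and>
      (\<forall>e>0. \<exists>U\<in>N. \<forall>u\<in>U. \<rho> u \<le> e) \<and> (\<forall>x. (\<rho> x)\<^sup>2 * (4 - (\<rho> x)\<^sup>2) \<le> (\<rho> (x + x))\<^sup>2) \<and> (\<forall>h\<in>?H. \<rho> h = 0) \<and>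
      (\<exists>x\<in>C. \<rho> x \<noteq> 0)"
      by (rule ex_doubling_norm) (fact C V\<^sub>0(2) W\<^sub>0C H x U sep)+
    then obtain \<rho> :: "'a \<Rightarrow> real" where \<rho>': "\<forall>x. 0 \<le> \<rho> x" "\<forall>x. \<rho> (- x) = \<rho> x" "\<forall>x y. \<rho> (x + y) \<le> \<rho> x + \<rho> y"
      "\<forall>e>0. \<exists>U\<in>N. \<forall>u\<in>U. \<rho> u \<le> e" "\<forall>x. (\<rho> x)\<^sup>2 * (4 - (\<rho> x)\<^sup>2) \<le> (\<rho> (x + x))\<^sup>2" "\<forall>h\<in>?H. \<rho> h = 0"
      "\<exists>x\<in>C. \<rho> x \<noteq> 0"
      by (elim exE conjE) (rule that)
    note \<rho> = \<rho>'(1-5)[rule_format]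
    obtain U1 where U1: "U1 \<in> N" "\<And>u. u \<in> U1 \<Longrightarrow> \<rho> u \<le> 1" using \<rho>(4)[of 1] by auto
    obtain V W where V: "V \<subseteq> U1" "chain_connected N V" "W \<in> N" "W \<subseteq> V" using conn[OF U1(1)] by blast
    have zero: "\<rho> v = 0" if "v \<in> V" for v
    proof -
      have "v \<in> C" using C_eq(1)[OF V(2-4)] that by blast
      then have "\<rho> (v + v) = 0" using \<rho>'(6) by blast
      then have "(\<rho> v)\<^sup>2 * (4 - (\<rho> v)\<^sup>2) \<le> 0" using \<rho>(5)[of v] by simp
      moreover have "(\<rho> v)\<^sup>2 \<le> 1" using U1(2)[of v] \<rho>(1)[of v] V(1) that by (intro power_le_one) auto
      ultimately show ?thesis by (simp add: mult_le_0_iff)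
    qed
    have "C \<subseteq> {x. \<rho> x = 0}"
      unfolding C_eq(2)[OF V(2-4)]
    proof (rule span_nsum_subset)
      show "0 \<in> {x. \<rho> x = 0}" using \<rho>'(6) H(1) by blast
      show "x + y \<in> {x. \<rho> x = 0}" if "x \<in> {x. \<rho> x = 0}" "y \<in> {x. \<rho> x = 0}" for x y
        using that \<rho>(3)[of x y] \<rho>(1)[of "x + y"] by simp
    qed (use zero \<rho>(2) in auto)
    then show False using \<rho>'(7) by blast
  qed
  have dense: "\<forall>x\<in>C. \<forall>U\<in>N. \<exists>y\<in>C. x - zmul (2 ^ s) y \<in> U" for s
  proof (induction s)
    case 0
    show ?case using nbhds_zero[OF N] by (auto simp: zmul_one intro!: bexI)
  next
    case (Suc s)
    show ?case
    proof (intro ballI)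
      fix x U assume x: "x \<in> C" and U: "U \<in> N"
      obtain V where V: "V \<in> N" "\<And>x y. x \<in> V \<Longrightarrow> y \<in> V \<Longrightarrow> x + y \<in> U" using nbhds_add[OF N U] by metis
      obtain V' where V': "V' \<in> N" "\<And>x. x \<in> V' \<Longrightarrow> zmul (2 ^ s) x \<in> V"
        using nbhds_zmul[OF N V(1), where k = "2 ^ s"] by metis
      obtain y where y: "y \<in> C" "x - zmul (2 ^ s) y \<in> V" using Suc x V(1) by blast
      obtain z where z: "z \<in> C" "y - (z + z) \<in> V'" using dense2[OF y(1) V'(1)] by blast
      have "(x - zmul (2 ^ s) y) + zmul (2 ^ s) (y - (z + z)) \<in> U" by (intro V(2) V'(2) y z)
      also have "(x - zmul (2 ^ s) y) + zmul (2 ^ s) (y - (z + z)) = x - zmul (2 ^ s) (zmul 2 z)"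
        by (simp add: zmul.scale_right_diff_distrib zmul_two)
      also have "\<dots> = x - zmul (2 ^ Suc s) z" by (simp add: mult.commute)
      finally show "\<exists>y\<in>C. x - zmul (2 ^ Suc s) y \<in> U" using z(1) by blast
    qed
  qed
  have "\<not> W\<^sub>0 \<subseteq> \<Inter>N" using nd V\<^sub>0(2) by blast
  then obtain x\<^sub>0 U where x\<^sub>0: "x\<^sub>0 \<in> W\<^sub>0" "U \<in> N" "x\<^sub>0 \<notin> U" by blast
  have "x\<^sub>0 \<in> C" using x\<^sub>0(1) W\<^sub>0C by blast
  have H0: "0 \<in> {0::'a}" "\<And>x y :: 'a. x \<in> {0} \<Longrightarrow> y \<in> {0} \<Longrightarrow> x + y \<in> {0}" "\<And>x :: 'a. x \<in> {0} \<Longrightarrow> - x \<in> {0}" "{0} \<subseteq> C"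
    using C(1) by auto
  have sep0: "x\<^sub>0 - h \<notin> U" if "h \<in> {0}" for h using x\<^sub>0(3) that by simp
  have "\<exists>\<rho> :: 'a \<Rightarrow> real. (\<forall>x. 0 \<le> \<rho> x) \<and> (\<forall>x. \<rho> (- x) = \<rho> x) \<and> (\<forall>x y. \<rho> (x + y) \<le> \<rho> x + \<rho> y) \<and>
    (\<forall>e>0. \<exists>U\<in>N. \<forall>u\<in>U. \<rho> u \<le> e) \<and> (\<forall>x. (\<rho> x)\<^sup>2 * (4 - (\<rho> x)\<^sup>2) \<le> (\<rho> (x + x))\<^sup>2) \<and> (\<forall>h\<in>{0}. \<rho> h = 0) \<and>
    (\<exists>x\<in>C. \<rho> x \<noteq> 0)"
    by (rule ex_doubling_norm) (fact C V\<^sub>0(2) W\<^sub>0C H0 \<open>x\<^sub>0 \<in> C\<close> x\<^sub>0(2) sep0)+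
  then obtain \<rho> :: "'a \<Rightarrow> real" where \<rho>': "\<forall>x. 0 \<le> \<rho> x" "\<forall>x. \<rho> (- x) = \<rho> x" "\<forall>x y. \<rho> (x + y) \<le> \<rho> x + \<rho> y"
    "\<forall>e>0. \<exists>U\<in>N. \<forall>u\<in>U. \<rho> u \<le> e" "\<forall>x. (\<rho> x)\<^sup>2 * (4 - (\<rho> x)\<^sup>2) \<le> (\<rho> (x + x))\<^sup>2" "\<forall>h\<in>{0}. \<rho> h = 0"
    "\<exists>x\<in>C. \<rho> x \<noteq> 0"
    by (elim exE conjE) (rule that)
  note \<rho> = \<rho>'(1-5)[rule_format]
  have \<rho>_half: "\<rho> x \<le> (2 / 3) * \<rho> (x + x)" if "\<rho> x \<le> 1" for x
  proof -
    have "(\<rho> x)\<^sup>2 \<le> 1" using that \<rho>(1)[of x] by (intro power_le_one) auto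
    then have "(\<rho> x)\<^sup>2 * (9 / 4) \<le> (\<rho> x)\<^sup>2 * (4 - (\<rho> x)\<^sup>2)" by (intro mult_left_mono) auto
    then have "((3 / 2) * \<rho> x)\<^sup>2 \<le> (\<rho> (x + x))\<^sup>2" using \<rho>(5)[of x] by (simp add: power_mult_distrib power2_eq_square)
    then have "(3 / 2) * \<rho> x \<le> \<rho> (x + x)" by (rule power2_le_imp_le) (rule \<rho>(1))
    then show ?thesis by simp
  qed
  have dbl: "zmul (2 ^ Suc j) y = zmul (2 ^ j) y + zmul (2 ^ j) y" for j and y :: 'a
    by (simp only: zmul_add_left mult_2 power_Suc)
  have shrink: "\<rho> (zmul (2 ^ j) y) \<le> (2 / 3) ^ (s - j) * (1 / 4)"
    if y: "\<And>j. j \<le> s \<Longrightarrow> \<rho> (zmul (2 ^ j) y) \<le> 1" "\<rho> (zmul (2 ^ s) y) \<le> 1 / 4" and j: "j \<le> s" for y s j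
    using j
  proof (induction j rule: inc_induct)
    case base
    then show ?case using y(2) by simp
  next
    case (step j)
    have "\<rho> (zmul (2 ^ j) y) \<le> (2 / 3) * \<rho> (zmul (2 ^ Suc j) y)"
      unfolding dbl using step by (intro \<rho>_half y(1)) simp
    also have "\<dots> \<le> (2 / 3) * ((2 / 3) ^ (s - Suc j) * (1 / 4))" by (intro mult_left_mono step.IH) simp
    also have "\<dots> = (2 / 3) ^ (s - j) * (1 / 4)" using step.hyps by (simp add: Suc_diff_Suc[symmetric])
    finally show ?case .
  qed
  obtain U8 where U8: "U8 \<in> N" "\<And>u. u \<in> U8 \<Longrightarrow> \<rho> u \<le> 1 / 8" using \<rho>(4)[of "1 / 8"] by auto
  obtain U2 where U2: "U2 \<in> N" "\<And>u. u \<in> U2 \<Longrightarrow> \<rho> u \<le> 1 / 2" using \<rho>(4)[of "1 / 2"] by auto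
  obtain V W where V: "V \<subseteq> U8" "chain_connected N V" "W \<in> N" "W \<subseteq> V" using conn[OF U8(1)] by blast
  note VC = C_eq(1)[OF V(2-4)] and C_span = C_eq(2)[OF V(2-4)]
  let ?V = "V \<union> uminus ` V"
  have V0: "0 \<in> V" using V(3,4) nbhds_zero[OF N] by blast
  have local_bound: "\<exists>A\<in>N. \<forall>v\<in>?V. \<forall>y\<in>C. zmul (2 ^ s) y - v \<in> A \<longrightarrow> \<rho> y \<le> (2 / 3) ^ s * (1 / 4)" for s
  proof -
    obtain W1 where W1: "W1 \<in> N" "\<And>z j. zmul (2 ^ s) z \<in> W1 \<Longrightarrow> j \<le> s \<Longrightarrow> zmul (2 ^ j) z \<in> U2"
      using nbhds_halving[OF half U2(1), of s] by blast
    obtain A' where A': "A' \<in> N" "A' \<subseteq> W1" "\<And>x y z w. x \<in> A' \<Longrightarrow> y \<in> A' \<Longrightarrow> z \<in> A' \<Longrightarrow> w \<in> A' \<Longrightarrow> x + y + (z + w) \<in> W1"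
      using nbhds_add4[OF N W1(1)] by metis
    obtain A where A: "A \<in> N" "A \<subseteq> A'" "A \<subseteq> U8" using nbhds_Int[OF N A'(1) U8(1)] .
    define good where "good y \<longleftrightarrow> (\<forall>j\<le>s. \<rho> (zmul (2 ^ j) y) \<le> 1 / 4)" for y
    have end_le: "\<rho> (zmul (2 ^ s) y) \<le> 1 / 4" if "v \<in> V" "zmul (2 ^ s) y - v \<in> A" for v y
    proof -
      have "\<rho> ((zmul (2 ^ s) y - v) + v) \<le> \<rho> (zmul (2 ^ s) y - v) + \<rho> v" by (rule \<rho>(3))
      also have "\<dots> \<le> 1 / 8 + 1 / 8" using that A(3) V(1) by (intro add_mono U8(2)) auto
      finally show ?thesis by simp
    qed
    have goodI: "good y" if "\<And>j. j \<le> s \<Longrightarrow> \<rho> (zmul (2 ^ j) y) \<le> 1" "\<rho> (zmul (2 ^ s) y) \<le> 1 / 4" for y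
      unfolding good_def
    proof (intro allI impI)
      fix j assume j: "j \<le> s"
      have "(2 / 3 :: real) ^ (s - j) * (1 / 4) \<le> 1 * (1 / 4)" by (intro mult_right_mono power_le_one) auto
      then show "\<rho> (zmul (2 ^ j) y) \<le> 1 / 4" using shrink[OF that j] by linarith
    qed
    have sub: "V \<subseteq> {v. v \<in> V \<and> (\<forall>y\<in>C. zmul (2 ^ s) y - v \<in> A \<longrightarrow> good y)}"
    proof (rule chain_connectedD[OF V(2) A(1)])
      show "0 \<in> {v. v \<in> V \<and> (\<forall>y\<in>C. zmul (2 ^ s) y - v \<in> A \<longrightarrow> good y)}"
      proof (intro CollectI conjI V0 ballI impI goodI)
        fix y assume y: "zmul (2 ^ s) y - 0 \<in> A"
        show "\<rho> (zmul (2 ^ s) y) \<le> 1 / 4" by (rule end_le[OF V0 y])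
        fix j assume "j \<le> s"
        then have "zmul (2 ^ j) y \<in> U2" using y A(2) A'(2) by (intro W1(2)) auto
        then have "\<rho> (zmul (2 ^ j) y) \<le> 1 / 2" by (rule U2(2))
        then show "\<rho> (zmul (2 ^ j) y) \<le> 1" by simp
      qed
      fix v w assume v: "v \<in> {v. v \<in> V \<and> (\<forall>y\<in>C. zmul (2 ^ s) y - v \<in> A \<longrightarrow> good y)}" and w: "w \<in> A" and vw: "v + w \<in> V"
      show "v + w \<in> {v. v \<in> V \<and> (\<forall>y\<in>C. zmul (2 ^ s) y - v \<in> A \<longrightarrow> good y)}"
      proof (intro CollectI conjI vw ballI impI)
        fix y' assume y': "y' \<in> C" "zmul (2 ^ s) y' - (v + w) \<in> A"
        have "v \<in> C" using v VC by blast
        then obtain y where y: "y \<in> C" "v - zmul (2 ^ s) y \<in> A" using dense A(1) by blast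
        have "zmul (2 ^ s) y - v \<in> A" using nbhds_uminus[OF N A(1) y(2)] by simp
        then have gy: "good y" using v y(1) by blast
        have "(zmul (2 ^ s) y' - (v + w)) + w + ((v - zmul (2 ^ s) y) + 0) \<in> W1"
          using A(2) y'(2) w y(2) nbhds_zero[OF N A(1)] by (intro A'(3)) auto
        also have "(zmul (2 ^ s) y' - (v + w)) + w + ((v - zmul (2 ^ s) y) + 0) = zmul (2 ^ s) (y' - y)"
          by (simp add: zmul.scale_right_diff_distrib)
        finally have mem: "zmul (2 ^ s) (y' - y) \<in> W1" .
        show "good y'"
        proof (rule goodI)
          show "\<rho> (zmul (2 ^ s) y') \<le> 1 / 4" by (rule end_le[OF vw y'(2)])
          fix j assume j: "j \<le> s"
          have "\<rho> (zmul (2 ^ j) (y' - y) + zmul (2 ^ j) y) \<le> \<rho> (zmul (2 ^ j) (y' - y)) + \<rho> (zmul (2 ^ j) y)"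
            by (rule \<rho>(3))
          moreover have "\<rho> (zmul (2 ^ j) (y' - y)) \<le> 1 / 2" by (rule U2(2)[OF W1(2)[OF mem j]])
          moreover have "\<rho> (zmul (2 ^ j) y) \<le> 1 / 4" using gy j unfolding good_def by blast
          ultimately show "\<rho> (zmul (2 ^ j) y') \<le> 1" by (simp add: zmul.scale_right_diff_distrib)
        qed
      qed
    qed
    have V_good: "good y" if "v \<in> V" "y \<in> C" "zmul (2 ^ s) y - v \<in> A" for v y
      using subsetD[OF sub that(1)] that(2,3) by simp
    have V_bound: "\<rho> y \<le> (2 / 3) ^ s * (1 / 4)" if vy: "v \<in> V" "y \<in> C" "zmul (2 ^ s) y - v \<in> A" for v y
    proof -
      have "\<rho> (zmul (2 ^ j) y) \<le> 1" if "j \<le> s" for j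
      proof -
        have "\<rho> (zmul (2 ^ j) y) \<le> 1 / 4" using V_good[OF vy] that unfolding good_def by blast
        then show ?thesis by simp
      qed
      from shrink[OF this end_le[OF vy(1,3)], of 0] show ?thesis by (simp add: zmul_one)
    qed
    have "\<rho> y \<le> (2 / 3) ^ s * (1 / 4)" if v: "v \<in> ?V" and y: "y \<in> C" "zmul (2 ^ s) y - v \<in> A" for v y
    proof (cases "v \<in> V")
      case False
      then obtain v' where v': "v' \<in> V" "v = - v'" using v by blast
      have "- (zmul (2 ^ s) y - v) \<in> A" by (rule nbhds_uminus[OF N A(1) y(2)])
      then have "zmul (2 ^ s) (- y) - v' \<in> A" by (simp add: v'(2))
      then have "\<rho> (- y) \<le> (2 / 3) ^ s * (1 / 4)" by (rule V_bound[OF v'(1) C(3)[OF y(1)]])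
      then show ?thesis by (simp only: \<rho>(2))
    qed (rule V_bound[OF _ y])
    then show ?thesis using A(1) by blast
  qed
  have nsum_bound: "\<exists>A\<in>N. \<forall>z\<in>nsum ?V n. \<forall>x\<in>C. zmul (2 ^ s) x - z \<in> A \<longrightarrow> \<rho> x \<le> (real n + 1) * ((2 / 3) ^ s * (1 / 4))" for n s
  proof -
    obtain A\<^sub>1 where A\<^sub>1: "A\<^sub>1 \<in> N" "\<And>v y. v \<in> ?V \<Longrightarrow> y \<in> C \<Longrightarrow> zmul (2 ^ s) y - v \<in> A\<^sub>1 \<Longrightarrow> \<rho> y \<le> (2 / 3) ^ s * (1 / 4)"
      using local_bound[of s] by blast
    show ?thesis
    proof (induction n)
      case 0
      have "\<rho> x \<le> (2 / 3) ^ s * (1 / 4)" if "x \<in> C" "zmul (2 ^ s) x - 0 \<in> A\<^sub>1" for x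
        using A\<^sub>1(2)[of 0 x] that V0 by blast
      then show ?case using A\<^sub>1(1) by (intro bexI[of _ A\<^sub>1]) auto
    next
      case (Suc n)
      then obtain A where A: "A \<in> N" "\<And>z x. z \<in> nsum ?V n \<Longrightarrow> x \<in> C \<Longrightarrow> zmul (2 ^ s) x - z \<in> A \<Longrightarrow> \<rho> x \<le> (real n + 1) * ((2 / 3) ^ s * (1 / 4))"
        by blast
      obtain B where B: "B \<in> N" "\<And>x y. x \<in> B \<Longrightarrow> y \<in> B \<Longrightarrow> x - y \<in> A" using nbhds_add[OF N A(1)] by metis
      obtain B' where B': "B' \<in> N" "B' \<subseteq> B" "B' \<subseteq> A\<^sub>1" using nbhds_Int[OF N B(1) A\<^sub>1(1)] .
      have "\<rho> x \<le> (real (Suc n) + 1) * ((2 / 3) ^ s * (1 / 4))" if z: "z \<in> nsum ?V (Suc n)" and x: "x \<in> C" "zmul (2 ^ s) x - z \<in> B'" for z x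
      proof -
        obtain z' v where z': "z' \<in> nsum ?V n" "v \<in> ?V" "z = z' + v" using z by (rule nsum_SucE) (rule that)
        have "v \<in> C" using z'(2) VC C(3) by blast
        then obtain y where y: "y \<in> C" "v - zmul (2 ^ s) y \<in> B'" using dense B'(1) by blast
        have yv: "zmul (2 ^ s) y - v \<in> B'" using nbhds_uminus[OF N B'(1) y(2)] by simp
        have "(zmul (2 ^ s) x - z) - (zmul (2 ^ s) y - v) \<in> A" using B'(2) x(2) yv by (intro B(2)) auto
        also have "(zmul (2 ^ s) x - z) - (zmul (2 ^ s) y - v) = zmul (2 ^ s) (x - y) - z'"
          by (simp add: z'(3) zmul.scale_right_diff_distrib algebra_simps)
        finally have "\<rho> (x - y) \<le> (real n + 1) * ((2 / 3) ^ s * (1 / 4))" by (rule A(2)[OF z'(1) C_diff[OF x(1) y(1)]])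
        moreover have "\<rho> y \<le> (2 / 3) ^ s * (1 / 4)" using A\<^sub>1(2)[OF z'(2) y(1)] yv B'(3) by blast
        moreover have "\<rho> x \<le> \<rho> (x - y) + \<rho> y" using \<rho>(3)[of "x - y" y] by simp
        ultimately have "\<rho> x \<le> (real n + 1) * ((2 / 3) ^ s * (1 / 4)) + (2 / 3) ^ s * (1 / 4)" by linarith
        also have "\<dots> = (real (Suc n) + 1) * ((2 / 3) ^ s * (1 / 4))" by (simp only: of_nat_Suc distrib_right)
        finally show ?thesis .
      qed
      then show ?case using B'(1) by blast
    qed
  qed
  obtain M where M: "C \<subseteq> nsum ?V M"
  proof -
    obtain F where F: "finite F" "\<And>x. \<exists>f\<in>F. x - f \<in> W" using big[OF V(3)] by (rule bigE) (rule that)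
    have "\<forall>f\<in>F \<inter> C. \<exists>k. f \<in> nsum ?V k" using C_span unfolding span_nsum_def by blast
    then obtain k where k: "\<And>f. f \<in> F \<inter> C \<Longrightarrow> f \<in> nsum ?V (k f)" by metis
    define K where "K = Max (insert 0 (k ` (F \<inter> C)))"
    have K: "k f \<le> K" if "f \<in> F \<inter> C" for f unfolding K_def using that F(1) by (intro Max_ge) auto
    have "x \<in> nsum ?V (Suc K)" if x: "x \<in> C" for x
    proof -
      obtain f where f: "f \<in> F" "x - f \<in> W" using F(2) by blast
      have xf: "x - f \<in> V" using f(2) V(4) by blast
      then have "x - (x - f) \<in> C" using C_diff[OF x] VC by blast
      then have "f \<in> F \<inter> C" using f(1) by simp
      then have "f \<in> nsum ?V K" using k K nsum_mono[of ?V "k f" K] V0 by blast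
      then have "f + (x - f) \<in> nsum ?V (Suc K)" by (rule nsum_SucI) (use xf in blast)
      then show ?thesis by (simp only: add_diff_cancel_left' diff_add_cancel add.commute[of f])
    qed
    then show ?thesis using that by blast
  qed
  have C_zmul: "zmul (2 ^ s) x \<in> C" if "x \<in> C" for s x
  proof (induction s)
    case (Suc s)
    then show ?case unfolding dbl by (intro C(2))
  qed (simp add: that zmul_one)
  have "\<rho> x = 0" if x: "x \<in> C" for x
  proof (rule ccontr)
    assume "\<rho> x \<noteq> 0"
    then have pos: "\<rho> x / (real M + 1) > 0" using \<rho>(1)[of x] by simp
    obtain s where s: "(2 / 3) ^ s < \<rho> x / (real M + 1)" using real_arch_pow_inv[OF pos, of "2 / 3"] by auto
    obtain A where A: "A \<in> N" "\<And>z x. z \<in> nsum ?V M \<Longrightarrow> x \<in> C \<Longrightarrow> zmul (2 ^ s) x - z \<in> A \<Longrightarrow> \<rho> x \<le> (real M + 1) * ((2 / 3) ^ s * (1 / 4))"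
      using nsum_bound[of M s] by blast
    have "\<rho> x \<le> (real M + 1) * ((2 / 3) ^ s * (1 / 4))"
      using A(2)[of "zmul (2 ^ s) x" x] M C_zmul[OF x] x nbhds_zero[OF N A(1)] by auto
    moreover have "(real M + 1) * (2 / 3) ^ s < \<rho> x" using s by (simp add: field_simps)
    moreover have "(real M + 1) * ((2 / 3) ^ s * (1 / 4)) \<le> (real M + 1) * (2 / 3) ^ s" by (intro mult_left_mono) auto
    ultimately show False by linarith
  qed
  then show False using \<rho>'(7) by blast
qed

end

section \<open>Topological groups as quotients of free Abelian groups\<close>

lemma hom_zmul:
  assumes G: "group G" and \<pi>: "\<And>x. \<pi> x \<in> carrier G" "\<And>x y. \<pi> (x + y) = \<pi> x \<otimes>\<^bsub>G\<^esub> \<pi> y" "\<pi> 0 = \<one>\<^bsub>G\<^esub>"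
  shows "\<pi> (zmul (int n) x) = \<pi> x [^]\<^bsub>G\<^esub> n"
proof -
  interpret group G by (rule G)
  show ?thesis
  proof (induction n)
    case (Suc n)
    have "zmul (int (Suc n)) x = zmul (int n) x + x" using zmul_plus1[of "int n" x] by (simp add: add.commute)
    then show ?case using Suc by (simp add: \<pi>)
  qed (simp add: \<pi>)
qed

text \<open>A free Abelian group mapping onto \<open>G\<close> carries the additive type class, so the neighbourhoods of \<open>G\<close> are pulled
  back along \<open>\<pi>\<close>; they are Hausdorff only modulo the kernel, which is why kernels appear as \<open>\<Inter>N\<close> above.\<close>
locale hausdorff_abelian_cover =
  comm_group G for G :: "('a, 'm) monoid_scheme" (structure) +
  fixes T :: "'a topology" and \<pi> :: "'g::ab_group_add \<Rightarrow> 'a"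
  assumes T: "hausdorff_topological_group G T"
    and \<pi>_in [simp]: "\<pi> x \<in> carrier G" and \<pi>_add: "\<pi> (x + y) = \<pi> x \<otimes>\<^bsub>G\<^esub> \<pi> y"
    and \<pi>_surj: "g \<in> carrier G \<Longrightarrow> \<exists>x. \<pi> x = g"
begin

lemma topspace_T [simp]: "topspace T = carrier G" and haus: "Hausdorff_space T"
  and mult_cont: "continuous_map (prod_topology T T) T (\<lambda>(x, y). x \<otimes> y)"
  and inv_cont: "continuous_map T T (\<lambda>x. inv x)"
  using T by (auto simp: hausdorff_topological_group_def)

lemma \<pi>_zero [simp]: "\<pi> 0 = \<one>"
  using \<pi>_add[of 0 0] by (simp add: r_cancel_one')

lemma \<pi>_uminus: "\<pi> (- x) = inv \<pi> x"
  using \<pi>_add[of "- x" x] by (simp add: inv_equality[symmetric])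

lemma \<pi>_diff: "\<pi> (x - y) = \<pi> x \<otimes> inv \<pi> y"
  using \<pi>_add[of x "- y"] by (simp add: \<pi>_uminus)

definition sym_nbhds :: "'a set set" where
  "sym_nbhds = {U. openin T U \<and> \<one> \<in> U \<and> (\<forall>x\<in>U. inv x \<in> U)}"

definition cover_nbhds :: "'g set set" where
  "cover_nbhds = (\<lambda>U. {x. \<pi> x \<in> U}) ` sym_nbhds"

lemma nbhdsI: "U \<in> sym_nbhds \<Longrightarrow> {x. \<pi> x \<in> U} \<in> cover_nbhds"
  unfolding cover_nbhds_def by (rule imageI)

lemma nbhdsE: assumes "V \<in> cover_nbhds" obtains U where "U \<in> sym_nbhds" "V = {x. \<pi> x \<in> U}"
  using assms unfolding cover_nbhds_def by (elim imageE) (rule that)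

lemma sym_nbhds_below:
  assumes "openin T U" "\<one> \<in> U" obtains V where "V \<in> sym_nbhds" "V \<subseteq> U"
proof
  have sub: "U \<subseteq> carrier G" using openin_subset[OF assms(1)] by simp
  have "openin T {x \<in> topspace T. inv x \<in> U}" by (rule openin_continuous_map_preimage[OF inv_cont assms(1)])
  then have "openin T (U \<inter> {x \<in> carrier G. inv x \<in> U})" using assms(1) by (simp add: openin_Int)
  then show "U \<inter> {x \<in> carrier G. inv x \<in> U} \<in> sym_nbhds"
    using assms(2) sub by (auto simp: sym_nbhds_def)
  show "U \<inter> {x \<in> carrier G. inv x \<in> U} \<subseteq> U" by blast
qed

lemma cover_group_nbhds: "group_nbhds cover_nbhds"
  unfolding group_nbhds_def
proof (intro conjI ballI)
  have "openin T (carrier G)" using openin_topspace[of T] by simp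
  then have "carrier G \<in> sym_nbhds" by (simp add: sym_nbhds_def)
  then show "cover_nbhds \<noteq> {}" using nbhdsI by blast
  show "0 \<in> U" if "U \<in> cover_nbhds" for U using that by (auto simp: cover_nbhds_def sym_nbhds_def)
  show "- x \<in> U" if "U \<in> cover_nbhds" "x \<in> U" for U x using that by (auto simp: cover_nbhds_def sym_nbhds_def \<pi>_uminus)
  show "\<exists>W\<in>cover_nbhds. W \<subseteq> U \<inter> V" if UV: "U \<in> cover_nbhds" "V \<in> cover_nbhds" for U V
  proof -
    obtain U' where U': "U' \<in> sym_nbhds" "U = {x. \<pi> x \<in> U'}" using UV(1) by (rule nbhdsE)
    obtain V' where V': "V' \<in> sym_nbhds" "V = {x. \<pi> x \<in> V'}" using UV(2) by (rule nbhdsE)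
    have "U' \<inter> V' \<in> sym_nbhds" using U'(1) V'(1) by (auto simp: sym_nbhds_def)
    from nbhdsI[OF this] show ?thesis by (rule bexI[rotated]) (use U'(2) V'(2) in auto)
  qed
  show "\<exists>V\<in>cover_nbhds. \<forall>x\<in>V. \<forall>y\<in>V. x + y \<in> U" if U: "U \<in> cover_nbhds" for U
  proof -
    obtain U' where U': "U' \<in> sym_nbhds" "U = {x. \<pi> x \<in> U'}" using U by (rule nbhdsE)
    have "openin (prod_topology T T) {p \<in> topspace (prod_topology T T). (\<lambda>(x, y). x \<otimes> y) p \<in> U'}"
      using U'(1) by (intro openin_continuous_map_preimage[OF mult_cont]) (simp add: sym_nbhds_def)
    moreover have "(\<one>, \<one>) \<in> {p \<in> topspace (prod_topology T T). (\<lambda>(x, y). x \<otimes> y) p \<in> U'}"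
      using U'(1) by (simp add: sym_nbhds_def)
    ultimately obtain A B where AB: "openin T A" "openin T B" "\<one> \<in> A" "\<one> \<in> B"
      "A \<times> B \<subseteq> {p \<in> topspace (prod_topology T T). (\<lambda>(x, y). x \<otimes> y) p \<in> U'}"
      unfolding openin_prod_topology_alt by meson
    obtain V where V: "V \<in> sym_nbhds" "V \<subseteq> A \<inter> B" using sym_nbhds_below[of "A \<inter> B"] AB by (auto simp: openin_Int)
    have "\<pi> (x + y) \<in> U'" if "\<pi> x \<in> V" "\<pi> y \<in> V" for x y
      using subsetD[OF AB(5), of "(\<pi> x, \<pi> y)"] V(2) that by (auto simp: \<pi>_add)
    then show ?thesis using nbhdsI[OF V(1)] U'(2) by (intro bexI[of _ "{x. \<pi> x \<in> V}"]) auto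
  qed
qed

lemma Inter_nbhds: "\<Inter>cover_nbhds = {x. \<pi> x = \<one>}"
proof (intro equalityI subsetI)
  fix x assume x: "x \<in> {x. \<pi> x = \<one>}"
  show "x \<in> \<Inter>cover_nbhds"
  proof (rule InterI)
    fix V assume "V \<in> cover_nbhds"
    then obtain U where "U \<in> sym_nbhds" "V = {x. \<pi> x \<in> U}" by (rule nbhdsE)
    then show "x \<in> V" using x by (simp add: sym_nbhds_def)
  qed
next
  fix x assume x: "x \<in> \<Inter>cover_nbhds"
  have "\<pi> x = \<one>"
  proof (rule ccontr)
    assume "\<pi> x \<noteq> \<one>"
    then have "\<exists>A B. openin T A \<and> openin T B \<and> \<pi> x \<in> A \<and> \<one> \<in> B \<and> disjnt A B"
      using haus by (simp add: Hausdorff_space_def)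
    then obtain A B where AB: "openin T A" "openin T B" "\<pi> x \<in> A" "\<one> \<in> B" "disjnt A B"
      by (elim exE conjE) (rule that)
    obtain V where V: "V \<in> sym_nbhds" "V \<subseteq> B" using AB(2,4) by (rule sym_nbhds_below)
    have "x \<in> {x. \<pi> x \<in> V}" using x nbhdsI[OF V(1)] by (rule InterD)
    then show False using AB(3,5) V(2) by (auto simp: disjnt_def)
  qed
  then show "x \<in> {x. \<pi> x = \<one>}" by simp
qed

lemma open_translate:
  assumes "openin T U" "g \<in> carrier G" shows "openin T {h \<in> carrier G. inv g \<otimes> h \<in> U}"
proof -
  have "continuous_map T (prod_topology T T) (\<lambda>h. (inv g, h))"
    using assms(2) by (intro continuous_map_pairedI) (auto simp: continuous_map_const)
  then have "continuous_map T T ((\<lambda>(x, y). x \<otimes> y) \<circ> (\<lambda>h. (inv g, h)))"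
    by (rule continuous_map_compose[OF _ mult_cont])
  then have "openin T {h \<in> topspace T. ((\<lambda>(x, y). x \<otimes> y) \<circ> (\<lambda>h. (inv g, h))) h \<in> U}"
    by (rule openin_continuous_map_preimage[OF _ assms(1)])
  then show ?thesis by simp
qed

lemma nbhds_open:
  assumes Q: "Q \<subseteq> carrier G" and loc: "\<And>x. \<pi> x \<in> Q \<Longrightarrow> \<exists>V\<in>cover_nbhds. \<forall>v\<in>V. \<pi> (x + v) \<in> Q"
  shows "openin T Q"
proof (subst openin_subopen, rule ballI)
  fix g assume g: "g \<in> Q"
  then have gG: "g \<in> carrier G" using Q by blast
  obtain x where x: "\<pi> x = g" using \<pi>_surj[OF gG] by blast
  obtain V where V: "V \<in> cover_nbhds" "\<forall>v\<in>V. \<pi> (x + v) \<in> Q" using loc[of x] g x by blast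
  obtain U where U: "U \<in> sym_nbhds" "V = {x. \<pi> x \<in> U}" using V(1) by (rule nbhdsE)
  have "openin T {h \<in> carrier G. inv g \<otimes> h \<in> U}" using U(1) by (intro open_translate gG) (simp add: sym_nbhds_def)
  moreover have "g \<in> {h \<in> carrier G. inv g \<otimes> h \<in> U}" using U(1) gG by (simp add: sym_nbhds_def)
  moreover have "{h \<in> carrier G. inv g \<otimes> h \<in> U} \<subseteq> Q"
  proof
    fix h assume h: "h \<in> {h \<in> carrier G. inv g \<otimes> h \<in> U}"
    then obtain v where v: "\<pi> v = inv g \<otimes> h" using \<pi>_surj[of "inv g \<otimes> h"] gG by auto
    then have "\<pi> (x + v) \<in> Q" using V(2) U(2) h by simp
    moreover have "\<pi> (x + v) = h" using h gG by (simp add: \<pi>_add x v m_assoc[symmetric])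
    ultimately show "h \<in> Q" by simp
  qed
  ultimately show "\<exists>A. openin T A \<and> g \<in> A \<and> A \<subseteq> Q" by blast
qed

lemma minimal_nbhds_nbhds:
  assumes min: "minimal_topological_group G T"
  shows "minimal_nbhds cover_nbhds"
  unfolding minimal_nbhds_def
proof (intro conjI allI impI cover_group_nbhds)
  fix M :: "'g set set" assume "group_nbhds M \<and> (\<forall>V\<in>M. \<exists>U\<in>cover_nbhds. U \<subseteq> V) \<and> \<Inter>M \<subseteq> \<Inter>cover_nbhds"
  then have M: "group_nbhds M" and coarser: "\<And>V. V \<in> M \<Longrightarrow> \<exists>U\<in>cover_nbhds. U \<subseteq> V" and ker: "\<Inter>M \<subseteq> \<Inter>cover_nbhds" by simp_all
  have kerM: "k \<in> V" if k: "\<pi> k = \<one>" "V \<in> M" for k V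
  proof -
    obtain U where "U \<in> cover_nbhds" "U \<subseteq> V" using coarser[OF k(2)] by (rule bexE)
    moreover have "k \<in> \<Inter>cover_nbhds" unfolding Inter_nbhds using k(1) by simp
    ultimately show ?thesis by (meson InterD subsetD)
  qed
  define opn where "opn Q \<longleftrightarrow> Q \<subseteq> carrier G \<and> (\<forall>x. \<pi> x \<in> Q \<longrightarrow> (\<exists>V\<in>M. \<forall>v\<in>V. \<pi> (x + v) \<in> Q))" for Q
  have opnD: "\<exists>V\<in>M. \<forall>v\<in>V. \<pi> (x + v) \<in> Q" if "opn Q" "\<pi> x \<in> Q" for Q x
    using that by (simp add: opn_def)
  have opnI: "opn Q" if "Q \<subseteq> carrier G" "\<And>x. \<pi> x \<in> Q \<Longrightarrow> \<exists>V\<in>M. \<forall>v\<in>V. \<pi> (x + v) \<in> Q" for Q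
    using that by (simp add: opn_def)
  have opn_sub: "Q \<subseteq> carrier G" if "opn Q" for Q using that by (simp add: opn_def)
  have "istopology opn"
    unfolding istopology_def
  proof (intro conjI allI impI)
    fix A B assume A: "opn A" and B: "opn B"
    show "opn (A \<inter> B)"
    proof (rule opnI)
      show "A \<inter> B \<subseteq> carrier G" using opn_sub[OF A] by (rule le_infI1)
      fix x assume x: "\<pi> x \<in> A \<inter> B"
      obtain V where V: "V \<in> M" "\<forall>v\<in>V. \<pi> (x + v) \<in> A" using opnD[OF A IntD1[OF x]] by (rule bexE)
      obtain V' where V': "V' \<in> M" "\<forall>v\<in>V'. \<pi> (x + v) \<in> B" using opnD[OF B IntD2[OF x]] by (rule bexE)
      obtain W where "W \<in> M" "W \<subseteq> V" "W \<subseteq> V'" using nbhds_Int[OF M V(1) V'(1)] .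
      then show "\<exists>V\<in>M. \<forall>v\<in>V. \<pi> (x + v) \<in> A \<inter> B" using V(2) V'(2) by (intro bexI[of _ W]) auto
    qed
  next
    fix K assume K: "\<forall>A\<in>K. opn A"
    show "opn (\<Union>K)"
    proof (rule opnI)
      show "\<Union>K \<subseteq> carrier G" using K opn_sub by (intro Union_least) simp
      fix x assume "\<pi> x \<in> \<Union>K"
      then obtain A where A: "A \<in> K" "\<pi> x \<in> A" by (rule UnionE)
      obtain V where "V \<in> M" "\<forall>v\<in>V. \<pi> (x + v) \<in> A" using opnD[OF K[rule_format, OF A(1)] A(2)] by (rule bexE)
      then show "\<exists>V\<in>M. \<forall>v\<in>V. \<pi> (x + v) \<in> \<Union>K" using A(1) by (intro bexI[of _ V]) auto
    qed
  qed
  define S where "S = topology opn"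
  have S: "openin S Q \<longleftrightarrow> opn Q" for Q
    unfolding S_def using \<open>istopology opn\<close> by (simp add: topology_inverse')
  obtain V0 where V0: "V0 \<in> M" using M unfolding group_nbhds_def by (elim conjE) (metis ex_in_conv)
  have "opn (carrier G)" by (rule opnI) (use V0 in auto)
  then have "openin S (carrier G)" by (simp add: S)
  moreover have "topspace S \<subseteq> carrier G" using openin_topspace[of S] unfolding S by (rule opn_sub)
  ultimately have topS: "topspace S = carrier G" by (intro equalityI openin_subset)
  define I where "I V = {y. \<exists>V'\<in>M. \<forall>v\<in>V'. y + v \<in> V}" for V
  define B where "B x V = {\<pi> (x + y) | y. y \<in> I V}" for x V
  have I_E: "\<exists>V'\<in>M. \<forall>v\<in>V'. y + v \<in> V" if "y \<in> I V" for y V using that by (simp add: I_def)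
  have I_I: "y \<in> I V" if "V' \<in> M" "\<And>v. v \<in> V' \<Longrightarrow> y + v \<in> V" for y V V'
    unfolding I_def using that by (intro CollectI bexI[of _ V']) simp_all
  have B_I: "\<pi> (x + y) \<in> B x V" if "y \<in> I V" for x y V
    unfolding B_def using that by (intro CollectI exI[of _ y]) simp
  have B_E: "\<exists>y\<in>I V. g = \<pi> (x + y)" if "g \<in> B x V" for g x V
    using that by (auto simp: B_def)
  have I_sub: "y \<in> V" if y: "y \<in> I V" for y V
  proof -
    obtain V' where V': "V' \<in> M" "\<forall>v\<in>V'. y + v \<in> V" using I_E[OF y] by (rule bexE)
    have "y + 0 \<in> V" using V'(2) nbhds_zero[OF M V'(1)] by (rule bspec)
    then show ?thesis by simp
  qed
  have B_open: "openin S (B x V)" if "V \<in> M" for x V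
    unfolding S
  proof (rule opnI)
    show "B x V \<subseteq> carrier G" unfolding B_def by auto
    fix z assume z: "\<pi> z \<in> B x V"
    obtain y where y: "y \<in> I V" "\<pi> z = \<pi> (x + y)" using B_E[OF z] by (rule bexE)
    obtain V' where V': "V' \<in> M" "\<forall>v\<in>V'. y + v \<in> V" using I_E[OF y(1)] by (rule bexE)
    obtain W where W: "W \<in> M" "\<And>x y z w. x \<in> W \<Longrightarrow> y \<in> W \<Longrightarrow> z \<in> W \<Longrightarrow> w \<in> W \<Longrightarrow> x + y + (z + w) \<in> V'"
      using nbhds_add4[OF M V'(1)] by metis
    define k where "k = z - (x + y)"
    have "\<pi> k = \<one>" unfolding k_def \<pi>_diff y(2) by simp
    then have k: "k \<in> W" using W(1) by (rule kerM)
    have "\<pi> (z + v) \<in> B x V" if v: "v \<in> W" for v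
    proof -
      have "y + k + v + v' \<in> V" if "v' \<in> W" for v'
        using bspec[OF V'(2) W(2)[OF k v that nbhds_zero[OF M W(1)]]] by (simp add: add.assoc)
      then have "y + k + v \<in> I V" by (rule I_I[OF W(1)])
      then have "\<pi> (x + (y + k + v)) \<in> B x V" by (rule B_I)
      moreover have "x + (y + k + v) = z + v" by (simp add: k_def)
      ultimately show ?thesis by (simp only:)
    qed
    then show "\<exists>V'\<in>M. \<forall>v\<in>V'. \<pi> (z + v) \<in> B x V" using W(1) by (intro bexI ballI)
  qed
  have B_mem: "\<pi> x \<in> B x V" if V: "V \<in> M" for x V
  proof -
    have "0 \<in> I V" by (rule I_I[OF V]) simp
    then show ?thesis using B_I[of 0 V x] by simp
  qed
  have "hausdorff_topological_group G S"
    unfolding hausdorff_topological_group_def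
  proof (intro conjI)
    show "group G" by unfold_locales
    show "topspace S = carrier G" by (rule topS)
    show "Hausdorff_space S"
      unfolding Hausdorff_space_def topS
    proof (intro allI impI)
      fix g h assume gh: "g \<in> carrier G \<and> h \<in> carrier G \<and> g \<noteq> h"
      obtain x where x: "\<pi> x = g" using \<pi>_surj[of g] gh by blast
      obtain y where y: "\<pi> y = h" using \<pi>_surj[of h] gh by blast
      have "y - x \<notin> \<Inter>cover_nbhds"
      proof
        assume "y - x \<in> \<Inter>cover_nbhds"
        then have "\<pi> (y - x) = \<one>" using Inter_nbhds by blast
        then have "\<pi> ((y - x) + x) = \<pi> x" unfolding \<pi>_add by simp
        then show False using gh x y by simp
      qed
      then have "y - x \<notin> \<Inter>M" using ker by (metis subsetD)
      then obtain V where V: "V \<in> M" "y - x \<notin> V" by (auto simp: Inter_iff)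
      obtain W where W: "W \<in> M" "\<And>x y z w. x \<in> W \<Longrightarrow> y \<in> W \<Longrightarrow> z \<in> W \<Longrightarrow> w \<in> W \<Longrightarrow> x + y + (z + w) \<in> V"
        using nbhds_add4[OF M V(1)] by metis
      have "disjnt (B x W) (B y W)"
        unfolding disjnt_def
      proof (rule equals0I)
        fix t assume t: "t \<in> B x W \<inter> B y W"
        obtain a b where ab: "a \<in> I W" "b \<in> I W" "\<pi> (x + a) = \<pi> (y + b)"
          using B_E[OF IntD1[OF t]] B_E[OF IntD2[OF t]] by metis
        have "\<pi> ((y + b) - (x + a)) = \<one>" unfolding \<pi>_diff ab(3) by simp
        then have k: "(y + b) - (x + a) \<in> W" using W(1) by (rule kerM)
        have "a + - b + (((y + b) - (x + a)) + 0) \<in> V"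
          by (rule W(2)[OF I_sub[OF ab(1)] nbhds_uminus[OF M W(1) I_sub[OF ab(2)]] k nbhds_zero[OF M W(1)]])
        moreover have "a + - b + (((y + b) - (x + a)) + 0) = y - x" by simp
        ultimately show False using V(2) by simp
      qed
      then show "\<exists>U V. openin S U \<and> openin S V \<and> g \<in> U \<and> h \<in> V \<and> disjnt U V"
        using B_open[OF W(1)] B_mem[OF W(1), of x] B_mem[OF W(1), of y] unfolding x y by (intro exI conjI)
    qed
    show "continuous_map (prod_topology S S) S (\<lambda>(x, y). x \<otimes> y)"
      unfolding continuous_map
    proof (intro conjI allI impI)
      show "(\<lambda>(x, y). x \<otimes> y) ` topspace (prod_topology S S) \<subseteq> topspace S" by (auto simp: topS)
      fix Q assume Q: "openin S Q"
      show "openin (prod_topology S S) {p \<in> topspace (prod_topology S S). (\<lambda>(x, y). x \<otimes> y) p \<in> Q}"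
        unfolding openin_prod_topology_alt
      proof (intro allI impI)
        fix g h assume gh: "(g, h) \<in> {p \<in> topspace (prod_topology S S). (\<lambda>(x, y). x \<otimes> y) p \<in> Q}"
        then have ghG: "g \<in> carrier G" "h \<in> carrier G" "g \<otimes> h \<in> Q" by (auto simp: topS)
        obtain x where x: "\<pi> x = g" using \<pi>_surj[OF ghG(1)] by (rule exE)
        obtain y where y: "\<pi> y = h" using \<pi>_surj[OF ghG(2)] by (rule exE)
        have xyQ: "\<pi> (x + y) \<in> Q" using ghG(3) by (simp add: \<pi>_add x y)
        obtain V where V: "V \<in> M" "\<forall>v\<in>V. \<pi> (x + y + v) \<in> Q" using opnD[OF Q[unfolded S] xyQ] by (rule bexE)
        obtain W where W: "W \<in> M" "\<And>x y. x \<in> W \<Longrightarrow> y \<in> W \<Longrightarrow> x + y \<in> V" using nbhds_add[OF M V(1)] by metis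
        have "B x W \<times> B y W \<subseteq> {p \<in> topspace (prod_topology S S). (\<lambda>(x, y). x \<otimes> y) p \<in> Q}"
        proof
          fix p assume p: "p \<in> B x W \<times> B y W"
          obtain a where a: "a \<in> I W" "fst p = \<pi> (x + a)" using B_E[of "fst p" x W] p by auto
          obtain b where b: "b \<in> I W" "snd p = \<pi> (y + b)" using B_E[of "snd p" y W] p by auto
          have ab: "p = (\<pi> (x + a), \<pi> (y + b))" using a(2) b(2) by (simp add: prod_eq_iff)
          have "\<pi> (x + y + (a + b)) \<in> Q" using V(2) W(2)[OF I_sub[OF a(1)] I_sub[OF b(1)]] by (rule bspec)
          also have "x + y + (a + b) = (x + a) + (y + b)" by simp
          finally show "p \<in> {p \<in> topspace (prod_topology S S). (\<lambda>(x, y). x \<otimes> y) p \<in> Q}"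
            by (simp only: ab \<pi>_add[of "x + a"]) (simp add: topS)
        qed
        then show "\<exists>U V. openin S U \<and> openin S V \<and> g \<in> U \<and> h \<in> V \<and>
            U \<times> V \<subseteq> {p \<in> topspace (prod_topology S S). (\<lambda>(x, y). x \<otimes> y) p \<in> Q}"
          using B_open[OF W(1)] B_mem[OF W(1), of x] B_mem[OF W(1), of y] unfolding x y by (intro exI conjI)
      qed
    qed
    show "continuous_map S S (\<lambda>x. inv x)"
      unfolding continuous_map
    proof (intro conjI allI impI)
      show "(\<lambda>x. inv x) ` topspace S \<subseteq> topspace S" by (auto simp: topS)
      fix Q assume Q: "openin S Q"
      show "openin S {x \<in> topspace S. inv x \<in> Q}"
        unfolding S
      proof (rule opnI)
        show "{x \<in> topspace S. inv x \<in> Q} \<subseteq> carrier G" by (auto simp: topS)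
        fix x assume "\<pi> x \<in> {x \<in> topspace S. inv x \<in> Q}"
        then have xQ: "\<pi> (- x) \<in> Q" by (simp add: \<pi>_uminus)
        obtain V where V: "V \<in> M" "\<forall>v\<in>V. \<pi> (- x + v) \<in> Q" using opnD[OF Q[unfolded S] xQ] by (rule bexE)
        have "inv \<pi> (x + v) \<in> Q" if v: "v \<in> V" for v
        proof -
          have "\<pi> (- x + - v) \<in> Q" using V(2) nbhds_uminus[OF M V(1) v] by (rule bspec)
          then show ?thesis by (simp only: minus_add_distrib[symmetric] \<pi>_uminus)
        qed
        then show "\<exists>V\<in>M. \<forall>v\<in>V. \<pi> (x + v) \<in> {x \<in> topspace S. inv x \<in> Q}" using V(1) topS by auto
      qed
    qed
  qed
  moreover have "openin T Q" if Q: "openin S Q" for Q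
  proof (rule nbhds_open)
    show "Q \<subseteq> carrier G" using Q unfolding S by (rule opn_sub)
    show "\<exists>V\<in>cover_nbhds. \<forall>v\<in>V. \<pi> (x + v) \<in> Q" if x: "\<pi> x \<in> Q" for x
    proof -
      obtain V where V: "V \<in> M" "\<forall>v\<in>V. \<pi> (x + v) \<in> Q" using opnD[OF Q[unfolded S] x] by (rule bexE)
      then show ?thesis using coarser[OF V(1)] by (meson subsetD)
    qed
  qed
  ultimately have "S = T" by (rule minimal_imp_coarser[OF min])
  show "\<forall>U\<in>cover_nbhds. \<exists>V\<in>M. V \<subseteq> U"
  proof
    fix U assume U: "U \<in> cover_nbhds"
    obtain U' where U': "U' \<in> sym_nbhds" "U = {x. \<pi> x \<in> U'}" using U by (rule nbhdsE)
    have U'': "opn U'" "\<pi> 0 \<in> U'" using \<open>S = T\<close> S U'(1) by (auto simp: sym_nbhds_def)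
    obtain V where "V \<in> M" "\<forall>v\<in>V. \<pi> (0 + v) \<in> U'" using opnD[OF U''] by (rule bexE)
    then show "\<exists>V\<in>M. V \<subseteq> U" using U'(2) by auto
  qed
qed

lemma connected_imp_chain_connected:
  assumes c: "connectedin T c" "\<one> \<in> c"
  shows "chain_connected cover_nbhds {x. \<pi> x \<in> c}"
  unfolding chain_connected_def
proof (intro allI ballI impI)
  fix S W assume W: "W \<in> cover_nbhds" and S0: "0 \<in> S" and step: "\<forall>s\<in>S. \<forall>w\<in>W. s + w \<in> {x. \<pi> x \<in> c} \<longrightarrow> s + w \<in> S"
  obtain U where U: "U \<in> sym_nbhds" "W = {x. \<pi> x \<in> U}" using W by (rule nbhdsE)
  have cG: "c \<subseteq> carrier G" using connectedin_subset_topspace[OF c(1)] by simp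
  define A where "A = {g \<in> c. \<exists>s\<in>S. \<pi> s = g}"
  define E where "E X = (\<Union>g\<in>X. {h \<in> carrier G. inv g \<otimes> h \<in> U})" for X
  have E_open: "openin T (E X)" if "X \<subseteq> c" for X
    unfolding E_def using that cG U(1) by (intro openin_Union ballI) (auto simp: sym_nbhds_def intro!: open_translate)
  have E_sup: "X \<subseteq> E X" if "X \<subseteq> c" for X
  proof
    fix h assume h: "h \<in> X"
    then have "h \<in> carrier G" using that cG by blast
    then show "h \<in> E X" unfolding E_def using U(1) by (intro UN_I[OF h]) (simp add: sym_nbhds_def)
  qed
  have A_step: "h \<in> A" if g: "g \<in> A" and h: "h \<in> c" "inv g \<otimes> h \<in> U" for g h
  proof -
    obtain s where s: "s \<in> S" "\<pi> s = g" "g \<in> c" using g unfolding A_def by blast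
    have gh: "g \<in> carrier G" "h \<in> carrier G" using s h cG by blast+
    obtain w where w: "\<pi> w = inv g \<otimes> h" using \<pi>_surj[of "inv g \<otimes> h"] gh by auto
    have sw: "\<pi> (s + w) = h" using gh by (simp add: \<pi>_add s w m_assoc[symmetric])
    then have "s + w \<in> S" using step s(1) w h U(2) by simp
    then show ?thesis using sw h(1) unfolding A_def by blast
  qed
  have "E A \<inter> E (c - A) \<inter> c = {}"
  proof (rule equals0I)
    fix t assume "t \<in> E A \<inter> E (c - A) \<inter> c"
    then obtain g h where gh: "g \<in> A" "inv g \<otimes> t \<in> U" "h \<in> c - A" "inv h \<otimes> t \<in> U" "t \<in> c" "t \<in> carrier G"
      unfolding E_def by blast
    have hG: "h \<in> carrier G" using gh(3) cG by blast
    have "t \<in> A" by (rule A_step[OF gh(1,5,2)])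
    moreover have "inv t \<otimes> h \<in> U"
    proof -
      have "inv (inv h \<otimes> t) \<in> U" using U(1) gh(4) by (simp add: sym_nbhds_def)
      then show ?thesis using gh(6) hG by (simp add: inv_mult_group)
    qed
    ultimately have "h \<in> A" using A_step gh(3) by blast
    then show False using gh(3) by blast
  qed
  moreover have "A \<subseteq> c" unfolding A_def by blast
  moreover have "c \<subseteq> E A \<union> E (c - A)" using E_sup[of A] E_sup[of "c - A"] \<open>A \<subseteq> c\<close> by blast
  moreover have "E A \<inter> c \<noteq> {}"
  proof -
    have "\<one> \<in> A" unfolding A_def using c(2) S0 by (auto intro!: bexI[of _ 0])
    then show ?thesis using E_sup[OF \<open>A \<subseteq> c\<close>] c(2) by blast
  qed
  ultimately have "E (c - A) \<inter> c = {}"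
    using c(1) E_open[of A] E_open[of "c - A"] unfolding connectedin by (metis Diff_subset)
  then have cA: "c \<subseteq> A" using E_sup[of "c - A"] by blast
  show "{x. \<pi> x \<in> c} \<subseteq> S"
  proof
    fix v assume v: "v \<in> {x. \<pi> x \<in> c}"
    then obtain s where s: "s \<in> S" "\<pi> s = \<pi> v" using cA unfolding A_def by blast
    have "\<pi> (v - s) = \<one>" unfolding \<pi>_diff s(2) by simp
    then have "v - s \<in> W" using U by (simp add: sym_nbhds_def)
    moreover have "s + (v - s) = v" by simp
    ultimately show "v \<in> S" using step[rule_format, OF s(1), of "v - s"] v by simp
  qed
qed

theorem trivial_if_minimal_torsion_free_locally_connected:
  assumes min: "minimal_topological_group G T" and tf: "torsion_free_group G" and lc: "locally_connected_space T"
  shows "trivial_group G"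
proof -
  have minN: "minimal_nbhds cover_nbhds" by (rule minimal_nbhds_nbhds[OF min])
  have tfN: "x \<in> \<Inter>cover_nbhds" if n: "n > 0" and x: "zmul n x \<in> \<Inter>cover_nbhds" for n x
  proof -
    have "\<pi> x [^] nat n = \<one>"
      using hom_zmul[of G \<pi> "nat n" x] n x Inter_nbhds is_group by (simp add: \<pi>_add)
    then have "\<pi> x = \<one>" using tf n unfolding torsion_free_group_def by (metis \<pi>_in zero_less_nat_eq)
    then show ?thesis using Inter_nbhds by blast
  qed
  have big: "big U" if "U \<in> cover_nbhds" for U by (rule minimal_nbhds_precompact[OF minN tfN that])
  obtain m :: "('g \<Rightarrow> real) \<Rightarrow> real" where m: "invariant_mean m" using ex_invariant_mean by blast
  interpret P: precompact_nbhds cover_nbhds m by unfold_locales (fact cover_group_nbhds big m)+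
  have "\<exists>U\<in>cover_nbhds. U \<subseteq> \<Inter>cover_nbhds"
  proof (rule P.chain_connected_imp_discrete)
    fix U assume U: "U \<in> cover_nbhds"
    show "\<exists>V\<in>cover_nbhds. \<forall>x. x + x \<in> V \<longrightarrow> x \<in> U"
    proof -
      have "zmul 2 x \<in> \<Inter>cover_nbhds \<Longrightarrow> x \<in> \<Inter>cover_nbhds" for x by (rule tfN[of 2]) simp_all
      then obtain V where "V \<in> cover_nbhds" "\<And>x. zmul 2 x \<in> V \<Longrightarrow> x \<in> U" using minimal_nbhds_zmul[OF minN _ U, of 2] by metis
      then show ?thesis by (auto simp: zmul_two)
    qed
    obtain U' where U': "U' \<in> sym_nbhds" "U = {x. \<pi> x \<in> U'}" using U by (rule nbhdsE)
    then have "openin T U'" "\<one> \<in> U'" by (simp_all add: sym_nbhds_def)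
    then obtain u c where uc: "openin T u" "connectedin T c" "\<one> \<in> u" "u \<subseteq> c" "c \<subseteq> U'"
      using lc unfolding locally_connected_space_def neighbourhood_base_of by meson
    obtain V where V: "V \<in> sym_nbhds" "V \<subseteq> u" using sym_nbhds_below[OF uc(1,3)] .
    have "chain_connected cover_nbhds {x. \<pi> x \<in> c}" using uc by (intro connected_imp_chain_connected) auto
    moreover have "{x. \<pi> x \<in> V} \<subseteq> {x. \<pi> x \<in> c}" using V(2) uc(4) by blast
    moreover have "{x. \<pi> x \<in> c} \<subseteq> U" using uc(5) U'(2) by blast
    ultimately show "\<exists>V. V \<subseteq> U \<and> chain_connected cover_nbhds V \<and> (\<exists>W\<in>cover_nbhds. W \<subseteq> V)"
      using nbhdsI[OF V(1)] by blast
  qed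
  then obtain U where U: "U \<in> cover_nbhds" "U \<subseteq> {x. \<pi> x = \<one>}" unfolding Inter_nbhds by blast
  obtain F where F: "finite F" "\<And>x. \<exists>f\<in>F. x - f \<in> U" using big[OF U(1)] by (rule bigE) (rule that)
  have "carrier G \<subseteq> \<pi> ` F"
  proof
    fix g assume "g \<in> carrier G"
    then obtain x where x: "\<pi> x = g" using \<pi>_surj by blast
    obtain f where f: "f \<in> F" "x - f \<in> U" using F(2) by blast
    then have "\<pi> (x - f) = \<one>" using U(2) by blast
    then have "\<pi> ((x - f) + f) = \<pi> f" unfolding \<pi>_add by simp
    then show "g \<in> \<pi> ` F" using f(1) x by auto
  qed
  then have fin: "finite (carrier G)" using F(1) finite_surj by blast
  have "g = \<one>" if g: "g \<in> carrier G" for g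
  proof -
    have "range (\<lambda>n::nat. g [^] n) \<subseteq> carrier G" using g by auto
    then have "\<not> inj (\<lambda>n::nat. g [^] n)" using fin finite_subset finite_imageD infinite_UNIV_nat by blast
    then obtain i j :: nat where ij: "i < j" "g [^] i = g [^] j" unfolding inj_def by (metis nat_neq_iff)
    have "g [^] i \<otimes> g [^] (j - i) = g [^] j" using g ij(1) by (simp add: nat_pow_mult)
    then have "g [^] i \<otimes> g [^] (j - i) = g [^] i" using ij(2) by simp
    then have "g [^] (j - i) = \<one>" using g by (metis l_cancel_one nat_pow_closed)
    then show ?thesis using tf g ij(1) unfolding torsion_free_group_def by (metis zero_less_diff)
  qed
  then have "carrier G = {\<one>}" using one_closed by blast
  then show ?thesis unfolding trivial_group_def using is_group by blast
qed

end

theorem theorem2p13: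
  fixes G :: "('a, 'm) monoid_scheme" and T :: "'a topology"
  assumes "comm_group G"
    and "torsion_free_group G"
    and "minimal_topological_group G T"
    and "locally_connected_space T"
  shows "trivial_group G"
proof -
  interpret comm_group G by (rule assms(1))
  obtain h where h: "h \<in> hom (free_Abelian_group UNIV) G"
    "\<And>x. x \<in> UNIV \<Longrightarrow> h (frag_of x) = (if x \<in> carrier G then x else \<one>\<^bsub>G\<^esub>)"
    using free_Abelian_group_universal[of "\<lambda>x. if x \<in> carrier G then x else \<one>\<^bsub>G\<^esub>" UNIV] by auto
  have "hausdorff_abelian_cover G T h"
  proof unfold_locales
    show "hausdorff_topological_group G T" using assms(3) by (simp add: minimal_topological_group_def)
    show "h x \<in> carrier G" for x using h(1) by (auto simp: hom_def)
    show "h (x + y) = h x \<otimes>\<^bsub>G\<^esub> h y" for x y using hom_mult[OF h(1), of x y] by simp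
    show "\<exists>x. h x = g" if "g \<in> carrier G" for g using h(2)[of g] that by auto
  qed
  then show ?thesis
    by (rule hausdorff_abelian_cover.trivial_if_minimal_torsion_free_locally_connected) (fact assms)+
qed

end
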